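(* Let $\theta\in\mathbb R$. The braided gauge Lie algebra $\mathrm{aut}_{\mathcal O(S^4_\theta)}(\mathcal O(SO_\theta(5,\mathbb R)))$ of the $\mathcal O(SO_\theta(4,\mathbb R))$-Hopf--Galois extension $\mathcal O(S^4_\theta)\subset\mathcal O(SO_\theta(5,\mathbb R))$ is generated, as an $\mathcal O(S^4_\theta)$-module, by the elements $$\widetilde K_j:=\mathcal D(K_j)=K_j,\qquad \widetilde W_{\mathsf r}:=\mathcal D(W_{\mathsf r})=W_{\mathsf r}\circ e^{-\pi i\theta(r_1H_2-r_2H_1)},\qquad j=1,2,\ \mathsf r=(r_1,r_2)\in\Gamma,$$ with bracket $$[\widetilde K_1,\widetilde K_2]_{\mathsf R_{\mathsf F}}=\mathcal D([K_1,K_2]),\quad[\widetilde K_j,\widetilde W_{\mathsf r}]_{\mathsf R_{\mathsf F}}=\mathcal D([K_j,W_{\mathsf r}]),\quad[\widetilde W_{\mathsf r},\widetilde W_{\mathsf s}]_{\mathsf R_{\mathsf F}}=e^{-i\pi\theta\,\mathsf r\wedge\mathsf s}\mathcal D([W_{\mathsf r},W_{\mathsf s}]),$$ where $\mathsf r\wedge\mathsf s=r_1s_2-r_2s_1$. The braided Lie bracket of generic elements is given, for $\widetilde X,\widetilde X'\in\mathrm{aut}_{\mathcal O(S^4_\theta)}(\mathcal O(SO_\theta(5,\mathbb R)))$ and $b,b'\in\mathcal O(S^4_\theta)$, by $$[b\bullet_\theta\widetilde X,\,b'\bullet_\theta\widetilde X']_{\mathsf R_{\mathsf F}}=b\bullet_\theta(\mathsf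 R_{\mathsf F\,\alpha}\triangleright b')\bullet_\theta[\mathsf R_{\mathsf F}{}^\alpha\triangleright\widetilde X,\widetilde X']_{\mathsf R_{\mathsf F}},$$ with $\mathcal O(S^4_\theta)$-module structure $(b\bullet_\theta\widetilde X)(a)=b\bullet_\theta\widetilde X(a)$.
   Context: Ground field $\mathbb C$. $\mathcal O(SO(5,\mathbb R))$ is the commutative Hopf algebra generated by the entries of $N=(n_{JK})_{J,K=1,\dots,5}$ with $N^tQN=Q$, $NQN^t=Q$, $\det N=1$, where $Q=\begin{pmatrix} 0 & I_2 & 0 \\ I_2 & 0 & 0 \\ 0 & 0 & 1 \end{pmatrix}$ (with $I_n$ the $n\times n$ identity matrix); $\Delta(n_{JK})=\sum_L n_{JL}\otimes n_{LK}$, $\varepsilon(N)=I_5$, $S(N)=N^{-1}$, and $n_{JK}^*=n_{J'K'}$ with $1'=3,2'=4,3'=1,4'=2,5'=5$. $\mathcal O(SO(4,\mathbb R))$ is its quotient by the Hopf ideal generated by $n_{55}-1,n_{5\nu},n_{\mu5}$ ($\mu,\nu\le4$), with projection $\pi$; the right coaction is $\delta=(\mathrm{id}\otimes\pi)\Delta$. The coinvariants $\mathcal O(S^4)$ are generated by $\alpha=\sqrt2n_{15}$, $\beta=\sqrt2n_{25}$, $\alpha^*=\sqrt2n_{35}$, $\beta^*=\sqrt2n_{45}$, $x=n_{55}$. With $\partial_{IJ}(n_{KL})=\delta_{IK}\delta_{JL}$ and sum over $K=1,\dots,5$ understood, define the (right-invariant) derivations $H_1=n_{1K}\partial_{1K}-n_{3K}\partial_{3K}$,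 $H_2=n_{2K}\partial_{2K}-n_{4K}\partial_{4K}$, $E_{10}=n_{5K}\partial_{3K}-n_{1K}\partial_{5K}$, $E_{-10}=n_{3K}\partial_{5K}-n_{5K}\partial_{1K}$, $E_{01}=n_{5K}\partial_{4K}-n_{2K}\partial_{5K}$, $E_{0-1}=n_{4K}\partial_{5K}-n_{5K}\partial_{2K}$, $E_{11}=n_{2K}\partial_{3K}-n_{1K}\partial_{4K}$, $E_{-1-1}=n_{3K}\partial_{2K}-n_{4K}\partial_{1K}$, $E_{1-1}=n_{4K}\partial_{3K}-n_{1K}\partial_{2K}$, $E_{-11}=n_{3K}\partial_{4K}-n_{2K}\partial_{1K}$, which span a Lie algebra isomorphic to $so(5)$. Let $\Gamma=\{(\pm1,0),(0,\pm1),(\pm1,\pm1)\}$ (eight roots) and $K_1=2xH_2+\sqrt2\beta^*E_{01}+\sqrt2\beta E_{0-1}$, $K_2=2xH_1+\sqrt2\alpha^*E_{10}+\sqrt2\alpha E_{-10}$, $W_{01}=\sqrt2(\beta H_1+\alpha^*E_{11}+\alpha E_{-11})$, $W_{0-1}=\sqrt2(\beta^*H_1+\alpha^*E_{1-1}+\alpha E_{-1-1})$, $W_{10}=\sqrt2(\alpha H_2-\beta^*E_{11}+\beta E_{1-1})$, $W_{-10}=\sqrt2(\alpha^*H_2+\beta^*E_{-11}-\beta E_{-1-1})$, $W_{11}=2xE_{11}+\sqrt2\alpha E_{01}-\sqrt2\beta E_{10}$, $W_{-1-1}=2xE_{-1-1}+\sqrt2\alpha^*E_{0-1}-\sqrt2\beta^*E_{-10}$,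 $W_{1-1}=-2xE_{1-1}+\sqrt2\beta^*E_{10}+\sqrt2\alpha E_{0-1}$, $W_{-11}=-2xE_{-11}+\sqrt2\beta E_{-10}+\sqrt2\alpha^*E_{01}$. These generate, as an $\mathcal O(S^4)$-module, the Lie algebra (under the commutator $[\ ,\ ]$) of derivations of $\mathcal O(SO(5,\mathbb R))$ that commute with $\delta$ and vanish on $\mathcal O(S^4)$. Twisting. $K$ is the universal enveloping algebra of the Lie algebra spanned by the ten derivations $H_1,H_2,E_{\mathsf r}$ ($\mathsf r\in\Gamma$) ($K\simeq U(so(5))^{op}$, acting from the left and commuting with $\delta$), $\mathsf F=e^{\pi i\theta(H_1\otimes H_2-H_2\otimes H_1)}$ with inverse $\bar{\mathsf F}=\bar{\mathsf F}^\alpha\otimes\bar{\mathsf F}_\alpha$; $K_{\mathsf F}$ is $K$ with coproduct $\mathsf F\Delta(\cdot)\bar{\mathsf F}$, triangular with $\mathsf R_{\mathsf F}=\mathsf F_{21}\bar{\mathsf F}=\bar{\mathsf F}^2=\mathsf R_{\mathsf F}{}^\alpha\otimes\mathsf R_{\mathsf F\,\alpha}$ (sums understood). $H_j$ acts on linear maps by $H_j\triangleright\psi=[H_j,\psi]$, so $H_j\triangleright K_l=0$ and $H_j\triangleright W_{\mathsf r}=r_jW_{\mathsf r}$; exponentials in $H_1,H_2$ act on weight vectors by scalars. The Hopf algebra $\mathcal O(SO_\theta(5,\mathbb R))$ is the coalgebra $\mathcal O(SO(5,\mathbb R))$ with 2-cocycle-deformed product: let $\epsilon_1=(1,0)$,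 $\epsilon_2=(0,1)$, $\epsilon_3=-\epsilon_1$, $\epsilon_4=-\epsilon_2$, $\epsilon_5=0$, and give $n_{JK}$ left weight $\epsilon_J$ (its weight under $(H_1,H_2)$) and right weight $\epsilon_K$; for $a,a'$ of left weights $\mathsf l,\mathsf l'$ and right weights $\mathsf p,\mathsf p'$, $a\bullet_\theta a'=e^{-\pi i\theta\,\mathsf l\wedge\mathsf l'}e^{\pi i\theta\,\mathsf p\wedge\mathsf p'}aa'$. $\mathcal O(SO_\theta(4,\mathbb R))$ is its quotient by the Hopf ideal generated by $n_{55}-1,n_{5\nu},n_{\mu5}$, coacting by $\delta=(\mathrm{id}\otimes\pi)\Delta$, and $\mathcal O(S^4_\theta)$ is the subalgebra of coinvariants (the vector space $\mathcal O(S^4)$ with product $\bullet_\theta$). $\mathrm{aut}_{\mathcal O(S^4_\theta)}(\mathcal O(SO_\theta(5,\mathbb R)))$ is the space of linear maps $u$ of $\mathcal O(SO_\theta(5,\mathbb R))$ with $\delta\circ u=(u\otimes\mathrm{id})\circ\delta$, $u(a\bullet_\theta a')=u(a)\bullet_\theta a'+(\mathsf R_{\mathsf F\,\alpha}\triangleright a)\bullet_\theta(\mathsf R_{\mathsf F}{}^\alpha\triangleright u)(a')$, $u(b)=0$ for $b\in\mathcal O(S^4_\theta)$, with bracket $[u,u']_{\mathsf R_{\mathsf F}}=u\circ u'-(\mathsf R_{\mathsf F\,\alpha}\triangleright u')\circ(\mathsf R_{\mathsf F}{}^\alpha\triangleright u)$; it is a $K_{\mathsf F}$-braided Lie algebra.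 The map $\mathcal D$ is $\mathcal D(u)(a)=(\bar{\mathsf F}^\alpha\triangleright u)(\bar{\mathsf F}_\alpha\triangleright a)$. *)

theory Defs
  imports "HOL-Analysis.Analysis" "HOL-Library.Poly_Mapping"
begin

section \<open>Complex vector spaces, commutative algebras and tensor products\<close>

class complex_vec = ab_group_add +
  fixes scaleC :: "complex \<Rightarrow> 'a \<Rightarrow> 'a" (infixr \<open>*\<^sub>C\<close> 75)
  assumes scaleC_add_right: "c *\<^sub>C (x + y) = c *\<^sub>C x + c *\<^sub>C y"
    and scaleC_add_left: "(c + d) *\<^sub>C x = c *\<^sub>C x + d *\<^sub>C x"
    and scaleC_scaleC [simp]: "c *\<^sub>C d *\<^sub>C x = (c * d) *\<^sub>C x"
    and scaleC_one [simp]: "1 *\<^sub>C x = x"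

class complex_comm_algebra = comm_ring_1 + complex_vec +
  assumes scaleC_mult_left [simp]: "(c *\<^sub>C x) * y = c *\<^sub>C (x * y)"

global_interpretation cvec: vector_space "scaleC :: complex \<Rightarrow> 'a \<Rightarrow> 'a::complex_vec"
  by unfold_locales (simp_all add: scaleC_add_right scaleC_add_left)

abbreviation cspan :: "'a::complex_vec set \<Rightarrow> 'a set"
  where "cspan \<equiv> module.span scaleC"

abbreviation clinear :: "('a::complex_vec \<Rightarrow> 'b::complex_vec) \<Rightarrow> bool"
  where "clinear \<equiv> Vector_Spaces.linear scaleC scaleC"

lemma clinearI:
  assumes "\<And>x y. f (x + y) = f x + f y" and "\<And>c x. f (c *\<^sub>C x) = c *\<^sub>C f x"
  shows "clinear f"
  using assms by unfold_locales auto

lemma clinearD: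
  assumes "clinear f"
  shows "f (x + y) = f x + f y" "f (c *\<^sub>C x) = c *\<^sub>C f x" "f 0 = 0" "f (- x) = - f x"
    "f (x - y) = f x - f y" "f (sum g S) = (\<Sum>a\<in>S. f (g a))"
proof -
  interpret Vector_Spaces.linear scaleC scaleC f by fact
  show "f (x + y) = f x + f y" "f (c *\<^sub>C x) = c *\<^sub>C f x" "f 0 = 0" "f (- x) = - f x"
    "f (x - y) = f x - f y" "f (sum g S) = (\<Sum>a\<in>S. f (g a))"
    by (simp_all add: add scale zero neg diff sum)
qed

lemma scaleC_mult_right [simp]: "(x::'a::complex_comm_algebra) * (c *\<^sub>C y) = c *\<^sub>C (x * y)"
  by (metis mult.commute scaleC_mult_left)

instantiation complex :: complex_comm_algebra
begin
definition scaleC_complex :: "complex \<Rightarrow> complex \<Rightarrow> complex" where "scaleC_complex = (*)"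
instance by standard (simp_all add: scaleC_complex_def algebra_simps)
end

instantiation poly_mapping :: (type, complex_vec) complex_vec
begin
definition scaleC_poly_mapping :: "complex \<Rightarrow> ('a \<Rightarrow>\<^sub>0 'b) \<Rightarrow> ('a \<Rightarrow>\<^sub>0 'b)"
  where "scaleC_poly_mapping c = Poly_Mapping.map (scaleC c)"
instance
proof -
  have "poly_mapping.lookup (Poly_Mapping.map (scaleC c) f) k = c *\<^sub>C poly_mapping.lookup f k"
    for c :: complex and f :: "'a \<Rightarrow>\<^sub>0 'b" and k
    by (simp add: map.rep_eq when_def)
  then show "OFCLASS('a \<Rightarrow>\<^sub>0 'b, complex_vec_class)"
    by intro_classes
       (auto intro!: poly_mapping_eqI simp: scaleC_poly_mapping_def lookup_add scaleC_add_right scaleC_add_left)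
qed
end

lemma lookup_scaleC [simp]: "poly_mapping.lookup (c *\<^sub>C f) k = c *\<^sub>C poly_mapping.lookup f k"
  by (auto simp: scaleC_poly_mapping_def map.rep_eq when_def)

lemma scaleC_single [simp]: "c *\<^sub>C Poly_Mapping.single k x = Poly_Mapping.single k (c *\<^sub>C x)"
  by (rule poly_mapping_eqI) (simp add: lookup_single when_def)

instance poly_mapping :: (comm_monoid_add, complex_comm_algebra) complex_comm_algebra
proof
  fix c :: complex and x y :: "'a \<Rightarrow>\<^sub>0 'b"
  have "c *\<^sub>C z = Poly_Mapping.single 0 (c *\<^sub>C 1) * z" for z :: "'a \<Rightarrow>\<^sub>0 'b"
  proof -
    have "Poly_Mapping.map ((*) (c *\<^sub>C 1)) z = Poly_Mapping.single 0 (c *\<^sub>C 1) * z"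
      by (rule mult_map_scale_conv_mult)
    moreover have "(*) (c *\<^sub>C 1 :: 'b) = scaleC c" by (rule ext) simp
    ultimately show ?thesis by (simp add: scaleC_poly_mapping_def)
  qed
  then show "(c *\<^sub>C x) * y = c *\<^sub>C (x * y)" by (simp add: mult.assoc)
qed

text \<open>The tensor product is the quotient of the vector space with basis the pairs \<open>(a, b)\<close> by the
bilinearity relations.\<close>

definition tensor_relators :: "('a::complex_vec \<times> 'b::complex_vec \<Rightarrow>\<^sub>0 complex) set"
  where "tensor_relators =
     {Poly_Mapping.single (a + a', b) 1 - Poly_Mapping.single (a, b) 1 - Poly_Mapping.single (a', b) 1 | a a' b. True}
   \<union> {Poly_Mapping.single (a, b + b') 1 - Poly_Mapping.single (a, b) 1 - Poly_Mapping.single (a, b') 1 | a b b'. True}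
   \<union> {Poly_Mapping.single (c *\<^sub>C a, b) 1 - Poly_Mapping.single (a, b) c | c a b. True}
   \<union> {Poly_Mapping.single (a, c *\<^sub>C b) 1 - Poly_Mapping.single (a, b) c | c a b. True}"

definition tensor_eq :: "('a::complex_vec \<times> 'b::complex_vec \<Rightarrow>\<^sub>0 complex) \<Rightarrow> _ \<Rightarrow> bool"
  where "tensor_eq f g \<longleftrightarrow> f - g \<in> cspan tensor_relators"

quotient_type (overloaded) ('a, 'b) tensor =
  "'a::complex_vec \<times> 'b::complex_vec \<Rightarrow>\<^sub>0 complex" / tensor_eq
proof (rule equivpI)
  show "reflp tensor_eq" by (rule reflpI) (simp add: tensor_eq_def cvec.span_zero)
  show "symp tensor_eq"
    unfolding tensor_eq_def by (rule sympI, drule cvec.span_neg) simp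
  show "transp tensor_eq"
    unfolding tensor_eq_def by (rule transpI, drule (1) cvec.span_add) simp
qed

instantiation tensor :: (complex_vec, complex_vec) complex_vec
begin
lift_definition zero_tensor :: "('a, 'b) tensor" is 0 .
lift_definition plus_tensor :: "('a, 'b) tensor \<Rightarrow> ('a, 'b) tensor \<Rightarrow> ('a, 'b) tensor" is "(+)"
  unfolding tensor_eq_def by (drule (1) cvec.span_add) (simp add: algebra_simps)
lift_definition minus_tensor :: "('a, 'b) tensor \<Rightarrow> ('a, 'b) tensor \<Rightarrow> ('a, 'b) tensor" is "(-)"
  unfolding tensor_eq_def
  by (drule (1) cvec.span_diff) (simp add: algebra_simps)
lift_definition uminus_tensor :: "('a, 'b) tensor \<Rightarrow> ('a, 'b) tensor" is uminus
  unfolding tensor_eq_def by (drule cvec.span_neg) (simp add: algebra_simps)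
lift_definition scaleC_tensor :: "complex \<Rightarrow> ('a, 'b) tensor \<Rightarrow> ('a, 'b) tensor" is scaleC
  unfolding tensor_eq_def by (simp add: cvec.scale_right_diff_distrib [symmetric] cvec.span_scale)
instance
  by standard (transfer; simp add: tensor_eq_def cvec.span_zero scaleC_add_right scaleC_add_left ac_simps)+
end

lift_definition tensor :: "'a::complex_vec \<Rightarrow> 'b::complex_vec \<Rightarrow> ('a, 'b) tensor" (infixr \<open>\<otimes>\<^sub>C\<close> 76)
  is "\<lambda>a b. Poly_Mapping.single (a, b) 1" .

lemma tensor_add_left: "(a + a') \<otimes>\<^sub>C b = a \<otimes>\<^sub>C b + a' \<otimes>\<^sub>C b"
  apply transfer
  unfolding tensor_eq_def diff_diff_eq [symmetric] tensor_relators_def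
  by (rule cvec.span_base) blast

lemma tensor_add_right: "a \<otimes>\<^sub>C (b + b') = a \<otimes>\<^sub>C b + a \<otimes>\<^sub>C b'"
  apply transfer
  unfolding tensor_eq_def diff_diff_eq [symmetric] tensor_relators_def
  by (rule cvec.span_base) blast

lemma tensor_scaleC_left: "(c *\<^sub>C a) \<otimes>\<^sub>C b = c *\<^sub>C (a \<otimes>\<^sub>C b)"
  apply transfer
  unfolding tensor_eq_def tensor_relators_def scaleC_single scaleC_complex_def mult_1_right
  by (rule cvec.span_base) blast

lemma tensor_scaleC_right: "a \<otimes>\<^sub>C (c *\<^sub>C b) = c *\<^sub>C (a \<otimes>\<^sub>C b)"
  apply transfer
  unfolding tensor_eq_def tensor_relators_def scaleC_single scaleC_complex_def mult_1_right
  by (rule cvec.span_base) blast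

definition bilinearC :: "('a::complex_vec \<Rightarrow> 'b::complex_vec \<Rightarrow> 'c::complex_vec) \<Rightarrow> bool"
  where "bilinearC \<phi> \<longleftrightarrow> (\<forall>b. clinear (\<lambda>a. \<phi> a b)) \<and> (\<forall>a. clinear (\<phi> a))"

definition free_extend :: "('k \<Rightarrow> 'c::complex_vec) \<Rightarrow> ('k \<Rightarrow>\<^sub>0 complex) \<Rightarrow> 'c"
  where "free_extend \<phi> f = (\<Sum>k\<in>Poly_Mapping.keys f. poly_mapping.lookup f k *\<^sub>C \<phi> k)"

lemma free_extend_superset:
  assumes "finite S" "Poly_Mapping.keys f \<subseteq> S"
  shows "free_extend \<phi> f = (\<Sum>k\<in>S. poly_mapping.lookup f k *\<^sub>C \<phi> k)"
  unfolding free_extend_def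
  by (rule sum.mono_neutral_left) (use assms in \<open>auto simp: in_keys_iff\<close>)

lemma free_extend_single [simp]: "free_extend \<phi> (Poly_Mapping.single k c) = c *\<^sub>C \<phi> k"
  by (subst free_extend_superset [of "{k}"]) auto

lemma clinear_free_extend: "clinear (free_extend \<phi>)"
proof (rule clinearI)
  fix f g :: "'a \<Rightarrow>\<^sub>0 complex" and c
  let ?S = "Poly_Mapping.keys f \<union> Poly_Mapping.keys g \<union> Poly_Mapping.keys (f + g)"
  have "free_extend \<phi> (f + g) = (\<Sum>k\<in>?S. poly_mapping.lookup (f + g) k *\<^sub>C \<phi> k)"
    by (rule free_extend_superset) auto
  also have "\<dots> = (\<Sum>k\<in>?S. poly_mapping.lookup f k *\<^sub>C \<phi> k) + (\<Sum>k\<in>?S. poly_mapping.lookup g k *\<^sub>C \<phi> k)"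
    by (simp add: lookup_add scaleC_add_left sum.distrib)
  also have "(\<Sum>k\<in>?S. poly_mapping.lookup f k *\<^sub>C \<phi> k) = free_extend \<phi> f"
    by (rule free_extend_superset [symmetric]) auto
  also have "(\<Sum>k\<in>?S. poly_mapping.lookup g k *\<^sub>C \<phi> k) = free_extend \<phi> g"
    by (rule free_extend_superset [symmetric]) auto
  finally show "free_extend \<phi> (f + g) = free_extend \<phi> f + free_extend \<phi> g" .
  have "free_extend \<phi> (c *\<^sub>C f) = (\<Sum>k\<in>Poly_Mapping.keys f. poly_mapping.lookup (c *\<^sub>C f) k *\<^sub>C \<phi> k)"
    by (rule free_extend_superset) (auto simp: in_keys_iff)
  then show "free_extend \<phi> (c *\<^sub>C f) = c *\<^sub>C free_extend \<phi> f"
    by (simp add: free_extend_def scaleC_complex_def cvec.scale_sum_right)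
qed

text \<open>The representative chosen here is irrelevant whenever \<open>\<phi>\<close> is bilinear, see \<open>tensor_lift_tensor\<close>.\<close>

definition tensor_lift :: "('a::complex_vec \<Rightarrow> 'b::complex_vec \<Rightarrow> 'c::complex_vec) \<Rightarrow> ('a, 'b) tensor \<Rightarrow> 'c"
  where "tensor_lift \<phi> t = free_extend (\<lambda>(a, b). \<phi> a b) (rep_tensor t)"

lemma tensor_lift_abs:
  assumes "bilinearC \<phi>"
  shows "tensor_lift \<phi> (abs_tensor f) = free_extend (\<lambda>(a, b). \<phi> a b) f"
proof -
  let ?L = "free_extend (\<lambda>(a, b). \<phi> a b)"
  note L = clinearD [OF clinear_free_extend, of "\<lambda>(a, b). \<phi> a b"]
  have \<phi>: "clinear (\<lambda>a. \<phi> a b)" "clinear (\<phi> a)" for a b using assms by (auto simp: bilinearC_def)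
  have "?L g = 0" if "g \<in> cspan tensor_relators" for g
    using that
  proof (induction rule: cvec.span_induct_alt)
    case base
    show ?case by (rule L)
  next
    case (step c x y)
    from step(1) have "?L x = 0"
      by (auto simp: tensor_relators_def L clinearD [OF \<phi>(1)] clinearD [OF \<phi>(2)])
    with step show ?case by (simp add: L)
  qed
  moreover have "rep_tensor (abs_tensor f) - f \<in> cspan tensor_relators"
    by (metis Quotient3_abs_rep [OF Quotient3_tensor] tensor.abs_eq_iff tensor_eq_def)
  ultimately have "?L (rep_tensor (abs_tensor f) - f) = 0" by blast
  then show ?thesis by (simp add: L tensor_lift_def)
qed

lemma tensor_lift_tensor [simp]:
  "bilinearC \<phi> \<Longrightarrow> tensor_lift \<phi> (a \<otimes>\<^sub>C b) = \<phi> a b"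
  by (simp add: tensor.abs_eq tensor_lift_abs)

lemma clinear_tensor_lift:
  assumes "bilinearC \<phi>"
  shows "clinear (tensor_lift \<phi>)"
proof (rule clinearI)
  note L = clinearD [OF clinear_free_extend, of "\<lambda>(a, b). \<phi> a b"]
  fix s t :: "('a, 'b) tensor" and c
  obtain f g where "s = abs_tensor f" "t = abs_tensor g"
    by (metis Quotient3_abs_rep [OF Quotient3_tensor])
  then show "tensor_lift \<phi> (s + t) = tensor_lift \<phi> s + tensor_lift \<phi> t"
    and "tensor_lift \<phi> (c *\<^sub>C s) = c *\<^sub>C tensor_lift \<phi> s"
    by (simp_all add: plus_tensor.abs_eq scaleC_tensor.abs_eq tensor_lift_abs [OF assms] L)
qed

lemma poly_mapping_induct_add [case_names zero step]:
  fixes f :: "'k \<Rightarrow>\<^sub>0 complex"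
  assumes "P 0" and "\<And>k c f. P f \<Longrightarrow> P (f + Poly_Mapping.single k c)"
  shows "P f"
proof (induction "card (Poly_Mapping.keys f)" arbitrary: f)
  case 0
  then show ?case using assms(1) by simp
next
  case (Suc n)
  then obtain k where k: "k \<in> Poly_Mapping.keys f" by fastforce
  let ?g = "f - Poly_Mapping.single k (poly_mapping.lookup f k)"
  have "Poly_Mapping.keys ?g = Poly_Mapping.keys f - {k}"
    by (auto simp: in_keys_iff lookup_minus lookup_single when_def split: if_splits)
  then have "P ?g" using Suc k by simp
  from assms(2) [OF this, of k "poly_mapping.lookup f k"] show ?case by simp
qed

lemma tensor_induct [case_names zero tensor add]:
  fixes t :: "('a::complex_vec, 'b::complex_vec) tensor"
  assumes "P 0" and "\<And>a b. P (a \<otimes>\<^sub>C b)" and "\<And>s t. P s \<Longrightarrow> P t \<Longrightarrow> P (s + t)"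
  shows "P t"
proof -
  have "P (abs_tensor f)" for f
  proof (induction f rule: poly_mapping_induct_add)
    case zero
    then show ?case using assms(1) by (simp add: zero_tensor_def)
  next
    case (step k c f)
    obtain a b where k: "k = (a, b)" by (cases k)
    have "abs_tensor (f + Poly_Mapping.single k c) = abs_tensor f + (c *\<^sub>C a) \<otimes>\<^sub>C b"
      unfolding tensor_scaleC_left k
      by (simp add: tensor.abs_eq scaleC_tensor.abs_eq plus_tensor.abs_eq scaleC_complex_def)
    then show ?case using assms step by metis
  qed
  then show ?thesis by (metis Quotient3_abs_rep [OF Quotient3_tensor])
qed

definition tensor_map ::
  "('a::complex_vec \<Rightarrow> 'c::complex_vec) \<Rightarrow> ('b::complex_vec \<Rightarrow> 'd::complex_vec) \<Rightarrow> ('a, 'b) tensor \<Rightarrow> ('c, 'd) tensor"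
  where "tensor_map u v = tensor_lift (\<lambda>a b. u a \<otimes>\<^sub>C v b)"

lemmas tensor_bilinear = tensor_add_left tensor_add_right tensor_scaleC_left tensor_scaleC_right

lemma bilinearC_tensor: "clinear u \<Longrightarrow> clinear v \<Longrightarrow> bilinearC (\<lambda>a b. u a \<otimes>\<^sub>C v b)"
  by (auto simp: bilinearC_def clinearD tensor_bilinear intro!: clinearI)

lemma clinear_times: "clinear ((*) a)" for a :: "'x::complex_comm_algebra"
  by (rule clinearI) (simp_all add: distrib_left)

lemma tensor_map_times_tensor: "tensor_map ((*) a) ((*) b) (c \<otimes>\<^sub>C d) = (a * c) \<otimes>\<^sub>C (b * d)"
  for a c :: "'a::complex_comm_algebra" and b d :: "'b::complex_comm_algebra"
  by (simp add: tensor_map_def bilinearC_tensor clinear_times)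

lemma clinear_tensor_map: "clinear u \<Longrightarrow> clinear v \<Longrightarrow> clinear (tensor_map u v)"
  unfolding tensor_map_def by (intro clinear_tensor_lift bilinearC_tensor)

lemma bilinearC_tensor_map_times: "bilinearC (\<lambda>a b. tensor_map ((*) a) ((*) b) t)"
  for t :: "('a::complex_comm_algebra, 'b::complex_comm_algebra) tensor"
proof -
  note M = clinearD [OF clinear_tensor_map [OF clinear_times clinear_times]]
  show ?thesis
    unfolding bilinearC_def
    by (intro conjI allI clinearI; induction t rule: tensor_induct)
       (simp_all add: M tensor_map_times_tensor distrib_right tensor_bilinear scaleC_add_right)
qed

instantiation tensor :: (complex_comm_algebra, complex_comm_algebra) complex_comm_algebra
begin

definition one_tensor :: "('a, 'b) tensor" where "one_tensor = 1 \<otimes>\<^sub>C 1"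

definition times_tensor :: "('a, 'b) tensor \<Rightarrow> ('a, 'b) tensor \<Rightarrow> ('a, 'b) tensor"
  where "times_tensor s t = tensor_lift (\<lambda>a b. tensor_map ((*) a) ((*) b) t) s"

instance
proof -
  note M = clinearD [OF clinear_tensor_map [OF clinear_times clinear_times]]
  note m3 = bilinearC_tensor_map_times
  have t1 [simp]: "(a \<otimes>\<^sub>C b) * (c \<otimes>\<^sub>C d) = (a * c) \<otimes>\<^sub>C (b * d)" for a c :: 'a and b d :: 'b
    unfolding times_tensor_def by (subst tensor_lift_tensor [OF m3]) (rule tensor_map_times_tensor)
  have t2: "clinear (\<lambda>s. s * t)" for t :: "('a, 'b) tensor"
    unfolding times_tensor_def by (rule clinear_tensor_lift [OF m3])
  have comm: "s * t = t * s" if "\<And>a b. (a \<otimes>\<^sub>C b) * t = t * (a \<otimes>\<^sub>C b)" and "t * 0 = 0"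
      "\<And>x y. t * (x + y) = t * x + t * y" for s t :: "('a, 'b) tensor"
    by (induction s rule: tensor_induct) (simp_all add: that clinearD [OF t2])
  have t3: "t * (x + y) = t * x + t * y" "t * 0 = 0" for x y t :: "('a, 'b) tensor"
  proof -
    have *: "(a \<otimes>\<^sub>C b) * s = tensor_map ((*) a) ((*) b) s" for a b and s :: "('a, 'b) tensor"
      unfolding times_tensor_def by (rule tensor_lift_tensor [OF m3])
    show "t * (x + y) = t * x + t * y" "t * 0 = 0"
      by (induction t rule: tensor_induct) (simp_all add: clinearD [OF t2] * M)
  qed
  have c: "s * t = t * s" for s t :: "('a, 'b) tensor"
  proof (rule comm)
    show "(a \<otimes>\<^sub>C b) * t = t * (a \<otimes>\<^sub>C b)" for a b
      by (induction t rule: tensor_induct) (simp_all add: t3 clinearD [OF t2] mult.commute)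
  qed (rule t3)+
  have a: "(s * t) * r = s * (t * r)" for s t r :: "('a, 'b) tensor"
  proof (induction s rule: tensor_induct)
    case (tensor a b)
    show ?case
    proof (induction t rule: tensor_induct)
      case (tensor c d)
      show ?case
        by (induction r rule: tensor_induct) (simp_all add: t3 clinearD [OF t2] mult.assoc)
    qed (simp_all add: t3 clinearD [OF t2])
  qed (simp_all add: t3 clinearD [OF t2])
  have ex: "\<exists>f. clinear f \<and> f (1::'x::complex_comm_algebra) = (1::complex)"
  proof -
    interpret vector_space_pair "scaleC :: complex \<Rightarrow> 'x \<Rightarrow> 'x" "scaleC :: complex \<Rightarrow> complex \<Rightarrow> complex" ..
    have "\<not> module.dependent scaleC {1::'x}" by (simp add: cvec.dependent_single)
    from linear_independent_extend [OF this, of "\<lambda>_. 1"] show ?thesis by auto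
  qed
  have nz: "(0 :: ('a, 'b) tensor) \<noteq> 1"
  proof -
    obtain f :: "'a \<Rightarrow> complex" where f: "clinear f" "f 1 = 1" using ex by blast
    obtain g :: "'b \<Rightarrow> complex" where g: "clinear g" "g 1 = 1" using ex by blast
    have bl: "bilinearC (\<lambda>a b. f a * g b)"
      by (auto simp: bilinearC_def clinearD [OF f(1)] clinearD [OF g(1)] algebra_simps intro!: clinearI)
    have "tensor_lift (\<lambda>a b. f a * g b) (1 \<otimes>\<^sub>C 1) = 1" using bl f g by simp
    moreover have "tensor_lift (\<lambda>a b. f a * g b) 0 = 0" by (rule clinearD [OF clinear_tensor_lift [OF bl]])
    ultimately show ?thesis unfolding one_tensor_def by force
  qed
  have o: "1 * t = t" for t :: "('a, 'b) tensor"
    by (induction t rule: tensor_induct) (simp_all add: t3 one_tensor_def)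
  show "OFCLASS(('a, 'b) tensor, complex_comm_algebra_class)"
    by intro_classes (fact a c o nz clinearD [OF t2] | simp add: clinearD [OF t2])+
qed

end

lemma tensor_mult [simp]: "(a \<otimes>\<^sub>C b) * (c \<otimes>\<^sub>C d) = (a * c) \<otimes>\<^sub>C (b * d)"
  for a c :: "'a::complex_comm_algebra" and b d :: "'b::complex_comm_algebra"
  unfolding times_tensor_def
  by (subst tensor_lift_tensor [OF bilinearC_tensor_map_times]) (rule tensor_map_times_tensor)

section \<open>The coordinate ring of \<open>SO(5)\<close>\<close>

type_synonym poly25 = "(5 \<times> 5 \<Rightarrow>\<^sub>0 nat) \<Rightarrow>\<^sub>0 complex"

text \<open>The index type \<open>5\<close> consists of \<open>1, 2, 3, 4, 5\<close> (with \<open>5 = 0\<close>). Polynomials in the 25 indeterminates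
\<open>var J K\<close> are finitely supported functions on the monomials.\<close>

definition var :: "5 \<Rightarrow> 5 \<Rightarrow> poly25"
  where "var J K = Poly_Mapping.single (Poly_Mapping.single (J, K) 1) 1"

definition prime_idx :: "5 \<Rightarrow> 5"
  where "prime_idx J = (if J = 1 then 3 else if J = 2 then 4 else if J = 3 then 1 else if J = 4 then 2 else 5)"

definition Qmat :: "'a::comm_ring_1^5^5"
  where "Qmat = (\<chi> J K. if (J, K) \<in> {(1, 3), (2, 4), (3, 1), (4, 2), (5, 5)} then 1 else 0)"

definition so5_relators :: "poly25 set"
  where "so5_relators = (let N = (\<chi> J K. var J K) in
      {(transpose N ** Qmat ** N - Qmat) $ J $ K | J K. True}
    \<union> {(N ** Qmat ** transpose N - Qmat) $ J $ K | J K. True}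
    \<union> {det N - 1})"

global_interpretation ideals: module "(*) :: 'a \<Rightarrow> 'a \<Rightarrow> 'a::comm_ring_1"
  by unfold_locales (simp_all add: algebra_simps)

declare ideals.scale_scale [simp del]

abbreviation ideal_gen :: "'a::comm_ring_1 set \<Rightarrow> 'a set"
  where "ideal_gen \<equiv> module.span (*)"

subsection \<open>Auxiliary facts\<close>

lemma exhaust_5:
  fixes x :: 5
  shows "x = 1 \<or> x = 2 \<or> x = 3 \<or> x = 4 \<or> x = 5"
proof (induct x)
  case (of_int z)
  then have "0 \<le> z" and "z < 5" by simp_all
  then have "z = 0 \<or> z = 1 \<or> z = 2 \<or> z = 3 \<or> z = 4" by arith
  then show ?case by auto
qed

lemma distinct_5 [simp]:
  "(1::5) \<noteq> 2" "(1::5) \<noteq> 3" "(1::5) \<noteq> 4" "(1::5) \<noteq> 5" "(2::5) \<noteq> 3" "(2::5) \<noteq> 4" "(2::5) \<noteq> 5"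
  "(3::5) \<noteq> 4" "(3::5) \<noteq> 5" "(4::5) \<noteq> 5"
  "(2::5) \<noteq> 1" "(3::5) \<noteq> 1" "(4::5) \<noteq> 1" "(5::5) \<noteq> 1" "(3::5) \<noteq> 2" "(4::5) \<noteq> 2" "(5::5) \<noteq> 2"
  "(4::5) \<noteq> 3" "(5::5) \<noteq> 3" "(5::5) \<noteq> 4"
  by simp_all

lemma prime_idx_simps [simp]:
  "prime_idx 1 = 3" "prime_idx 2 = 4" "prime_idx 3 = 1" "prime_idx 4 = 2" "prime_idx 5 = 5"
  by (simp_all add: prime_idx_def)

lemma prime_prime [simp]: "prime_idx (prime_idx J) = J"
  using exhaust_5 [of J] by auto

lemma Qmat_nth: "(Qmat::'a::comm_ring_1^5^5) $ J $ K = (if K = prime_idx J then 1 else 0)"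
  using exhaust_5 [of J] exhaust_5 [of K] by (elim disjE) (simp_all add: Qmat_def)

definition map_mat :: "('a \<Rightarrow> 'b) \<Rightarrow> 'a^5^5 \<Rightarrow> 'b^5^5"
  where "map_mat h A = (\<chi> i j. h (A $ i $ j))"

lemma map_mat_nth [simp]: "map_mat h A $ i $ j = h (A $ i $ j)"
  by (simp add: map_mat_def)

lemma mat5_eqI: "(\<And>i j. A $ i $ j = B $ i $ j) \<Longrightarrow> A = (B :: 'a^5^5)"
  by (simp add: vec_eq_iff)

locale unital_ring_hom =
  fixes h :: "'a::comm_ring_1 \<Rightarrow> 'b::comm_ring_1"
  assumes add: "h (x + y) = h x + h y" and mult: "h (x * y) = h x * h y" and one [simp]: "h 1 = 1"
begin

lemma zero [simp]: "h 0 = 0" using add [of 0 0] by simp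
lemma minus: "h (- x) = - h x" using add [of "-x" x] by (simp add: eq_neg_iff_add_eq_0)
lemma diff: "h (x - y) = h x - h y" using add [of x "-y"] by (simp add: minus)
lemma sum: "h (sum f S) = (\<Sum>x\<in>S. h (f x))" by (induction S rule: infinite_finite_induct) (auto simp: add)
lemma prod: "h (prod f S) = (\<Prod>x\<in>S. h (f x))" by (induction S rule: infinite_finite_induct) (auto simp: mult)
lemma power: "h (x ^ n) = h x ^ n" by (induction n) (auto simp: mult)
lemma of_int: "h (of_int k) = of_int k"
proof -
  have n: "h (of_nat n) = of_nat n" for n by (induction n) (auto simp: add)
  show ?thesis by (cases k rule: int_cases2) (simp_all add: n minus)
qed
lemma map_mult: "map_mat h (A ** B) = map_mat h A ** map_mat h B"
  by (rule mat5_eqI) (simp add: matrix_matrix_mult_def sum mult)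
lemma map_transpose: "map_mat h (transpose A) = transpose (map_mat h A)"
  by (rule mat5_eqI) (simp add: transpose_def)
lemma map_diff: "map_mat h (A - B) = map_mat h A - map_mat h B"
  by (rule mat5_eqI) (simp add: diff)
lemma map_Q [simp]: "map_mat h Qmat = Qmat"
  by (rule mat5_eqI) (simp add: Qmat_nth)
lemma map_det: "h (det A) = det (map_mat h A)"
  unfolding det_def by (simp add: sum mult prod of_int)
end

definition so5_mat :: "'a::comm_ring_1^5^5 \<Rightarrow> bool"
  where "so5_mat N \<longleftrightarrow> transpose N ** Qmat ** N = Qmat \<and> N ** Qmat ** transpose N = Qmat \<and> det N = 1"

lemma (in unital_ring_hom) so5_mat_map: "so5_mat A \<Longrightarrow> so5_mat (map_mat h A)"
  unfolding so5_mat_def by (metis map_Q map_det map_mult map_transpose one)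

lemma so5_mat_mult: "so5_mat A \<Longrightarrow> so5_mat B \<Longrightarrow> so5_mat (A ** B)"
proof -
  assume "so5_mat A" "so5_mat B"
  note A = this(1) [unfolded so5_mat_def] and B = this(2) [unfolded so5_mat_def]
  have "transpose (A ** B) ** Qmat ** (A ** B) = transpose B ** (transpose A ** Qmat ** A) ** B"
    by (simp add: matrix_transpose_mul matrix_mul_assoc)
  moreover have "(A ** B) ** Qmat ** transpose (A ** B) = A ** (B ** Qmat ** transpose B) ** transpose A"
    by (simp add: matrix_transpose_mul matrix_mul_assoc)
  ultimately show ?thesis using A B by (simp add: so5_mat_def det_mul)
qed

definition eval_poly :: "('a::complex_comm_algebra)^5^5 \<Rightarrow> poly25 \<Rightarrow> 'a"
  where "eval_poly A = free_extend (\<lambda>m. \<Prod>(J, K)\<in>UNIV. A $ J $ K ^ poly_mapping.lookup m (J, K))"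

lemma eval_poly_single:
  "eval_poly A (Poly_Mapping.single m c) = c *\<^sub>C (\<Prod>(J, K)\<in>UNIV. A $ J $ K ^ poly_mapping.lookup m (J, K))"
  by (simp add: eval_poly_def)

lemma clinear_eval_poly: "clinear (eval_poly A)"
  unfolding eval_poly_def by (rule clinear_free_extend)

lemma unital_ring_hom_eval: "unital_ring_hom (eval_poly A)"
proof
  note L = clinearD [OF clinear_eval_poly, of A]
  fix p q :: poly25
  show "eval_poly A (p + q) = eval_poly A p + eval_poly A q" by (rule L)
  show "eval_poly A 1 = 1"
    unfolding single_one [symmetric] eval_poly_single by (simp add: case_prod_unfold)
  show "eval_poly A (p * q) = eval_poly A p * eval_poly A q"
  proof (induction p rule: poly_mapping_induct_add)
    case (step m c p)
    have "eval_poly A (Poly_Mapping.single m c * q) = eval_poly A (Poly_Mapping.single m c) * eval_poly A q"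
    proof (induction q rule: poly_mapping_induct_add)
      case (step m' c' q)
      have "eval_poly A (Poly_Mapping.single m c * Poly_Mapping.single m' c') =
          eval_poly A (Poly_Mapping.single m c) * eval_poly A (Poly_Mapping.single m' c')"
        unfolding mult_single eval_poly_single
        by (simp add: lookup_add power_add case_prod_unfold prod.distrib)
      with step show ?case by (simp add: distrib_left L)
    qed (simp add: L)
    with step show ?case by (simp add: distrib_right L)
  qed (simp add: L)
qed

lemma eval_var [simp]: "eval_poly A (var J K) = A $ J $ K"
proof -
  have "(\<Prod>(I, L)\<in>UNIV. A $ I $ L ^ poly_mapping.lookup (Poly_Mapping.single (J, K) (Suc 0)) (I, L)) =
     (\<Prod>x\<in>UNIV. if x = (J, K) then A $ J $ K else 1)"
    by (rule prod.cong) (auto simp: lookup_single when_def split: if_splits)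
  then show ?thesis by (simp add: var_def eval_poly_single)
qed

lemma eval_poly_ideal:
  assumes "so5_mat A" "p \<in> ideal_gen so5_relators"
  shows "eval_poly A p = 0"
proof -
  interpret unital_ring_hom "eval_poly A" by (rule unital_ring_hom_eval)
  have e: "map_mat (eval_poly A) (\<chi> J K. var J K) = A" by (rule mat5_eqI) simp
  have "map_mat (eval_poly A) (transpose (\<chi> J K. var J K) ** Qmat ** (\<chi> J K. var J K) - Qmat) = 0"
    "map_mat (eval_poly A) ((\<chi> J K. var J K) ** Qmat ** transpose (\<chi> J K. var J K) - Qmat) = 0"
    using assms(1) unfolding map_diff map_mult map_transpose map_Q e by (simp_all add: so5_mat_def)
  then have r: "eval_poly A ((transpose (\<chi> J K. var J K) ** Qmat ** (\<chi> J K. var J K) - Qmat) $ J $ K) = 0"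
    "eval_poly A (((\<chi> J K. var J K) ** Qmat ** transpose (\<chi> J K. var J K) - Qmat) $ J $ K) = 0" for J K
    by (simp_all only: map_mat_nth [of "eval_poly A", symmetric] zero_index)
  have d: "eval_poly A (det (\<chi> J K. var J K) - 1) = 0"
    using assms(1) unfolding diff map_det e by (simp add: so5_mat_def)
  have "eval_poly A g = 0" if "g \<in> so5_relators" for g
    using that unfolding so5_relators_def Let_def
    by (elim UnE CollectE exE conjE singletonE) (simp_all only: r d)
  with assms(2) show ?thesis
    by (induction rule: ideals.span_induct_alt) (simp_all add: add mult)
qed

lemma so5_mat_id: "so5_mat (mat 1)"
  by (simp add: so5_mat_def)

lemma one_notin_ideal: "1 \<notin> ideal_gen so5_relators"
proof
  assume "1 \<in> ideal_gen so5_relators"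
  then have "eval_poly (mat 1 :: complex^5^5) 1 = 0" by (rule eval_poly_ideal [OF so5_mat_id])
  then show False unfolding unital_ring_hom.one [OF unital_ring_hom_eval] by simp
qed

subsection \<open>The ring\<close>

text \<open>The type \<open>oso5\<close> is the underlying algebra (and, with \<open>coproduct\<close> below, coalgebra) of \<open>O(SO(5, R))\<close>: complex
polynomials in the matrix entries modulo \<open>N\<^sup>t Q N = Q\<close>, \<open>N Q N\<^sup>t = Q\<close>, \<open>det N = 1\<close>.\<close>

definition so5_eq :: "poly25 \<Rightarrow> poly25 \<Rightarrow> bool"
  where "so5_eq p q \<longleftrightarrow> p - q \<in> ideal_gen so5_relators"

quotient_type oso5 = poly25 / so5_eq
proof (rule equivpI)
  show "reflp so5_eq" by (rule reflpI) (simp add: so5_eq_def ideals.span_zero)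
  show "symp so5_eq"
    unfolding so5_eq_def by (rule sympI, drule ideals.span_neg) simp
  show "transp so5_eq"
    unfolding so5_eq_def by (rule transpI, drule (1) ideals.span_add) simp
qed

lemma ideal_mult: "p \<in> ideal_gen S \<Longrightarrow> q * p \<in> ideal_gen S" "p \<in> ideal_gen S \<Longrightarrow> p * q \<in> ideal_gen S"
  for p q :: "'a::comm_ring_1"
  using ideals.span_scale [of p S q] by (simp_all add: mult.commute)

instantiation oso5 :: complex_comm_algebra
begin
lift_definition zero_oso5 :: oso5 is 0 .
lift_definition one_oso5 :: oso5 is 1 .
lift_definition plus_oso5 :: "oso5 \<Rightarrow> oso5 \<Rightarrow> oso5" is "(+)"
  unfolding so5_eq_def by (drule (1) ideals.span_add) (simp add: algebra_simps)
lift_definition minus_oso5 :: "oso5 \<Rightarrow> oso5 \<Rightarrow> oso5" is "(-)"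
  unfolding so5_eq_def by (drule (1) ideals.span_diff) (simp add: algebra_simps)
lift_definition uminus_oso5 :: "oso5 \<Rightarrow> oso5" is uminus
  unfolding so5_eq_def by (drule ideals.span_neg) (simp add: algebra_simps)
lift_definition times_oso5 :: "oso5 \<Rightarrow> oso5 \<Rightarrow> oso5" is "(*)"
proof -
  fix p p' q q' assume "so5_eq p p'" "so5_eq q q'"
  then have "(p - p') * q + p' * (q - q') \<in> ideal_gen so5_relators"
    unfolding so5_eq_def by (intro ideals.span_add ideal_mult)
  then show "so5_eq (p * q) (p' * q')" by (simp add: so5_eq_def algebra_simps)
qed
lift_definition scaleC_oso5 :: "complex \<Rightarrow> oso5 \<Rightarrow> oso5" is scaleC
proof -
  fix c p p' assume "so5_eq p p'"
  then have "(c *\<^sub>C 1) * (p - p') \<in> ideal_gen so5_relators"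
    unfolding so5_eq_def by (rule ideal_mult)
  then show "so5_eq (c *\<^sub>C p) (c *\<^sub>C p')" by (simp add: so5_eq_def cvec.scale_right_diff_distrib)
qed
instance
proof
  note defs = plus_oso5.abs_eq times_oso5.abs_eq minus_oso5.abs_eq uminus_oso5.abs_eq scaleC_oso5.abs_eq
    zero_oso5_def one_oso5_def
  fix a b c :: oso5 and r t :: complex
  obtain p q s where [simp]: "a = abs_oso5 p" "b = abs_oso5 q" "c = abs_oso5 s"
    by (metis Quotient3_abs_rep [OF Quotient3_oso5])
  show "a + b + c = a + (b + c)" "a + b = b + a" "0 + a = a" "- a + a = 0" "a - b = a + - b"
    by (simp_all add: defs ac_simps)
  show "a * b * c = a * (b * c)" "a * b = b * a" "1 * a = a" "(a + b) * c = a * c + b * c"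
    by (simp_all add: defs ac_simps distrib_left)
  show "r *\<^sub>C (a + b) = r *\<^sub>C a + r *\<^sub>C b" "(r + t) *\<^sub>C a = r *\<^sub>C a + t *\<^sub>C a"
    "r *\<^sub>C t *\<^sub>C a = (r * t) *\<^sub>C a" "1 *\<^sub>C a = a" "(r *\<^sub>C a) * b = r *\<^sub>C (a * b)"
    by (simp_all add: defs scaleC_add_right scaleC_add_left)
  have "\<not> so5_eq 0 1"
    using one_notin_ideal ideals.span_neg [of "- 1" so5_relators] by (auto simp: so5_eq_def)
  then show "(0::oso5) \<noteq> 1"
    by (simp add: zero_oso5_def one_oso5_def oso5.abs_eq_iff)
qed
end

lift_definition gen_n :: "5 \<Rightarrow> 5 \<Rightarrow> oso5" is var .

definition gen_mat :: "oso5^5^5" where "gen_mat = (\<chi> J K. gen_n J K)"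

lemma unital_ring_hom_abs: "unital_ring_hom abs_oso5"
  by unfold_locales (simp_all add: plus_oso5.abs_eq times_oso5.abs_eq one_oso5_def)

lemma so5_mat_gen: "so5_mat gen_mat"
proof -
  interpret unital_ring_hom abs_oso5 by (rule unital_ring_hom_abs)
  let ?N = "\<chi> J K. var J K"
  have e: "map_mat abs_oso5 ?N = gen_mat" by (rule mat5_eqI) (simp add: gen_mat_def gen_n.abs_eq)
  have z: "abs_oso5 p = 0" if "p \<in> so5_relators" for p
    using ideals.span_base [OF that] unfolding zero_oso5_def oso5.abs_eq_iff so5_eq_def by simp
  have "map_mat abs_oso5 (transpose ?N ** Qmat ** ?N - Qmat) = 0"
    "map_mat abs_oso5 (?N ** Qmat ** transpose ?N - Qmat) = 0"
    by (rule mat5_eqI; unfold map_mat_nth zero_index; rule z; unfold so5_relators_def Let_def; blast)+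
  moreover have "abs_oso5 (det ?N - 1) = 0"
    by (rule z; unfold so5_relators_def Let_def; blast)
  ultimately show ?thesis
    by (simp add: so5_mat_def map_diff map_mult map_transpose e diff map_det)
qed

subsection \<open>Coproduct\<close>

lift_definition coproduct :: "oso5 \<Rightarrow> (oso5, oso5) tensor"
  is "eval_poly (\<chi> J K. \<Sum>L\<in>UNIV. gen_n J L \<otimes>\<^sub>C gen_n L K)"
proof -
  have 1: "unital_ring_hom (\<lambda>a::oso5. a \<otimes>\<^sub>C (1::oso5))"
    by unfold_locales (simp_all add: tensor_bilinear tensor_mult one_tensor_def)
  have 2: "unital_ring_hom (\<lambda>a::oso5. (1::oso5) \<otimes>\<^sub>C a)"
    by unfold_locales (simp_all add: tensor_bilinear tensor_mult one_tensor_def)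
  have "(\<chi> J K. \<Sum>L\<in>UNIV. gen_n J L \<otimes>\<^sub>C gen_n L K)
      = map_mat (\<lambda>a. a \<otimes>\<^sub>C 1) gen_mat ** map_mat (\<lambda>a. 1 \<otimes>\<^sub>C a) gen_mat"
    by (rule mat5_eqI) (simp add: matrix_matrix_mult_def tensor_mult gen_mat_def)
  then have "so5_mat (\<chi> J K. \<Sum>L\<in>UNIV. gen_n J L \<otimes>\<^sub>C gen_n L K)"
    using so5_mat_mult [OF unital_ring_hom.so5_mat_map [OF 1 so5_mat_gen] unital_ring_hom.so5_mat_map [OF 2 so5_mat_gen]]
    by simp
  note E = eval_poly_ideal [OF this]
  fix p q assume "so5_eq p q"
  then have "eval_poly (\<chi> J K. \<Sum>L\<in>UNIV. gen_n J L \<otimes>\<^sub>C gen_n L K) (p - q) = 0"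
    unfolding so5_eq_def by (rule E)
  then show "eval_poly (\<chi> J K. \<Sum>L\<in>UNIV. gen_n J L \<otimes>\<^sub>C gen_n L K) p
      = eval_poly (\<chi> J K. \<Sum>L\<in>UNIV. gen_n J L \<otimes>\<^sub>C gen_n L K) q"
    by (simp add: clinearD [OF clinear_eval_poly])
qed

section \<open>The ten derivations\<close>

text \<open>\<open>partial_n J K\<close> is the partial derivative with respect to \<open>var J K\<close>, and \<open>T_poly I J\<close> is
\<open>n_IK d_JK\<close> summed over \<open>K\<close>. Single operators \<open>T_poly I J\<close> do not preserve the defining ideal, the differences
\<open>L_poly I J\<close>, i.e. \<open>n_IK d_JK - n_J'K d_I'K\<close> with \<open>1' = 3, 2' = 4, 3' = 1, 4' = 2, 5' = 5\<close>, do.\<close>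

definition partial_n :: "5 \<Rightarrow> 5 \<Rightarrow> poly25 \<Rightarrow> poly25"
  where "partial_n J K = free_extend
    (\<lambda>m. Poly_Mapping.single (m - Poly_Mapping.single (J, K) 1) (of_nat (poly_mapping.lookup m (J, K))))"

definition T_poly :: "5 \<Rightarrow> 5 \<Rightarrow> poly25 \<Rightarrow> poly25"
  where "T_poly I J p = (\<Sum>K\<in>UNIV. var I K * partial_n J K p)"

definition L_poly :: "5 \<Rightarrow> 5 \<Rightarrow> poly25 \<Rightarrow> poly25"
  where "L_poly I J p = T_poly I J p - T_poly (prime_idx J) (prime_idx I) p"

locale ring_derivation =
  fixes X :: "'a::comm_ring_1 \<Rightarrow> 'a"
  assumes add: "X (x + y) = X x + X y" and mult: "X (x * y) = X x * y + x * X y"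
begin

lemma zero [simp]: "X 0 = 0" using add [of 0 0] by simp
lemma one [simp]: "X 1 = 0" using mult [of 1 1] by simp
lemma minus: "X (- x) = - X x" using add [of "-x" x] by (simp add: eq_neg_iff_add_eq_0)
lemma diff: "X (x - y) = X x - X y" using add [of x "-y"] by (simp add: minus)
lemma sum: "X (sum f S) = (\<Sum>x\<in>S. X (f x))" by (induction S rule: infinite_finite_induct) (auto simp: add)
lemma of_int: "X (of_int k) = 0"
proof -
  have n: "X (of_nat n) = 0" for n by (induction n) (auto simp: add)
  show ?thesis by (cases k rule: int_cases2) (simp_all add: n minus)
qed
lemma prod: "finite S \<Longrightarrow> X (prod f S) = (\<Sum>k\<in>S. X (f k) * prod f (S - {k}))"
proof (induction S rule: finite_induct)
  case (insert x F)
  have "(\<Sum>k\<in>F. X (f k) * prod f (insert x F - {k})) = (\<Sum>k\<in>F. f x * (X (f k) * prod f (F - {k})))"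
  proof (rule sum.cong)
    fix k assume "k \<in> F"
    then have "insert x F - {k} = insert x (F - {k})" using insert by auto
    then show "X (f k) * prod f (insert x F - {k}) = f x * (X (f k) * prod f (F - {k}))"
      using insert by (simp add: mult.left_commute)
  qed simp
  with insert show ?case by (simp add: mult sum_distrib_left)
qed simp
lemma map_mult: "map_mat X (A ** B) = map_mat X A ** B + A ** map_mat X B"
  by (rule mat5_eqI) (simp add: matrix_matrix_mult_def sum mult sum.distrib)
lemma map_transpose: "map_mat X (transpose A) = transpose (map_mat X A)"
  by (rule mat5_eqI) (simp add: transpose_def)
lemma map_diff: "map_mat X (A - B) = map_mat X A - map_mat X B"
  by (rule mat5_eqI) (simp add: diff)
lemma map_Q [simp]: "map_mat X Qmat = 0"
  by (rule mat5_eqI) (simp add: Qmat_nth)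

lemma det_derivative:
  "X (det A) = (\<Sum>k\<in>UNIV. det (\<chi> i. if i = k then map_mat X A $ k else A $ i))"
proof -
  have *: "X (\<Prod>i\<in>UNIV. A $ i $ p i) = (\<Sum>k\<in>UNIV. \<Prod>i\<in>UNIV. (\<chi> i. if i = k then map_mat X A $ k else A $ i) $ i $ p i)" for p
  proof -
    have "(\<Prod>i\<in>UNIV. (\<chi> i. if i = k then map_mat X A $ k else A $ i) $ i $ p i)
        = X (A $ k $ p k) * (\<Prod>i\<in>UNIV - {k}. A $ i $ p i)" for k
      by (subst prod.remove [of UNIV k]) (auto intro!: arg_cong2 [of _ _ _ _ "(*)"] prod.cong)
    then show ?thesis by (simp add: prod)
  qed
  show ?thesis
    unfolding det_def
    by (subst sum.swap) (simp add: sum mult of_int * sum_distrib_left del: vec_lambda_beta)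
qed

lemma det_trace:
  assumes "map_mat X A = Y ** A"
  shows "X (det A) = (\<Sum>k\<in>UNIV. Y $ k $ k) * det A"
proof -
  have "det (\<chi> i. if i = k then map_mat X A $ k else A $ i) = Y $ k $ k * det A" for k
  proof -
    have row: "map_mat X A $ k = (\<Sum>j\<in>UNIV. Y $ k $ j *s A $ j)"
      unfolding assms by (simp add: vec_eq_iff matrix_matrix_mult_def)
    have "det (\<chi> i. if i = k then map_mat X A $ k else A $ i)
      = (\<Sum>j\<in>UNIV. det (\<chi> i. if i = k then Y $ k $ j *s A $ j else A $ i))"
      unfolding row by (rule det_linear_row_sum) simp
    also have "\<dots> = (\<Sum>j\<in>UNIV. if j = k then Y $ k $ k * det A else 0)"
    proof (rule sum.cong)
      fix j :: 5
      have "det (\<chi> i. if i = k then Y $ k $ j *s A $ j else A $ i)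
          = Y $ k $ j * det (\<chi> i. if i = k then A $ j else A $ i)"
        by (rule det_row_mul)
      moreover have "(\<chi> i. if i = k then A $ k else A $ i) = A"
        by (simp add: vec_eq_iff)
      moreover have "det (\<chi> i. if i = k then A $ j else A $ i) = 0" if "j \<noteq> k"
        by (rule det_identical_rows [OF that]) (use that in \<open>simp add: row_def\<close>)
      ultimately show "det (\<chi> i. if i = k then Y $ k $ j *s A $ j else A $ i)
          = (if j = k then Y $ k $ k * det A else 0)" by auto
    qed simp
    finally show ?thesis by simp
  qed
  then show ?thesis by (simp add: det_derivative sum_distrib_right)
qed

lemma maps_ideal:
  assumes "\<And>g. g \<in> S \<Longrightarrow> X g \<in> ideal_gen S" and "p \<in> ideal_gen S"
  shows "X p \<in> ideal_gen S"
  using assms(2)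
proof (induction rule: ideals.span_induct_alt)
  case (step c g p)
  have "X c * g \<in> ideal_gen S" "c * X g \<in> ideal_gen S"
    using step(1) assms(1) by (simp_all add: ideal_mult ideals.span_base)
  with step show ?case by (simp add: add mult ideals.span_add)
qed (simp add: ideals.span_zero)

end

lemma partial_n_single:
  "partial_n J K (Poly_Mapping.single m c) =
     Poly_Mapping.single (m - Poly_Mapping.single (J, K) 1) (c * of_nat (poly_mapping.lookup m (J, K)))"
  by (simp add: partial_n_def scaleC_complex_def)

lemma clinear_partial_n: "clinear (partial_n J K)"
  unfolding partial_n_def by (rule clinear_free_extend)

lemma ring_derivation_partial_n: "ring_derivation (partial_n J K)"
proof
  note L = clinearD [OF clinear_partial_n, of J K]
  fix p q :: poly25
  show "partial_n J K (p + q) = partial_n J K p + partial_n J K q" by (rule L)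
  have mono: "partial_n J K (Poly_Mapping.single m c * Poly_Mapping.single m' c')
      = partial_n J K (Poly_Mapping.single m c) * Poly_Mapping.single m' c'
        + Poly_Mapping.single m c * partial_n J K (Poly_Mapping.single m' c')" for m m' c c'
  proof -
    let ?e = "Poly_Mapping.single (J, K) (1::nat)"
    have shift: "m1 - ?e + m2 = m1 + m2 - ?e" if "poly_mapping.lookup m1 (J, K) \<noteq> 0" for m1 m2
      by (rule poly_mapping_eqI) (use that in \<open>auto simp: lookup_add lookup_minus lookup_single when_def\<close>)
    have 1: "Poly_Mapping.single (m1 - ?e + m2) (x * of_nat (poly_mapping.lookup m1 (J, K)) * y)
        = Poly_Mapping.single (m1 + m2 - ?e) (x * of_nat (poly_mapping.lookup m1 (J, K)) * y)"
      for m1 m2 and x y :: complex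
    proof (cases "poly_mapping.lookup m1 (J, K) = 0")
      case False
      then show ?thesis by (simp only: shift [OF False])
    qed simp
    show ?thesis
      using 1 [of m m' c c'] 1 [of m' m c' c]
      by (simp add: mult_single partial_n_single lookup_add single_add [symmetric] algebra_simps)
  qed
  show "partial_n J K (p * q) = partial_n J K p * q + p * partial_n J K q"
  proof (induction p rule: poly_mapping_induct_add)
    case (step m c p)
    have "partial_n J K (Poly_Mapping.single m c * q)
      = partial_n J K (Poly_Mapping.single m c) * q + Poly_Mapping.single m c * partial_n J K q"
      by (induction q rule: poly_mapping_induct_add) (simp_all add: L mono distrib_left)
    with step show ?case by (simp add: L distrib_right)
  qed (simp add: L)
qed

lemma partial_n_var: "partial_n J K (var L M) = (if (L, M) = (J, K) then 1 else 0)"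
  by (auto simp: var_def partial_n_single lookup_single)

lemma ring_derivation_L_poly: "ring_derivation (L_poly I J)"
proof -
  interpret d: ring_derivation "partial_n J K" for J K by (rule ring_derivation_partial_n)
  show ?thesis
    by unfold_locales
       (simp_all add: L_poly_def T_poly_def d.add d.mult algebra_simps sum.distrib sum_distrib_left)
qed

lemma T_poly_var: "T_poly I J (var L M) = (if L = J then var I M else 0)"
  by (simp add: T_poly_def partial_n_var if_distrib cong: if_cong)

lemma clinear_L_poly: "clinear (L_poly I J)"
  by (rule clinearI)
     (simp_all add: L_poly_def T_poly_def clinearD [OF clinear_partial_n] distrib_left sum.distrib
       cvec.scale_sum_right cvec.scale_right_diff_distrib)

lemma matrix_add_rdistrib: "(A + B) ** C = A ** C + B ** C" for A B C :: "'a::comm_ring_1^5^5"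
  by (rule mat5_eqI) (simp add: matrix_matrix_mult_def distrib_right sum.distrib)

lemma mult_Qmat_right: "(A ** Qmat) $ a $ b = A $ a $ prime_idx b"
proof -
  have "(A ** Qmat) $ a $ b = (\<Sum>j\<in>UNIV. if j = prime_idx b then A $ a $ j else 0)"
    unfolding matrix_matrix_mult_def vec_lambda_beta by (rule sum.cong) (auto simp: Qmat_nth)
  then show ?thesis by simp
qed

lemma mult_Qmat_left: "(Qmat ** A) $ a $ b = A $ prime_idx a $ b"
proof -
  have "(Qmat ** A) $ a $ b = (\<Sum>j\<in>UNIV. if j = prime_idx a then A $ j $ b else 0)"
    unfolding matrix_matrix_mult_def vec_lambda_beta by (rule sum.cong) (auto simp: Qmat_nth)
  then show ?thesis by simp
qed

lemma L_poly_ideal: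
  assumes "p \<in> ideal_gen so5_relators"
  shows "L_poly I J p \<in> ideal_gen so5_relators"
proof -
  interpret ring_derivation "L_poly I J" by (rule ring_derivation_L_poly)
  let ?I = "prime_idx I" and ?J = "prime_idx J"
  define N :: "poly25^5^5" where "N = (\<chi> J K. var J K)"
  define Y :: "poly25^5^5" where "Y = (\<chi> a b. (if a = J \<and> b = I then 1 else 0) - (if a = ?I \<and> b = ?J then 1 else 0))"
  have pr: "prime_idx a = b \<longleftrightarrow> a = prime_idx b" for a b by auto
  have XN: "map_mat (L_poly I J) N = Y ** N"
    by (rule mat5_eqI)
       (auto simp: N_def Y_def matrix_matrix_mult_def L_poly_def T_poly_var left_diff_distrib sum_subtractf
         if_distrib [of "\<lambda>x. x * _"] cong: if_cong)
  have YQ: "transpose Y ** Qmat + Qmat ** Y = 0"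
    by (rule mat5_eqI) (simp add: mult_Qmat_right mult_Qmat_left transpose_def Y_def pr conj_commute)
  have QY: "Y ** Qmat + Qmat ** transpose Y = 0"
    by (rule mat5_eqI) (simp add: mult_Qmat_right mult_Qmat_left transpose_def Y_def pr conj_commute)
  have tr: "(\<Sum>k\<in>UNIV. Y $ k $ k) = 0"
  proof -
    have "(\<Sum>k\<in>UNIV. Y $ k $ k) = (\<Sum>k\<in>UNIV. if k = J then if J = I then 1 else 0 else 0)
        - (\<Sum>k\<in>UNIV. if k = ?I then if ?I = ?J then 1 else 0 else 0)"
      unfolding sum_subtractf [symmetric] by (rule sum.cong) (auto simp: Y_def)
    moreover have "?I = ?J \<longleftrightarrow> J = I" by (metis prime_prime)
    ultimately show ?thesis by simp
  qed
  show ?thesis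
  proof (rule maps_ideal [OF _ assms])
    fix g assume g: "g \<in> so5_relators"
    define R where "R = N ** Qmat ** transpose N - Qmat"
    have R: "R $ a $ b \<in> ideal_gen so5_relators" for a b
      by (rule ideals.span_base) (auto simp: so5_relators_def Let_def R_def N_def)
    have m1: "map_mat (L_poly I J) (transpose N ** Qmat ** N - Qmat) = 0"
    proof -
      have "map_mat (L_poly I J) (transpose N ** Qmat ** N - Qmat)
          = transpose N ** (transpose Y ** Qmat + Qmat ** Y) ** N"
        by (simp add: map_diff map_mult map_transpose XN matrix_transpose_mul matrix_mul_assoc
             matrix_add_ldistrib matrix_add_rdistrib)
      then show ?thesis by (simp add: YQ)
    qed
    have m2: "map_mat (L_poly I J) R = Y ** R + R ** transpose Y"
    proof -
      have "map_mat (L_poly I J) R = Y ** (R + Qmat) + (R + Qmat) ** transpose Y"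
        by (simp add: R_def map_diff map_mult map_transpose XN matrix_transpose_mul matrix_mul_assoc)
      also have "\<dots> = Y ** R + R ** transpose Y + (Y ** Qmat + Qmat ** transpose Y)"
        by (simp add: matrix_add_ldistrib matrix_add_rdistrib)
      finally show ?thesis by (simp add: QY)
    qed
    consider (1) a b where "g = (transpose N ** Qmat ** N - Qmat) $ a $ b"
      | (2) a b where "g = R $ a $ b" | (3) "g = det N - 1"
      using g unfolding so5_relators_def Let_def N_def R_def by blast
    then show "L_poly I J g \<in> ideal_gen so5_relators"
    proof cases
      case 1
      then have "L_poly I J g = map_mat (L_poly I J) (transpose N ** Qmat ** N - Qmat) $ a $ b" by simp
      then show ?thesis by (simp only: m1 zero_index ideals.span_zero)
    next
      case 2
      then have "L_poly I J g = (Y ** R + R ** transpose Y) $ a $ b" by (simp only: m2 [symmetric] map_mat_nth)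
      then have "L_poly I J g = (\<Sum>k\<in>UNIV. Y $ a $ k * R $ k $ b) + (\<Sum>k\<in>UNIV. R $ a $ k * transpose Y $ k $ b)"
        by (simp add: matrix_matrix_mult_def)
      also have "\<dots> \<in> ideal_gen so5_relators"
        by (rule ideals.span_add; rule ideals.span_sum) (rule ideal_mult(1) [OF R] ideal_mult(2) [OF R])+
      finally show ?thesis .
    next
      case 3
      then show ?thesis by (simp add: diff det_trace [OF XN] tr ideals.span_zero)
    qed
  qed
qed

lift_definition L_op :: "5 \<Rightarrow> 5 \<Rightarrow> oso5 \<Rightarrow> oso5" is L_poly
  unfolding so5_eq_def
  using L_poly_ideal clinearD(5) [OF clinear_L_poly] by metis

section \<open>Weights\<close>

type_synonym weight = "int \<times> int"

definition eps :: "5 \<Rightarrow> weight"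
  where "eps J = (if J = 1 then (1, 0) else if J = 2 then (0, 1) else if J = 3 then (- 1, 0)
    else if J = 4 then (0, - 1) else (0, 0))"

definition monom_weight :: "(5 \<times> 5 \<Rightarrow> weight) \<Rightarrow> (5 \<times> 5 \<Rightarrow>\<^sub>0 nat) \<Rightarrow> weight"
  where "monom_weight w m = (\<Sum>k\<in>UNIV. (int (poly_mapping.lookup m k) * fst (w k), int (poly_mapping.lookup m k) * snd (w k)))"

abbreviation left_weight where "left_weight \<equiv> monom_weight (\<lambda>(J, K). eps J)"
abbreviation right_weight where "right_weight \<equiv> monom_weight (\<lambda>(J, K). eps K)"

text \<open>\<open>part_poly R\<close> keeps the monomials whose left weight \<open>l\<close> and right weight \<open>p\<close> satisfy \<open>R l p\<close>.\<close>

definition part_poly :: "(weight \<Rightarrow> weight \<Rightarrow> bool) \<Rightarrow> poly25 \<Rightarrow> poly25"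
  where "part_poly R = free_extend
    (\<lambda>m. if R (left_weight m) (right_weight m) then Poly_Mapping.single m 1 else 0)"

lemma monom_weight_add: "monom_weight w (m + m') = monom_weight w m + monom_weight w m'"
  by (simp add: monom_weight_def lookup_add distrib_right sum.distrib [symmetric])

lemma monom_weight_zero [simp]: "monom_weight w 0 = 0"
  by (simp add: monom_weight_def zero_prod_def [symmetric])

lemma monom_weight_single [simp]: "monom_weight w (Poly_Mapping.single k (Suc 0)) = w k"
proof -
  have "monom_weight w (Poly_Mapping.single k (Suc 0)) = (\<Sum>x\<in>UNIV. if x = k then w k else 0)"
    unfolding monom_weight_def
    by (rule sum.cong) (auto simp: lookup_single when_def zero_prod_def)
  then show ?thesis by simp
qed

definition bihom :: "weight \<Rightarrow> weight \<Rightarrow> poly25 \<Rightarrow> bool"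
  where "bihom l r p \<longleftrightarrow> (\<forall>m\<in>Poly_Mapping.keys p. left_weight m = l \<and> right_weight m = r)"

lemma bihom_zero [simp]: "bihom l r 0" by (simp add: bihom_def)

lemma bihom_add: "bihom l r p \<Longrightarrow> bihom l r q \<Longrightarrow> bihom l r (p + q)"
  using keys_add [of p q] by (auto simp: bihom_def)

lemma bihom_minus: "bihom l r p \<Longrightarrow> bihom l r (- p)"
  by (auto simp: bihom_def in_keys_iff)

lemma bihom_diff: "bihom l r p \<Longrightarrow> bihom l r q \<Longrightarrow> bihom l r (p - q)"
  using bihom_add [of l r p "- q"] bihom_minus by auto

lemma bihom_sum: "(\<And>x. x \<in> S \<Longrightarrow> bihom l r (f x)) \<Longrightarrow> bihom l r (sum f S)"
  by (induction S rule: infinite_finite_induct) (auto intro: bihom_add)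

lemma bihom_mult: "bihom l r p \<Longrightarrow> bihom l' r' q \<Longrightarrow> bihom (l + l') (r + r') (p * q)"
  using keys_mult [of p q] by (fastforce simp: bihom_def monom_weight_add)

lemma bihom_of_int: "bihom 0 0 (of_int k)"
  by (auto simp: bihom_def single_of_int [symmetric] simp del: single_of_int)

lemma bihom_prod: "finite S \<Longrightarrow> (\<And>x. x \<in> S \<Longrightarrow> bihom (l x) (r x) (f x)) \<Longrightarrow> bihom (sum l S) (sum r S) (prod f S)"
proof (induction S rule: finite_induct)
  case empty
  show ?case using bihom_of_int [of 1] by simp
qed (auto intro!: bihom_mult)

lemma bihom_var: "bihom (eps J) (eps K) (var J K)"
  by (simp add: bihom_def var_def)

lemma eps_prime: "eps (prime_idx J) = - eps J"
  using exhaust_5 [of J] by (elim disjE) (simp_all add: eps_def)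

lemma sum_eps: "sum eps UNIV = 0"
proof -
  have "sum eps UNIV = (\<Sum>J\<in>UNIV. eps (prime_idx J))"
    by (rule sum.reindex_bij_witness [of _ prime_idx prime_idx]) auto
  then have "sum eps UNIV = - sum eps UNIV" by (simp add: eps_prime sum_negf)
  then show ?thesis by (auto simp: prod_eq_iff)
qed

lemma bihom_relators:
  assumes "g \<in> so5_relators"
  shows "\<exists>l r. bihom l r g"
proof -
  define N :: "poly25^5^5" where "N = (\<chi> J K. var J K)"
  have Q: "bihom (eps J + eps K) 0 (Qmat $ J $ K)" "bihom 0 (eps J + eps K) (Qmat $ J $ K)" for J K
    using bihom_of_int [of 1] by (auto simp: Qmat_nth eps_prime)
  consider (1) a b where "g = (transpose N ** Qmat ** N) $ a $ b - Qmat $ a $ b"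
    | (2) a b where "g = (N ** Qmat ** transpose N) $ a $ b - Qmat $ a $ b" | (3) "g = det N - 1"
    using assms unfolding so5_relators_def Let_def N_def vector_minus_component by blast
  then show ?thesis
  proof cases
    case 1
    have "bihom 0 (eps a + eps b) (var (prime_idx k) a * var k b)" for k
      using bihom_mult [OF bihom_var [of "prime_idx k" a] bihom_var [of k b]] by (simp add: eps_prime)
    moreover have "(transpose N ** Qmat ** N) $ a $ b = (\<Sum>k\<in>UNIV. var (prime_idx k) a * var k b)"
      by (subst matrix_matrix_mult_def) (simp add: mult_Qmat_right N_def transpose_def)
    ultimately have "bihom 0 (eps a + eps b) ((transpose N ** Qmat ** N) $ a $ b)"
      by (simp only: bihom_sum)
    then show ?thesis unfolding 1 using bihom_diff Q(2) by blast
  next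
    case 2
    have "bihom (eps a + eps b) 0 (var a (prime_idx k) * var b k)" for k
      using bihom_mult [OF bihom_var [of a "prime_idx k"] bihom_var [of b k]] by (simp add: eps_prime)
    moreover have "(N ** Qmat ** transpose N) $ a $ b = (\<Sum>k\<in>UNIV. var a (prime_idx k) * var b k)"
      by (subst matrix_matrix_mult_def) (simp add: mult_Qmat_right N_def transpose_def)
    ultimately have "bihom (eps a + eps b) 0 ((N ** Qmat ** transpose N) $ a $ b)"
      by (simp only: bihom_sum)
    then show ?thesis unfolding 2 using bihom_diff Q(1) by blast
  next
    case 3
    have b: "bihom (0 + (\<Sum>i\<in>UNIV. eps i)) (0 + (\<Sum>i\<in>UNIV. eps (p i))) (of_int (sign p) * (\<Prod>i\<in>UNIV. N $ i $ p i))" for p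
      unfolding N_def by (intro bihom_mult bihom_of_int bihom_prod) (simp_all add: bihom_var)
    have "(\<Sum>i\<in>UNIV. eps (p i)) = 0" if "p permutes UNIV" for p
      using sum.permute [OF that, of eps] sum_eps by (simp add: comp_def)
    then have "bihom 0 0 (of_int (sign p) * (\<Prod>i\<in>UNIV. N $ i $ p i))" if "p permutes UNIV" for p
      using b [of p] sum_eps that by simp
    then have "bihom 0 0 (det N)" unfolding det_def by (intro bihom_sum) simp
    then show ?thesis using 3 bihom_diff bihom_of_int [of 1] by fastforce
  qed
qed

lemma part_poly_single:
  "part_poly R (Poly_Mapping.single m c) = (if R (left_weight m) (right_weight m) then Poly_Mapping.single m c else 0)"
  by (simp add: part_poly_def scaleC_complex_def)

lemma clinear_part_poly: "clinear (part_poly R)"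
  unfolding part_poly_def by (rule clinear_free_extend)

lemma part_poly_mult_bihom:
  assumes "bihom l r g"
  shows "part_poly R (p * g) = part_poly (\<lambda>l' r'. R (l' + l) (r' + r)) p * g"
proof (induction p rule: poly_mapping_induct_add)
  case (step m c p)
  have g: "g = (\<Sum>k\<in>Poly_Mapping.keys g. Poly_Mapping.single k (poly_mapping.lookup g k))"
    by (rule poly_mapping_eqI) (auto simp: lookup_sum lookup_single when_def in_keys_iff)
  have "part_poly R (Poly_Mapping.single m c * g) = part_poly (\<lambda>l' r'. R (l' + l) (r' + r)) (Poly_Mapping.single m c) * g"
  proof (subst (1 2) g)
    show "part_poly R (Poly_Mapping.single m c * (\<Sum>k\<in>Poly_Mapping.keys g. Poly_Mapping.single k (poly_mapping.lookup g k)))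
      = part_poly (\<lambda>l' r'. R (l' + l) (r' + r)) (Poly_Mapping.single m c) * (\<Sum>k\<in>Poly_Mapping.keys g. Poly_Mapping.single k (poly_mapping.lookup g k))"
      using assms
      by (auto simp: sum_distrib_left clinearD [OF clinear_part_poly] mult_single part_poly_single
          monom_weight_add bihom_def intro!: sum.cong)
  qed
  with step show ?case by (simp add: distrib_right clinearD [OF clinear_part_poly])
qed (simp add: clinearD [OF clinear_part_poly])

lemma part_poly_ideal:
  assumes "p \<in> ideal_gen so5_relators"
  shows "part_poly R p \<in> ideal_gen so5_relators"
  using assms
proof (induction rule: ideals.span_induct_alt)
  case base
  show ?case by (simp add: clinearD [OF clinear_part_poly] ideals.span_zero)
next
  case (step c g p)
  obtain l r where "bihom l r g" using bihom_relators step(1) by blast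
  then have "part_poly R (c * g + p) = part_poly (\<lambda>l' r'. R (l' + l) (r' + r)) c * g + part_poly R p"
    by (simp add: clinearD [OF clinear_part_poly] part_poly_mult_bihom)
  moreover have "part_poly (\<lambda>l' r'. R (l' + l) (r' + r)) c * g \<in> ideal_gen so5_relators"
    using step(1) by (intro ideal_mult ideals.span_base)
  ultimately show ?case using step by (simp add: ideals.span_add)
qed

lift_definition part :: "(weight \<Rightarrow> weight \<Rightarrow> bool) \<Rightarrow> oso5 \<Rightarrow> oso5" is part_poly
  unfolding so5_eq_def
  using part_poly_ideal clinearD(5) [OF clinear_part_poly] by metis

subsection \<open>The derivations on the quotient\<close>

lemma ring_derivation_L_op: "ring_derivation (L_op I J)"
proof -
  interpret d: ring_derivation "L_poly I J" by (rule ring_derivation_L_poly)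
  show ?thesis
  proof
    fix a b :: oso5
    show "L_op I J (a + b) = L_op I J a + L_op I J b"
      by (metis Quotient3_abs_rep [OF Quotient3_oso5] L_op.abs_eq plus_oso5.abs_eq d.add)
    show "L_op I J (a * b) = L_op I J a * b + a * L_op I J b"
      by (metis Quotient3_abs_rep [OF Quotient3_oso5] L_op.abs_eq plus_oso5.abs_eq times_oso5.abs_eq d.mult)
  qed
qed

lemma L_op_gen_n:
  "L_op I J (gen_n L M) = (if L = J then gen_n I M else 0) - (if L = prime_idx I then gen_n (prime_idx J) M else 0)"
  by (simp add: gen_n.abs_eq L_op.abs_eq L_poly_def T_poly_var zero_oso5_def minus_oso5.abs_eq)

definition H1 :: "oso5 \<Rightarrow> oso5" where "H1 = L_op 1 1"
definition H2 :: "oso5 \<Rightarrow> oso5" where "H2 = L_op 2 2"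

definition roots :: "weight set"
  where "roots = {(1, 0), (- 1, 0), (0, 1), (0, - 1), (1, 1), (- 1, - 1), (1, - 1), (- 1, 1)}"

text \<open>With the index involution written out, the operators below are
\<open>L_op 1 1 = n_1K d_1K - n_3K d_3K\<close>, \<open>L_op 2 2 = n_2K d_2K - n_4K d_4K\<close>,
\<open>L_op 5 3 = n_5K d_3K - n_1K d_5K\<close>, \<open>L_op 3 5 = n_3K d_5K - n_5K d_1K\<close>,
\<open>L_op 5 4 = n_5K d_4K - n_2K d_5K\<close>, \<open>L_op 4 5 = n_4K d_5K - n_5K d_2K\<close>,
\<open>L_op 2 3 = n_2K d_3K - n_1K d_4K\<close>, \<open>L_op 3 2 = n_3K d_2K - n_4K d_1K\<close>,
\<open>L_op 4 3 = n_4K d_3K - n_1K d_2K\<close>, \<open>L_op 3 4 = n_3K d_4K - n_2K d_1K\<close>.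
Values of \<open>E_op\<close>, \<open>K_op\<close>, \<open>W_op\<close> at other indices are irrelevant.\<close>

definition E_op :: "weight \<Rightarrow> oso5 \<Rightarrow> oso5" where
  "E_op r =
    (if r = (1, 0) then L_op 5 3
     else if r = (- 1, 0) then L_op 3 5
     else if r = (0, 1) then L_op 5 4
     else if r = (0, - 1) then L_op 4 5
     else if r = (1, 1) then L_op 2 3
     else if r = (- 1, - 1) then L_op 3 2
     else if r = (1, - 1) then L_op 4 3
     else if r = (- 1, 1) then L_op 3 4
     else (\<lambda>_. 0))"

definition sqrt2 :: complex where "sqrt2 = complex_of_real (sqrt 2)"
definition alpha :: oso5 where "alpha = sqrt2 *\<^sub>C gen_n 1 5"
definition beta :: oso5 where "beta = sqrt2 *\<^sub>C gen_n 2 5"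
definition alpha_star :: oso5 where "alpha_star = sqrt2 *\<^sub>C gen_n 3 5"
definition beta_star :: oso5 where "beta_star = sqrt2 *\<^sub>C gen_n 4 5"
definition x_coord :: oso5 where "x_coord = gen_n 5 5"

definition K_op :: "nat \<Rightarrow> oso5 \<Rightarrow> oso5" where
  "K_op j a =
    (if j = 1 then 2 * x_coord * H2 a + sqrt2 *\<^sub>C (beta_star * E_op (0, 1) a) + sqrt2 *\<^sub>C (beta * E_op (0, - 1) a)
     else if j = 2 then 2 * x_coord * H1 a + sqrt2 *\<^sub>C (alpha_star * E_op (1, 0) a) + sqrt2 *\<^sub>C (alpha * E_op (- 1, 0) a)
     else 0)"

definition W_op :: "weight \<Rightarrow> oso5 \<Rightarrow> oso5" where
  "W_op r a =
    (if r = (0, 1) then sqrt2 *\<^sub>C (beta * H1 a + alpha_star * E_op (1, 1) a + alpha * E_op (- 1, 1) a)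
     else if r = (0, - 1) then sqrt2 *\<^sub>C (beta_star * H1 a + alpha_star * E_op (1, - 1) a + alpha * E_op (- 1, - 1) a)
     else if r = (1, 0) then sqrt2 *\<^sub>C (alpha * H2 a - beta_star * E_op (1, 1) a + beta * E_op (1, - 1) a)
     else if r = (- 1, 0) then sqrt2 *\<^sub>C (alpha_star * H2 a + beta_star * E_op (- 1, 1) a - beta * E_op (- 1, - 1) a)
     else if r = (1, 1) then
       2 * x_coord * E_op (1, 1) a + sqrt2 *\<^sub>C (alpha * E_op (0, 1) a) - sqrt2 *\<^sub>C (beta * E_op (1, 0) a)
     else if r = (- 1, - 1) then
       2 * x_coord * E_op (- 1, - 1) a + sqrt2 *\<^sub>C (alpha_star * E_op (0, - 1) a) - sqrt2 *\<^sub>C (beta_star * E_op (- 1, 0) a)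
     else if r = (1, - 1) then
       - 2 * x_coord * E_op (1, - 1) a + sqrt2 *\<^sub>C (beta_star * E_op (1, 0) a) + sqrt2 *\<^sub>C (alpha * E_op (0, - 1) a)
     else if r = (- 1, 1) then
       - 2 * x_coord * E_op (- 1, 1) a + sqrt2 *\<^sub>C (beta * E_op (- 1, 0) a) + sqrt2 *\<^sub>C (alpha_star * E_op (0, 1) a)
     else 0)"

definition commutator :: "(oso5 \<Rightarrow> oso5) \<Rightarrow> (oso5 \<Rightarrow> oso5) \<Rightarrow> oso5 \<Rightarrow> oso5"
  where "commutator u v a = u (v a) - v (u a)"

section \<open>Weight components\<close>

text \<open>\<open>bipart l p\<close> projects onto left weight \<open>l\<close> and right weight \<open>p\<close>, \<open>lpart l\<close> onto left weight \<open>l\<close>, which is the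
joint eigenspace of \<open>H1\<close> and \<open>H2\<close> for \<open>l\<close>; see \<open>H_lpart\<close> and \<open>lpart_sum\<close>.\<close>

definition bipart :: "weight \<Rightarrow> weight \<Rightarrow> oso5 \<Rightarrow> oso5"
  where "bipart l p = part (\<lambda>l' p'. l' = l \<and> p' = p)"

definition lpart :: "weight \<Rightarrow> oso5 \<Rightarrow> oso5"
  where "lpart l = part (\<lambda>l' p'. l' = l)"

lemma part_sum:
  fixes c :: "weight \<Rightarrow> weight \<Rightarrow> 'c"
  shows "finite {k. part (\<lambda>l p. c l p = k) a \<noteq> 0}"
    and "Sum_any (\<lambda>k. part (\<lambda>l p. c l p = k) a) = a"
proof -
  obtain f where a: "a = abs_oso5 f" by (metis Quotient3_abs_rep [OF Quotient3_oso5])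
  let ?c = "\<lambda>m. c (left_weight m) (right_weight m)"
  let ?S = "?c ` Poly_Mapping.keys f"
  have p: "poly_mapping.lookup (part_poly R f) m
      = (if R (left_weight m) (right_weight m) then poly_mapping.lookup f m else 0)" for R m
    by (induction f rule: poly_mapping_induct_add)
       (auto simp: clinearD [OF clinear_part_poly] part_poly_single lookup_add lookup_single when_def)
  have z: "part (\<lambda>l p. c l p = k) a = 0" if "k \<notin> ?S" for k
  proof -
    have "part_poly (\<lambda>l p. c l p = k) f = 0"
      by (rule poly_mapping_eqI) (use that in \<open>auto simp: p in_keys_iff\<close>)
    then show ?thesis by (simp add: a part.abs_eq zero_oso5_def)
  qed
  then have sub: "{k. part (\<lambda>l p. c l p = k) a \<noteq> 0} \<subseteq> ?S" by blast
  then show "finite {k. part (\<lambda>l p. c l p = k) a \<noteq> 0}"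
    by (rule finite_subset) simp
  interpret unital_ring_hom abs_oso5 by (rule unital_ring_hom_abs)
  have "(\<Sum>k\<in>?S. part_poly (\<lambda>l p. c l p = k) f) = f"
    by (rule poly_mapping_eqI) (auto simp: lookup_sum p in_keys_iff)
  then have "(\<Sum>k\<in>?S. part (\<lambda>l p. c l p = k) a) = a"
    by (simp add: a part.abs_eq sum [symmetric])
  with sub show "Sum_any (\<lambda>k. part (\<lambda>l p. c l p = k) a) = a"
    by (simp add: Sum_any.expand_superset [of ?S])
qed

lemma lpart_sum: "finite {l. lpart l a \<noteq> 0}" "Sum_any (\<lambda>l. lpart l a) = a"
  using part_sum [of "\<lambda>l p. l" a] by (simp_all add: lpart_def)

lemma T_poly_single:
  "T_poly I I (Poly_Mapping.single m c) =
     (\<Sum>K\<in>UNIV. of_nat (poly_mapping.lookup m (I, K))) *\<^sub>C Poly_Mapping.single m c"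
proof -
  have *: "var I K * partial_n I K (Poly_Mapping.single m c)
      = of_nat (poly_mapping.lookup m (I, K)) *\<^sub>C Poly_Mapping.single m c" for K
  proof (cases "poly_mapping.lookup m (I, K) = 0")
    case False
    then have "Poly_Mapping.single (I, K) 1 + (m - Poly_Mapping.single (I, K) 1) = m"
      by (intro poly_mapping_eqI) (auto simp: lookup_add lookup_minus lookup_single when_def)
    then show ?thesis
      by (simp add: var_def partial_n_single mult_single scaleC_complex_def mult.commute)
  qed (simp add: partial_n_single)
  show ?thesis by (simp only: T_poly_def * cvec.scale_sum_left)
qed

lemma left_weight_sum:
  "left_weight m = (\<Sum>J\<in>UNIV. \<Sum>K\<in>UNIV. (int (poly_mapping.lookup m (J, K)) * fst (eps J), int (poly_mapping.lookup m (J, K)) * snd (eps J)))"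
  unfolding monom_weight_def by (simp add: sum.cartesian_product case_prod_unfold)

lemma UNIV_5: "UNIV = {1, 2, 3, 4, 5::5}"
  using exhaust_5 by auto

lemma sum_5: "sum f (UNIV :: 5 set) = f 1 + f 2 + f 3 + f 4 + f 5"
  unfolding UNIV_5 by (simp add: ac_simps)

lemma H_single:
  "L_poly 1 1 (Poly_Mapping.single m c) = of_int (fst (left_weight m)) *\<^sub>C Poly_Mapping.single m c"
  "L_poly 2 2 (Poly_Mapping.single m c) = of_int (snd (left_weight m)) *\<^sub>C Poly_Mapping.single m c"
proof -
  have w: "fst (left_weight m) = (\<Sum>K\<in>UNIV. int (poly_mapping.lookup m (1, K))) - (\<Sum>K\<in>UNIV. int (poly_mapping.lookup m (3, K)))"
    "snd (left_weight m) = (\<Sum>K\<in>UNIV. int (poly_mapping.lookup m (2, K))) - (\<Sum>K\<in>UNIV. int (poly_mapping.lookup m (4, K)))"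
    unfolding left_weight_sum by (simp_all add: sum_5 eps_def)
  show "L_poly 1 1 (Poly_Mapping.single m c) = of_int (fst (left_weight m)) *\<^sub>C Poly_Mapping.single m c"
    "L_poly 2 2 (Poly_Mapping.single m c) = of_int (snd (left_weight m)) *\<^sub>C Poly_Mapping.single m c"
    unfolding w by (simp_all add: L_poly_def T_poly_single cvec.scale_left_diff_distrib single_diff)
qed

lemma H_lpart:
  "H1 (lpart l a) = of_int (fst l) *\<^sub>C lpart l a" "H2 (lpart l a) = of_int (snd l) *\<^sub>C lpart l a"
proof -
  obtain f where a: "a = abs_oso5 f" by (metis Quotient3_abs_rep [OF Quotient3_oso5])
  have "L_poly 1 1 (part_poly (\<lambda>l' p'. l' = l) f) = of_int (fst l) *\<^sub>C part_poly (\<lambda>l' p'. l' = l) f \<and>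
      L_poly 2 2 (part_poly (\<lambda>l' p'. l' = l) f) = of_int (snd l) *\<^sub>C part_poly (\<lambda>l' p'. l' = l) f"
    by (induction f rule: poly_mapping_induct_add)
       (auto simp: clinearD [OF clinear_part_poly] clinearD [OF clinear_L_poly] part_poly_single H_single scaleC_add_right
         simp del: scaleC_single)
  then show "H1 (lpart l a) = of_int (fst l) *\<^sub>C lpart l a" "H2 (lpart l a) = of_int (snd l) *\<^sub>C lpart l a"
    by (simp_all add: H1_def H2_def lpart_def a part.abs_eq L_op.abs_eq scaleC_oso5.abs_eq)
qed

text \<open>\<open>exp_H s t\<close> is \<open>exp (s H1 + t H2)\<close>, acting on weight vectors by scalars.\<close>

definition exp_H :: "complex \<Rightarrow> complex \<Rightarrow> oso5 \<Rightarrow> oso5"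
  where "exp_H s t a = (\<Sum>l. exp (s * of_int (fst l) + t * of_int (snd l)) *\<^sub>C lpart l a)"

text \<open>The component of weight \<open>r\<close> of a linear map \<open>u\<close> under \<open>H_j \<triangleright> u = [H_j, u]\<close>: it raises left weights by \<open>r\<close>.
Every linear map \<open>u\<close> is the sum of its components, and at each argument only finitely many of
them are nonzero.\<close>

definition map_part :: "weight \<Rightarrow> (oso5 \<Rightarrow> oso5) \<Rightarrow> oso5 \<Rightarrow> oso5"
  where "map_part r u a = (\<Sum>l. lpart (l + r) (u (lpart l a)))"

section \<open>The deformation\<close>

definition wedge :: "weight \<Rightarrow> weight \<Rightarrow> int"
  where "wedge r s = fst r * snd s - snd r * fst s"

definition phase :: "real \<Rightarrow> int \<Rightarrow> complex"
  where "phase t k = exp (\<i> * of_real pi * of_real t * of_int k)"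

text \<open>\<open>exp_wedge t f\<close> is the action of \<open>exp (i \<pi> t (H1 \<otimes> H2 - H2 \<otimes> H1))\<close> followed by a bilinear operation, where \<open>f r s\<close>
is the result of that operation on the component of weight \<open>r\<close> in the first leg and the component
of weight \<open>s\<close> in the second leg. Thus \<open>t = - \<theta>\<close> gives the inverse twist, and \<open>t = - 2 * \<theta>\<close>
the universal R-matrix, which is its square. All sums occurring below have finite support for linear maps.\<close>

definition exp_wedge :: "real \<Rightarrow> (weight \<Rightarrow> weight \<Rightarrow> 'v::complex_vec) \<Rightarrow> 'v"
  where "exp_wedge t f = (\<Sum>(r, s). phase t (wedge r s) *\<^sub>C f r s)"

text \<open>The product of \<open>O(SO\<^sub>\<theta>(5, R))\<close> on the vector space \<open>oso5\<close>.\<close>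

definition star :: "real \<Rightarrow> oso5 \<Rightarrow> oso5 \<Rightarrow> oso5"
  where "star \<theta> a a' = (\<Sum>(l, p, l', p').
     (phase (- \<theta>) (wedge l l') * phase \<theta> (wedge p p')) *\<^sub>C (bipart l p a * bipart l' p' a'))"

text \<open>The kernel of the projection \<open>O(SO\<^sub>\<theta>(5, R)) \<rightarrow> O(SO\<^sub>\<theta>(4, R))\<close>: a two-sided ideal for the product \<open>star \<theta>\<close>,
closed under scalars because the unit is that of \<open>oso5\<close>.\<close>

inductive_set so4_ideal :: "real \<Rightarrow> oso5 set" for \<theta> :: real where
  gen_55: "gen_n 5 5 - 1 \<in> so4_ideal \<theta>"
| gen_row: "\<nu> \<noteq> 5 \<Longrightarrow> gen_n 5 \<nu> \<in> so4_ideal \<theta>"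
| gen_col: "\<mu> \<noteq> 5 \<Longrightarrow> gen_n \<mu> 5 \<in> so4_ideal \<theta>"
| zero: "0 \<in> so4_ideal \<theta>"
| add: "j \<in> so4_ideal \<theta> \<Longrightarrow> j' \<in> so4_ideal \<theta> \<Longrightarrow> j + j' \<in> so4_ideal \<theta>"
| left: "j \<in> so4_ideal \<theta> \<Longrightarrow> star \<theta> a j \<in> so4_ideal \<theta>"
| right: "j \<in> so4_ideal \<theta> \<Longrightarrow> star \<theta> j a \<in> so4_ideal \<theta>"

text \<open>Since \<open>O(SO\<^sub>\<theta>(4, R))\<close> depends on the real number \<open>\<theta>\<close> it is not a type. Writing \<open>A\<close> for \<open>oso5\<close> and \<open>J\<close> for
\<open>so4_ideal \<theta>\<close>, the space \<open>A \<otimes> (A / J)\<close> is \<open>(A \<otimes> A) / (A \<otimes> J)\<close>, its elements are represented by cosets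
of \<open>proj_kernel \<theta>\<close>, and \<open>id_proj \<theta>\<close> is \<open>id \<otimes> \<pi>\<close>. On cosets, \<open>map_id \<theta> u\<close> is \<open>u \<otimes> id\<close>.\<close>

definition proj_kernel :: "real \<Rightarrow> (oso5, oso5) tensor set"
  where "proj_kernel \<theta> = cspan {a \<otimes>\<^sub>C j | a j. j \<in> so4_ideal \<theta>}"

definition id_proj :: "real \<Rightarrow> (oso5, oso5) tensor \<Rightarrow> (oso5, oso5) tensor set"
  where "id_proj \<theta> t = {t + k | k. k \<in> proj_kernel \<theta>}"

definition coaction :: "real \<Rightarrow> oso5 \<Rightarrow> (oso5, oso5) tensor set"
  where "coaction \<theta> a = id_proj \<theta> (coproduct a)"

definition map_id :: "real \<Rightarrow> (oso5 \<Rightarrow> oso5) \<Rightarrow> (oso5, oso5) tensor set \<Rightarrow> (oso5, oso5) tensor set"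
  where "map_id \<theta> u T = (\<Union>t\<in>T. id_proj \<theta> (tensor_map u id t))"

text \<open>The coinvariants, \<open>O(S\<^sup>4\<^sub>\<theta>)\<close>.\<close>

definition sphere_alg :: "real \<Rightarrow> oso5 set"
  where "sphere_alg \<theta> = {b. coaction \<theta> b = id_proj \<theta> (b \<otimes>\<^sub>C 1)}"

text \<open>In the braided Leibniz rule and in the bracket the first leg of the R-matrix acts on \<open>u\<close> and the
second leg on \<open>a\<close>, respectively \<open>u'\<close>.\<close>

definition aut :: "real \<Rightarrow> (oso5 \<Rightarrow> oso5) set"
  where "aut \<theta> = {u. clinear u
     \<and> (\<forall>a. coaction \<theta> (u a) = map_id \<theta> u (coaction \<theta> a))
     \<and> (\<forall>a a'. u (star \<theta> a a')
           = star \<theta> (u a) a' + exp_wedge (- 2 * \<theta>) (\<lambda>r l. star \<theta> (lpart l a) (map_part r u a')))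
     \<and> (\<forall>b\<in>sphere_alg \<theta>. u b = 0)}"

definition braided_bracket :: "real \<Rightarrow> (oso5 \<Rightarrow> oso5) \<Rightarrow> (oso5 \<Rightarrow> oso5) \<Rightarrow> oso5 \<Rightarrow> oso5"
  where "braided_bracket \<theta> u u' a
     = u (u' a) - exp_wedge (- 2 * \<theta>) (\<lambda>r s. map_part s u' (map_part r u a))"

definition twist_D :: "real \<Rightarrow> (oso5 \<Rightarrow> oso5) \<Rightarrow> oso5 \<Rightarrow> oso5"
  where "twist_D \<theta> u a = exp_wedge (- \<theta>) (\<lambda>r l. map_part r u (lpart l a))"

definition act :: "real \<Rightarrow> oso5 \<Rightarrow> (oso5 \<Rightarrow> oso5) \<Rightarrow> oso5 \<Rightarrow> oso5"
  where "act \<theta> b u a = star \<theta> b (u a)"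

inductive_set submodule_gen :: "real \<Rightarrow> (oso5 \<Rightarrow> oso5) set \<Rightarrow> (oso5 \<Rightarrow> oso5) set"
  for \<theta> :: real and S :: "(oso5 \<Rightarrow> oso5) set" where
  base: "u \<in> S \<Longrightarrow> u \<in> submodule_gen \<theta> S"
| zero: "(\<lambda>a. 0) \<in> submodule_gen \<theta> S"
| add: "u \<in> submodule_gen \<theta> S \<Longrightarrow> v \<in> submodule_gen \<theta> S \<Longrightarrow> (\<lambda>a. u a + v a) \<in> submodule_gen \<theta> S"
| act: "b \<in> sphere_alg \<theta> \<Longrightarrow> u \<in> submodule_gen \<theta> S \<Longrightarrow> act \<theta> b u \<in> submodule_gen \<theta> S"

end

theory Submission
  imports Defs
begin

text \<open>
Every space and every map in the theorem is graded by weights, and the deformation acts on homogeneous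
components by scalars of modulus one. An element of left weight \<open>l\<close> and right weight \<open>p\<close> lies in \<open>graded l p\<close>; a linear
map that raises left weights by \<open>r\<close> and keeps right weights is \<open>homogeneous r\<close>. On such elements and maps, \<open>star\<close>,
\<open>twist_D\<close>, the braiding and the bracket are the undeformed operations times a phase
(\<open>star_graded\<close>, \<open>twist_D_homogeneous\<close>, \<open>braided_bracket_homogeneous\<close>), so every assertion about them reduces to
an identity between exponents, once it has been reduced to homogeneous arguments by additivity.

The ideal of \<open>SO(4)\<close> is spanned by homogeneous elements and is therefore the same for all \<open>\<theta>\<close> (\<open>so4_ideal_eq\<close>).
Hence coinvariants and equivariance are undeformed notions. Coinvariants have right weight zero and equivariant maps keep
right weights, because the maximal torus of \<open>SO(5)\<close> lies in \<open>SO(4)\<close>; for this reason the right weights cancel from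
all exponents.

It follows that \<open>twist_D \<theta>\<close> relates the braided derivations of the deformed algebra to the ordinary derivations of the
commutative algebra, in both directions: \<open>twist_gauge_in_aut\<close> and \<open>ring_derivation_untwist\<close>. What remains is geometry of
the commutative algebra.

Let \<open>X\<close> be a derivation. In the frame of the right-invariant derivations \<open>right_inv_field I J\<close>, which span \<open>so(5)\<close>, it
has antisymmetric coefficients \<open>c\<^sub>I\<^sub>J\<close> (\<open>left_expansion\<close>); if \<open>X\<close> commutes with the coaction on the generators, these are
coinvariant (\<open>left_coeff_sphere\<close>). If \<open>X\<close> also annihilates the coordinates \<open>v\<^sub>J = n\<^sub>J\<^sub>5\<close> of the sphere, then the contraction
of \<open>c\<close> with \<open>v\<close> vanishes. Since \<open>v\<close> is a unit vector for the quadratic form, the Koszul complex of \<open>v\<close> is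
contractible, and \<open>c\<close> is the contraction with \<open>v\<close> of a trivector with coinvariant entries (\<open>koszul_expansion\<close>). The contractions of the ten
basis trivectors are the derivations \<open>vertical K I J\<close>, which are the operators \<open>K_op\<close> and \<open>W_op\<close> up to scalars
(\<open>K_op_vertical\<close>, \<open>W_op_vertical\<close>).

Conversely each \<open>vertical K I J\<close> annihilates all coinvariants, not only the coordinates \<open>v\<^sub>J\<close>: expanded in the left-invariant
frame instead, a derivation that kills all \<open>v\<^sub>J\<close> involves only the generators of \<open>so(4)\<close>, and these differentiate along the
fibres (\<open>vanishes_on_sphere\<close>).

The formula for the bracket of twisted derivations is \<open>twist_D_bracket\<close>. The formula for \<open>b \<bullet> X\<close> and
\<open>b' \<bullet> X'\<close> is additive in all four arguments and holds for homogeneous ones by the braided Leibniz rule (\<open>bracket_act\<close>).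
\<close>

section \<open>Bihomogeneous elements\<close>

text \<open>The simultaneous weight spaces of the left and the right action of the maximal torus.\<close>

definition graded :: "weight \<Rightarrow> weight \<Rightarrow> oso5 set"
  where "graded l p = {a. bipart l p a = a}"

lemma oso5_cases: obtains f where "a = abs_oso5 f"
  by (metis Quotient3_abs_rep [OF Quotient3_oso5])

lemma clinear_part: "clinear (part R)"
proof (rule clinearI)
  note L = clinearD [OF clinear_part_poly]
  fix x y :: oso5 and c
  obtain f g where "x = abs_oso5 f" "y = abs_oso5 g" by (metis oso5_cases)
  then show "part R (x + y) = part R x + part R y" "part R (c *\<^sub>C x) = c *\<^sub>C part R x"
    by (simp_all add: plus_oso5.abs_eq scaleC_oso5.abs_eq part.abs_eq L)
qed

lemma part_part: "part R (part S a) = part (\<lambda>l p. R l p \<and> S l p) a"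
proof -
  note L = clinearD [OF clinear_part_poly]
  obtain f where a: "a = abs_oso5 f" by (rule oso5_cases)
  have "part_poly R (part_poly S f) = part_poly (\<lambda>l p. R l p \<and> S l p) f"
    by (induction f rule: poly_mapping_induct_add) (simp_all add: L part_poly_single)
  then show ?thesis by (simp add: a part.abs_eq)
qed

lemma clinear_bipart: "clinear (bipart l p)"
  by (simp add: bipart_def clinear_part)

lemma clinear_lpart: "clinear (lpart l)"
  by (simp add: lpart_def clinear_part)

lemma part_graded:
  assumes "a \<in> graded l p"
  shows "part R a = (if R l p then a else 0)"
proof -
  have a: "a = part (\<lambda>l' p'. l' = l \<and> p' = p) a" using assms by (simp add: graded_def bipart_def)
  have z: "part (\<lambda>l p. False) b = 0" for b
  proof -
    obtain f where b: "b = abs_oso5 f" by (rule oso5_cases)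
    have "part_poly (\<lambda>l p. False) f = 0" by (simp add: part_poly_def free_extend_def)
    then show ?thesis by (simp add: b part.abs_eq zero_oso5_def)
  qed
  have "part R a = part (\<lambda>l' p'. R l' p' \<and> l' = l \<and> p' = p) a"
    by (subst a) (rule part_part)
  also have "(\<lambda>l' p'. R l' p' \<and> l' = l \<and> p' = p) = (if R l p then \<lambda>l' p'. l' = l \<and> p' = p else (\<lambda>l p. False))"
    by auto
  finally show ?thesis using a z by auto
qed

lemma lpart_graded: "a \<in> graded l p \<Longrightarrow> lpart m a = (if m = l then a else 0)"
  by (auto simp: lpart_def part_graded)

lemma bipart_graded: "a \<in> graded l p \<Longrightarrow> bipart m q a = (if m = l \<and> q = p then a else 0)"
  by (auto simp: bipart_def part_graded)

lemma bipart_in_graded: "bipart l p a \<in> graded l p"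
  by (simp add: graded_def bipart_def part_part)

lemma part_poly_one: "part_poly R 1 = (if R 0 0 then 1 else 0)"
  using part_poly_single [of R 0 1] by simp

lemma graded_abs: "bihom l p f \<Longrightarrow> abs_oso5 f \<in> graded l p"
proof -
  assume h: "bihom l p f"
  have "part_poly (\<lambda>l' p'. l' = l \<and> p' = p) f = f"
    using part_poly_mult_bihom [OF h, of "\<lambda>l' p'. l' = l \<and> p' = p" 1]
    by (simp add: part_poly_one)
  then show ?thesis by (simp add: graded_def bipart_def part.abs_eq)
qed

text \<open>Representatives can be chosen homogeneous because the defining ideal is generated by bihomogeneous
polynomials, so that \<open>part\<close> descends from polynomials to the quotient.\<close>

lemma graded_ex_poly:
  assumes "a \<in> graded l p" obtains f where "bihom l p f" "a = abs_oso5 f"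
proof -
  obtain f where f: "a = abs_oso5 f" by (rule oso5_cases)
  have "bihom l p (part_poly (\<lambda>l' p'. l' = l \<and> p' = p) f)"
  proof (induction f rule: poly_mapping_induct_add)
    case (step k c f)
    have "bihom l p (part_poly (\<lambda>l' p'. l' = l \<and> p' = p) (Poly_Mapping.single k c))"
      by (simp add: part_poly_single bihom_def)
    then show ?case using step by (simp add: clinearD [OF clinear_part_poly] bihom_add)
  qed (simp add: clinearD [OF clinear_part_poly])
  moreover have "a = abs_oso5 (part_poly (\<lambda>l' p'. l' = l \<and> p' = p) f)"
    using assms by (simp add: graded_def bipart_def f part.abs_eq)
  ultimately show ?thesis using that by blast
qed

lemma graded_zero [simp]: "0 \<in> graded l p"
  by (simp add: graded_def clinearD [OF clinear_bipart])

lemma graded_add: "a \<in> graded l p \<Longrightarrow> b \<in> graded l p \<Longrightarrow> a + b \<in> graded l p"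
  by (simp add: graded_def clinearD [OF clinear_bipart])

lemma graded_diff: "a \<in> graded l p \<Longrightarrow> b \<in> graded l p \<Longrightarrow> a - b \<in> graded l p"
  by (simp add: graded_def clinearD [OF clinear_bipart])

lemma graded_scaleC: "a \<in> graded l p \<Longrightarrow> c *\<^sub>C a \<in> graded l p"
  by (simp add: graded_def clinearD [OF clinear_bipart])

lemma graded_mult: "a \<in> graded l p \<Longrightarrow> b \<in> graded l' p' \<Longrightarrow> a * b \<in> graded (l + l') (p + p')"
proof -
  assume "a \<in> graded l p" "b \<in> graded l' p'"
  then obtain f g where "bihom l p f" "a = abs_oso5 f" "bihom l' p' g" "b = abs_oso5 g"
    by (elim graded_ex_poly) blast
  then show ?thesis by (simp add: times_oso5.abs_eq graded_abs bihom_mult)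
qed

lemma graded_one: "1 \<in> graded 0 0"
  using graded_abs [OF bihom_of_int [of 1]] by (simp add: one_oso5_def)

lemma graded_gen_n: "gen_n J K \<in> graded (eps J) (eps K)"
  using graded_abs [OF bihom_var] by (simp add: gen_n.abs_eq)

text \<open>Monomials are bihomogeneous, so a property closed under addition only has to be checked on weight vectors.\<close>

lemma graded_induct [case_names zero add graded]:
  assumes "P 0" "\<And>a b. P a \<Longrightarrow> P b \<Longrightarrow> P (a + b)" "\<And>l p a. a \<in> graded l p \<Longrightarrow> P a"
  shows "P a"
proof -
  obtain f where a: "a = abs_oso5 f" by (rule oso5_cases)
  have "P (abs_oso5 f)"
  proof (induction f rule: poly_mapping_induct_add)
    case zero
    then show ?case using assms(1) by (simp add: zero_oso5_def)
  next
    case (step k c f)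
    have "abs_oso5 (Poly_Mapping.single k c) \<in> graded (left_weight k) (right_weight k)"
      by (rule graded_abs) (simp add: bihom_def)
    then show ?case using step assms by (metis plus_oso5.abs_eq)
  qed
  then show ?thesis by (simp add: a)
qed

text \<open>Comparing left weight components avoids manipulating the infinite families of components of a linear map.\<close>

lemma lpart_eqI: "(\<And>m. lpart m a = lpart m b) \<Longrightarrow> a = b"
  by (metis (no_types, lifting) ext lpart_sum(2))

lemma lpart_lpart: "lpart m (lpart l a) = (if m = l then lpart l a else 0)"
  by (induction a rule: graded_induct)
    (auto simp: clinearD [OF clinear_lpart] lpart_graded)

lemma clinear_eqI_graded:
  assumes "\<And>l p a. a \<in> graded l p \<Longrightarrow> f a = g a" "clinear f" "clinear g"
  shows "f a = g a"
  by (induction a rule: graded_induct) (auto simp: clinearD [OF assms(2)] clinearD [OF assms(3)] assms(1))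

section \<open>Finitely supported sums\<close>

lemma Sum_any_single:
  assumes "\<And>x. x \<noteq> k \<Longrightarrow> f x = 0"
  shows "Sum_any f = f k"
proof -
  have "{x. f x \<noteq> 0} \<subseteq> {k}" using assms by auto
  then show ?thesis by (subst Sum_any.expand_superset [of "{k}"]) auto
qed

lemma clinear_Sum_any_image:
  assumes "clinear h" "finite {k. f k \<noteq> 0}"
  shows "h (Sum_any f) = Sum_any (\<lambda>k. h (f k))"
proof -
  have "{k. h (f k) \<noteq> 0} \<subseteq> {k. f k \<noteq> 0}" using clinearD(3) [OF assms(1)] by auto
  then show ?thesis
    using assms(2) by (subst Sum_any.expand_superset [of "{k. f k \<noteq> 0}" "\<lambda>k. h (f k)"])
      (auto simp: Sum_any.expand_set clinearD [OF assms(1)])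
qed

lemma clinear_Sum_any:
  assumes "\<And>k. clinear (F k)" "\<And>a. finite {k. F k a \<noteq> 0}"
  shows "clinear (\<lambda>a. Sum_any (\<lambda>k. F k a))"
proof (rule clinearI)
  fix x y c
  show "Sum_any (\<lambda>k. F k (x + y)) = Sum_any (\<lambda>k. F k x) + Sum_any (\<lambda>k. F k y)"
    by (simp add: clinearD [OF assms(1)] Sum_any.distrib assms(2))
  show "Sum_any (\<lambda>k. F k (c *\<^sub>C x)) = c *\<^sub>C Sum_any (\<lambda>k. F k x)"
    using clinear_Sum_any_image [of "scaleC c", OF _ assms(2) [of x]]
    by (simp add: clinearD [OF assms(1)] clinearI scaleC_add_right mult.commute)
qed

lemma exp_wedge_image:
  assumes "clinear h" "finite {(r, s). f r s \<noteq> 0}"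
  shows "h (exp_wedge t f) = exp_wedge t (\<lambda>r s. h (f r s))"
proof -
  have "finite {x. (case x of (r, s) \<Rightarrow> phase t (wedge r s) *\<^sub>C f r s) \<noteq> 0}"
    by (rule finite_subset [OF _ assms(2)]) auto
  then show ?thesis
    by (simp add: exp_wedge_def clinear_Sum_any_image [OF assms(1)] clinearD [OF assms(1)] case_prod_unfold)
qed

lemma exp_wedge_add:
  assumes "finite {(r, s). f r s \<noteq> 0}" "finite {(r, s). g r s \<noteq> 0}"
  shows "exp_wedge t (\<lambda>r s. f r s + g r s) = exp_wedge t f + exp_wedge t g"
proof -
  have fin: "finite {x. (case x of (r, s) \<Rightarrow> phase t (wedge r s) *\<^sub>C f r s) \<noteq> 0}"
    if "finite {(r, s). f r s \<noteq> 0}" for f :: "weight \<Rightarrow> weight \<Rightarrow> 'a"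
    by (rule finite_subset [OF _ that]) auto
  show ?thesis unfolding exp_wedge_def
    by (subst Sum_any.distrib [OF fin fin, OF assms, symmetric]) (simp add: scaleC_add_right case_prod_unfold)
qed

lemma exp_wedge_single:
  assumes "\<And>r' s'. (r', s') \<noteq> (r, s) \<Longrightarrow> f r' s' = 0"
  shows "exp_wedge t f = phase t (wedge r s) *\<^sub>C f r s"
proof -
  have "(case x of (r, s) \<Rightarrow> phase t (wedge r s) *\<^sub>C f r s) = 0" if "x \<noteq> (r, s)" for x
    using assms that by (cases x) simp
  then show ?thesis unfolding exp_wedge_def by (subst Sum_any_single [of "(r, s)"]) simp_all
qed

lemma clinear_exp_wedge:
  assumes "\<And>r s. clinear (\<lambda>x. f x r s)" "\<And>x. finite {(r, s). f x r s \<noteq> 0}"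
  shows "clinear (\<lambda>x. exp_wedge t (f x))"
proof (rule clinearI)
  fix x y c
  show "exp_wedge t (f (x + y)) = exp_wedge t (f x) + exp_wedge t (f y)"
    unfolding exp_wedge_add [OF assms(2) [of x] assms(2) [of y], symmetric]
    by (intro arg_cong [of _ _ "exp_wedge t"] ext) (rule clinearD [OF assms(1)])
  have "clinear (scaleC c :: 'b \<Rightarrow> 'b)"
    by (rule clinearI) (simp_all add: scaleC_add_right mult.commute)
  from exp_wedge_image [OF this assms(2) [of x]]
  have "c *\<^sub>C exp_wedge t (f x) = exp_wedge t (\<lambda>r s. c *\<^sub>C f x r s)" .
  also have "(\<lambda>r s. c *\<^sub>C f x r s) = f (c *\<^sub>C x)"
    by (intro ext) (rule clinearD(2) [OF assms(1), symmetric])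
  finally show "exp_wedge t (f (c *\<^sub>C x)) = c *\<^sub>C exp_wedge t (f x)" ..
qed

section \<open>Phases\<close>

lemma phase_add: "phase t (j + k) = phase t j * phase t k"
  by (simp add: phase_def exp_add [symmetric] algebra_simps)

lemma phase_zero [simp]: "phase t 0 = 1"
  by (simp add: phase_def)

lemma phase_inverse_time: "phase (- t) k = phase t (- k)"
  by (simp add: phase_def)

lemma phase_double_time: "phase (- (2 * t)) k = phase t (- 2 * k)"
  by (simp add: phase_def algebra_simps)

lemmas phase_simps = phase_inverse_time phase_double_time phase_add [symmetric]

lemma wedge_zero [simp]: "wedge 0 r = 0" "wedge r 0 = 0"
  by (simp_all add: wedge_def)

section \<open>The star product\<close>

lemma finite_bipart: "finite {(l, p). bipart l p a \<noteq> 0}"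
proof -
  have "bipart l p a = part (\<lambda>l' p'. (l', p') = (l, p)) a" for l p by (simp add: bipart_def)
  then have "{(l, p). bipart l p a \<noteq> 0} = {k. part (\<lambda>l p. (l, p) = k) a \<noteq> 0}" by auto
  then show ?thesis using part_sum(1) [of Pair a] by simp
qed

lemma bilinearC_star: "bilinearC (star \<theta>)"
proof -
  have fin: "finite {k. (case k of (l, p, l', p') \<Rightarrow>
     (phase (- \<theta>) (wedge l l') * phase \<theta> (wedge p p')) *\<^sub>C (bipart l p a * bipart l' p' a')) \<noteq> 0}" (is "finite ?S") for a a'
  proof (rule finite_subset)
    show "?S \<subseteq> (\<lambda>((l, p), (l', p')). (l, p, l', p')) ` ({(l, p). bipart l p a \<noteq> 0} \<times> {(l, p). bipart l p a' \<noteq> 0})"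
      by (force simp: image_iff)
  qed (intro finite_imageI finite_cartesian_product finite_bipart)
  note L = clinearD [OF clinear_bipart]
  show ?thesis
    unfolding bilinearC_def
  proof (intro conjI allI)
    fix b
    have "clinear (\<lambda>a. case k of (l, p, l', p') \<Rightarrow>
        (phase (- \<theta>) (wedge l l') * phase \<theta> (wedge p p')) *\<^sub>C (bipart l p a * bipart l' p' b))" for k
      by (cases k, rule clinearI) (simp_all add: L distrib_right scaleC_add_right mult.commute [where 'a = complex])
    from clinear_Sum_any [OF this fin] show "clinear (\<lambda>a. star \<theta> a b)"
      unfolding star_def .
  next
    fix a
    have "clinear (\<lambda>b. case k of (l, p, l', p') \<Rightarrow>
        (phase (- \<theta>) (wedge l l') * phase \<theta> (wedge p p')) *\<^sub>C (bipart l p a * bipart l' p' b))" for k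
      by (cases k, rule clinearI) (simp_all add: L distrib_left scaleC_add_right mult.commute [where 'a = complex])
    from clinear_Sum_any [OF this fin] show "clinear (star \<theta> a)"
      unfolding star_def [abs_def] .
  qed
qed

lemma clinear_star: "clinear (star \<theta> a)" "clinear (\<lambda>a. star \<theta> a b)"
  using bilinearC_star by (auto simp: bilinearC_def)

lemmas star_linear = clinearD [OF clinear_star(1)] clinearD [OF clinear_star(2)]

lemma star_graded:
  assumes "a \<in> graded l p" "a' \<in> graded l' p'"
  shows "star \<theta> a a' = phase \<theta> (wedge p p' - wedge l l') *\<^sub>C (a * a')"
proof -
  have "star \<theta> a a' = (case (l, p, l', p') of (l, p, l', p') \<Rightarrow>
     (phase (- \<theta>) (wedge l l') * phase \<theta> (wedge p p')) *\<^sub>C (bipart l p a * bipart l' p' a'))"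
    unfolding star_def
  proof (rule Sum_any_single)
    fix k assume k: "k \<noteq> (l, p, l', p')"
    obtain m q m' q' where m: "k = (m, q, m', q')" by (cases k)
    with k have "bipart m q a = 0 \<or> bipart m' q' a' = 0" by (auto simp: bipart_graded [OF assms(1)] bipart_graded [OF assms(2)])
    then show "(case k of (l, p, l', p') \<Rightarrow>
       (phase (- \<theta>) (wedge l l') * phase \<theta> (wedge p p')) *\<^sub>C (bipart l p a * bipart l' p' a')) = 0"
      unfolding m by auto
  qed
  then show ?thesis using assms by (simp add: bipart_graded phase_simps)
qed

lemma star_in_graded:
  "a \<in> graded l p \<Longrightarrow> a' \<in> graded l' p' \<Longrightarrow> star \<theta> a a' \<in> graded (l + l') (p + p')"
  by (simp add: star_graded graded_scaleC graded_mult)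

lemma times_graded_star:
  assumes "a \<in> graded l p" "a' \<in> graded l' p'"
  shows "a * a' = phase \<theta> (wedge l l' - wedge p p') *\<^sub>C star \<theta> a a'"
  using assms by (simp add: star_graded phase_simps)

lemma wedge_add [simp]: "wedge (r + r') s = wedge r s + wedge r' s" "wedge r (s + s') = wedge r s + wedge r s'"
  by (simp_all add: wedge_def algebra_simps)

lemma wedge_swap: "wedge s r = - wedge r s"
  by (simp add: wedge_def)

text \<open>The twisting factors are values of bicharacters, hence satisfy the 2-cocycle identity.\<close>

lemma star_assoc: "star \<theta> (star \<theta> a b) c = star \<theta> a (star \<theta> b c)"
proof -
  have 1: "star \<theta> (star \<theta> a b) c = star \<theta> a (star \<theta> b c)"
    if "a \<in> graded l p" "b \<in> graded l' p'" "c \<in> graded l'' p''" for a b c l p l' p' l'' p''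
  proof -
    have "star \<theta> (star \<theta> a b) c = phase \<theta> (wedge (p + p') p'' - wedge (l + l') l'') *\<^sub>C
        phase \<theta> (wedge p p' - wedge l l') *\<^sub>C (a * b * c)"
      using star_graded [OF star_in_graded [OF that(1,2)] that(3), of \<theta> \<theta>] star_graded [OF that(1,2)] by simp
    moreover have "star \<theta> a (star \<theta> b c) = phase \<theta> (wedge p (p' + p'') - wedge l (l' + l'')) *\<^sub>C
        phase \<theta> (wedge p' p'' - wedge l' l'') *\<^sub>C (a * (b * c))"
      using star_graded [OF that(1) star_in_graded [OF that(2,3)], of \<theta> \<theta>] star_graded [OF that(2,3)] by simp
    ultimately show ?thesis by (simp add: phase_simps algebra_simps)
  qed
  have 2: "star \<theta> (star \<theta> a b) c = star \<theta> a (star \<theta> b c)"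
    if "a \<in> graded l p" "b \<in> graded l' p'" for a b l p l' p'
    by (induction c rule: graded_induct) (simp_all add: star_linear 1 [OF that])
  have 3: "star \<theta> (star \<theta> a b) c = star \<theta> a (star \<theta> b c)"
    if "a \<in> graded l p" for a l p
    by (induction b rule: graded_induct) (simp_all add: star_linear 2 [OF that])
  show ?thesis by (induction a rule: graded_induct) (simp_all add: star_linear 3)
qed

section \<open>Components of linear maps\<close>

lemma finite_lpart_shift: "finite {r. lpart (l + r) a \<noteq> 0}"
  using finite_vimageI [OF lpart_sum(1) [of a], of "\<lambda>r. l + r"] by (simp add: vimage_def inj_on_def)

lemma map_part_graded:
  assumes "clinear u" "a \<in> graded l p"
  shows "map_part r u a = lpart (l + r) (u a)"
  unfolding map_part_def
  by (subst Sum_any_single [of l]) (use assms in \<open>auto simp: lpart_graded clinearD [OF clinear_lpart] clinearD [OF assms(1)]\<close>)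

lemma clinear_map_part:
  assumes "clinear u" shows "clinear (map_part r u)"
  unfolding map_part_def
proof (rule clinear_Sum_any)
  show "clinear (\<lambda>a. lpart (l + r) (u (lpart l a)))" for l
    by (rule clinearI) (simp_all add: clinearD [OF clinear_lpart] clinearD [OF assms])
  show "finite {l. lpart (l + r) (u (lpart l a)) \<noteq> 0}" for a
    by (rule finite_subset [OF _ lpart_sum(1) [of a]]) (clarsimp simp: clinearD [OF clinear_lpart] clinearD [OF assms])
qed

text \<open>A linear map can have infinitely many components, but only finitely many of them are nonzero at a given argument.\<close>

lemma finite_map_part:
  assumes "clinear u" shows "finite {r. map_part r u a \<noteq> 0}"
proof (induction a rule: graded_induct)
  case (add a b)
  have "{r. map_part r u (a + b) \<noteq> 0} \<subseteq> {r. map_part r u a \<noteq> 0} \<union> {r. map_part r u b \<noteq> 0}"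
    by (clarsimp simp: clinearD [OF clinear_map_part [OF assms]])
  then show ?case using add by (meson finite_UnI finite_subset)
qed (auto simp: map_part_graded [OF assms] finite_lpart_shift clinearD [OF clinear_map_part [OF assms]])

lemma finite_support_prod:
  assumes "finite A" "finite B" "\<And>r s. f r s \<noteq> 0 \<Longrightarrow> r \<in> A \<and> s \<in> B"
  shows "finite {(r, s). f r s \<noteq> 0}"
  by (rule finite_subset [of _ "A \<times> B"]) (use assms in auto)

lemma finite_twist_support:
  assumes "clinear u" shows "finite {(r, l). map_part r u (lpart l a) \<noteq> 0}"
proof -
  have "{(r, l). map_part r u (lpart l a) \<noteq> 0} \<subseteq> (\<Union>l\<in>{l. lpart l a \<noteq> 0}. {r. map_part r u (lpart l a) \<noteq> 0} \<times> {l})"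
    using clinearD(3) [OF clinear_map_part [OF assms]] by force
  then show ?thesis
    by (rule finite_subset) (intro finite_UN_I finite_cartesian_product lpart_sum finite_map_part assms, simp)
qed

lemma clinear_twist_D:
  assumes "clinear u" shows "clinear (twist_D \<theta> u)"
  unfolding twist_D_def
  by (rule clinear_exp_wedge [OF _ finite_twist_support [OF assms]])
    (auto intro!: clinearI simp: clinearD [OF clinear_map_part [OF assms]] clinearD [OF clinear_lpart])

text \<open>At an argument of weight \<open>l\<close>, the part of \<open>u a\<close> of weight \<open>m\<close> comes from the component of \<open>u\<close> of
weight \<open>m - l\<close>; \<open>twist_D\<close> multiplies it by the corresponding phase.\<close>

lemma lpart_twist_D:
  assumes "clinear u" "a \<in> graded l p"
  shows "lpart m (twist_D \<theta> u a) = phase \<theta> (- wedge (m - l) l) *\<^sub>C lpart m (u a)"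
proof -
  have "lpart m (twist_D \<theta> u a) = exp_wedge (- \<theta>) (\<lambda>r l. lpart m (map_part r u (lpart l a)))"
    unfolding twist_D_def by (rule exp_wedge_image [OF clinear_lpart finite_twist_support [OF assms(1)]])
  also have "\<dots> = phase (- \<theta>) (wedge (m - l) l) *\<^sub>C lpart m (map_part (m - l) u (lpart l a))"
    by (rule exp_wedge_single)
      (use assms in \<open>auto simp: lpart_graded map_part_graded lpart_lpart clinearD [OF clinear_map_part [OF assms(1)]] clinearD [OF clinear_lpart]\<close>)
  finally show ?thesis using assms by (simp add: lpart_graded map_part_graded lpart_lpart phase_simps)
qed

lemma twist_D_add:
  assumes "clinear u" "clinear v"
  shows "twist_D \<theta> (\<lambda>a. u a + v a) a = twist_D \<theta> u a + twist_D \<theta> v a"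
proof (rule clinear_eqI_graded [of "twist_D \<theta> (\<lambda>a. u a + v a)" "\<lambda>a. twist_D \<theta> u a + twist_D \<theta> v a"])
  have *: "clinear (\<lambda>a. u a + v a)" by (auto intro!: clinearI simp: clinearD [OF assms(1)] clinearD [OF assms(2)] scaleC_add_right)
  show "clinear (twist_D \<theta> (\<lambda>a. u a + v a))" by (rule clinear_twist_D [OF *])
  show "clinear (\<lambda>a. twist_D \<theta> u a + twist_D \<theta> v a)"
    by (auto intro!: clinearI simp: clinearD [OF clinear_twist_D [OF assms(1)]] clinearD [OF clinear_twist_D [OF assms(2)]] scaleC_add_right)
  fix l p a assume "a \<in> graded l p"
  then show "twist_D \<theta> (\<lambda>a. u a + v a) a = twist_D \<theta> u a + twist_D \<theta> v a"
    by - (rule lpart_eqI, simp add: clinearD [OF clinear_lpart] lpart_twist_D * assms scaleC_add_right)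
qed

lemma twist_D_zero: "twist_D \<theta> (\<lambda>a. 0) = (\<lambda>a. 0)"
  by (rule ext) (simp add: twist_D_def map_part_def clinearD [OF clinear_lpart] exp_wedge_def)

lemma twist_D_inverse:
  assumes "clinear u" shows "twist_D \<theta> (twist_D (- \<theta>) u) a = u a"
proof (rule clinear_eqI_graded [of "twist_D \<theta> (twist_D (- \<theta>) u)" u])
  show "clinear (twist_D \<theta> (twist_D (- \<theta>) u))" by (intro clinear_twist_D assms)
  fix l p a assume "a \<in> graded l p"
  then show "twist_D \<theta> (twist_D (- \<theta>) u) a = u a"
    by - (rule lpart_eqI, simp add: clinearD [OF clinear_lpart] lpart_twist_D clinear_twist_D assms phase_simps)
qed fact

definition homogeneous :: "weight \<Rightarrow> (oso5 \<Rightarrow> oso5) \<Rightarrow> bool"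
  where "homogeneous r u \<longleftrightarrow> clinear u \<and> (\<forall>l p a. a \<in> graded l p \<longrightarrow> u a \<in> graded (l + r) p)"

lemma homogeneousD:
  assumes "homogeneous r u"
  shows "clinear u" "a \<in> graded l p \<Longrightarrow> u a \<in> graded (l + r) p"
  using assms unfolding homogeneous_def by blast+

lemma map_part_homogeneous:
  assumes "homogeneous r u" shows "map_part s u = (if s = r then u else (\<lambda>a. 0))"
proof
  note u = homogeneousD(1) [OF assms]
  fix a
  show "map_part s u a = (if s = r then u else (\<lambda>a. 0)) a"
    by (induction a rule: graded_induct)
      (auto simp: clinearD [OF clinear_map_part [OF u]] clinearD [OF u] map_part_graded [OF u] lpart_graded [OF homogeneousD(2) [OF assms]])
qed

lemma twist_D_homogeneous:
  assumes "homogeneous r u" "a \<in> graded l p"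
  shows "twist_D \<theta> u a = phase \<theta> (- wedge r l) *\<^sub>C u a"
proof -
  have "twist_D \<theta> u a = phase (- \<theta>) (wedge r l) *\<^sub>C map_part r u (lpart l a)"
    unfolding twist_D_def
    by (rule exp_wedge_single)
     (use assms in \<open>auto simp: lpart_graded map_part_homogeneous clinearD [OF homogeneousD(1)]\<close>)
  then show ?thesis using assms by (simp add: lpart_graded map_part_homogeneous phase_simps)
qed

lemma homogeneous_twist_D: "homogeneous r u \<Longrightarrow> homogeneous r (twist_D \<theta> u)"
  unfolding homogeneous_def [of r "twist_D \<theta> u"]
  by (simp add: homogeneousD clinear_twist_D twist_D_homogeneous graded_scaleC)

lemma braided_bracket_homogeneous:
  assumes "homogeneous r u" "homogeneous s u'"
  shows "braided_bracket \<theta> u u' a = u (u' a) - phase \<theta> (- 2 * wedge r s) *\<^sub>C u' (u a)"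
proof -
  have "exp_wedge (- 2 * \<theta>) (\<lambda>r s. map_part s u' (map_part r u a)) = phase (- 2 * \<theta>) (wedge r s) *\<^sub>C map_part s u' (map_part r u a)"
    by (rule exp_wedge_single)
      (use assms in \<open>auto simp: map_part_homogeneous clinearD [OF homogeneousD(1) [OF assms(2)]]\<close>)
  then show ?thesis using assms by (simp add: braided_bracket_def map_part_homogeneous phase_double_time)
qed

text \<open>The phases in the two compositions of the twisted maps are opposite at \<open>wedge r s\<close>. The braiding, with exponent
\<open>- 2 * wedge r s\<close>, makes them equal, so that the commutator can be factored out.\<close>

lemma twist_D_bracket:
  assumes u: "homogeneous r u" and v: "homogeneous s v"
  shows "braided_bracket \<theta> (twist_D \<theta> u) (twist_D \<theta> v) a = phase (- \<theta>) (wedge r s) *\<^sub>C twist_D \<theta> (commutator u v) a"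
  (is "?L a = ?R a")
proof (rule clinear_eqI_graded [of ?L ?R])
  note [simp] = clinearD [OF homogeneousD(1) [OF u]] clinearD [OF homogeneousD(1) [OF v]]
  have c: "homogeneous (r + s) (commutator u v)"
    unfolding homogeneous_def commutator_def
  proof (intro conjI allI impI graded_diff)
    show "clinear (\<lambda>a. u (v a) - v (u a))"
      by (rule clinearI) (simp_all add: cvec.scale_right_diff_distrib)
    fix l p a assume a: "a \<in> graded l p"
    show "u (v a) \<in> graded (l + (r + s)) p" "v (u a) \<in> graded (l + (r + s)) p"
      using homogeneousD(2) [OF u homogeneousD(2) [OF v a]] homogeneousD(2) [OF v homogeneousD(2) [OF u a]]
      by (simp_all add: ac_simps)
  qed
  note hu = homogeneous_twist_D [OF u, of \<theta>] and hv = homogeneous_twist_D [OF v, of \<theta>]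
  note L = clinearD [OF homogeneousD(1) [OF hu]] clinearD [OF homogeneousD(1) [OF hv]]
    clinearD [OF homogeneousD(1) [OF homogeneous_twist_D [OF c]]]
  show "clinear ?L" "clinear ?R"
    unfolding braided_bracket_homogeneous [OF hu hv]
    by (auto intro!: clinearI simp: L algebra_simps scaleC_add_right cvec.scale_right_diff_distrib)
  fix l p a assume a: "a \<in> graded l p"
  have e: "phase \<theta> (- wedge r (l + s)) * phase \<theta> (- wedge s l) = phase \<theta> (- wedge r s - wedge (r + s) l)"
    "phase \<theta> (- 2 * wedge r s) * (phase \<theta> (- wedge s (l + r)) * phase \<theta> (- wedge r l)) = phase \<theta> (- wedge r s - wedge (r + s) l)"
    "phase (- \<theta>) (wedge r s) * phase \<theta> (- wedge (r + s) l) = phase \<theta> (- wedge r s - wedge (r + s) l)"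
    unfolding phase_inverse_time phase_add [symmetric]
    by (rule arg_cong [of _ _ "phase \<theta>"], simp add: wedge_swap [of s r])+
  have uv: "twist_D \<theta> u (twist_D \<theta> v a) = phase \<theta> (- wedge r s - wedge (r + s) l) *\<^sub>C u (v a)"
    unfolding twist_D_homogeneous [OF v a] L twist_D_homogeneous [OF u homogeneousD(2) [OF v a]] e(1) [symmetric]
    by (simp add: mult.commute)
  have vu: "phase \<theta> (- 2 * wedge r s) *\<^sub>C twist_D \<theta> v (twist_D \<theta> u a) = phase \<theta> (- wedge r s - wedge (r + s) l) *\<^sub>C v (u a)"
    unfolding twist_D_homogeneous [OF u a] L twist_D_homogeneous [OF v homogeneousD(2) [OF u a]] e(2) [symmetric]
    by (simp add: ac_simps)
  have "?L a = phase \<theta> (- wedge r s - wedge (r + s) l) *\<^sub>C commutator u v a"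
    unfolding braided_bracket_homogeneous [OF hu hv] uv vu commutator_def cvec.scale_right_diff_distrib ..
  also have "\<dots> = ?R a"
    unfolding twist_D_homogeneous [OF c a] e(3) [symmetric] by simp
  finally show "?L a = ?R a" .
qed

section \<open>The matrix entries as generators\<close>

lemma prod_single_one:
  "finite S \<Longrightarrow> (\<Prod>x\<in>S. Poly_Mapping.single (g x) (1::complex)) = Poly_Mapping.single (\<Sum>x\<in>S. g x) 1"
  for g :: "'b \<Rightarrow> 'a::comm_monoid_add"
  by (induction S rule: finite_induct) (simp_all add: mult_single)

lemma var_power: "var J K ^ n = Poly_Mapping.single (Poly_Mapping.single (J, K) n) 1"
  by (induction n) (simp_all add: var_def mult_single single_add [symmetric])

lemma monomial_eq_prod: "Poly_Mapping.single m 1 = (\<Prod>(J, K)\<in>UNIV. var J K ^ poly_mapping.lookup m (J, K))"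
proof -
  have "(\<Sum>k\<in>UNIV. Poly_Mapping.single k (poly_mapping.lookup m k)) = m"
    by (rule poly_mapping_eqI) (simp add: lookup_sum lookup_single when_def)
  then show ?thesis by (simp add: var_power case_prod_unfold prod_single_one)
qed

text \<open>The matrix entries generate the algebra, so homomorphisms and derivations are determined by them.\<close>

lemma oso5_induct [case_names scalar gen add mult]:
  assumes scalar: "\<And>c. P (c *\<^sub>C 1)" and gen: "\<And>J K. P (gen_n J K)"
    and add: "\<And>a b. P a \<Longrightarrow> P b \<Longrightarrow> P (a + b)" and mult: "\<And>a b. P a \<Longrightarrow> P b \<Longrightarrow> P (a * b)"
  shows "P a"
proof -
  interpret h: unital_ring_hom abs_oso5 by (rule unital_ring_hom_abs)
  have one: "P 1" using scalar [of 1] by simp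
  have pow: "P b \<Longrightarrow> P (b ^ n)" for b n by (induction n) (simp_all add: one mult)
  have pr: "finite S \<Longrightarrow> (\<And>x. P (f x)) \<Longrightarrow> P (prod f S)" for S :: "(5 \<times> 5) set" and f
    by (induction S rule: finite_induct) (simp_all add: one mult)
  obtain f where a: "a = abs_oso5 f" by (rule oso5_cases)
  have "P (abs_oso5 f)"
  proof (induction f rule: poly_mapping_induct_add)
    case zero
    then show ?case using scalar [of 0] by simp
  next
    case (step k c f)
    have "abs_oso5 (Poly_Mapping.single k c) = c *\<^sub>C 1 * (\<Prod>(J, K)\<in>UNIV. gen_n J K ^ poly_mapping.lookup k (J, K))"
    proof -
      have "Poly_Mapping.single k c = c *\<^sub>C Poly_Mapping.single k 1" by (simp add: scaleC_complex_def)
      then show ?thesis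
        by (simp add: monomial_eq_prod scaleC_oso5.abs_eq [symmetric] h.prod h.power case_prod_unfold gen_n.abs_eq)
    qed
    moreover have "P (\<Prod>(J, K)\<in>UNIV. gen_n J K ^ poly_mapping.lookup k (J, K))"
      by (rule pr) (auto intro: pow gen)
    ultimately show ?case using add [OF step mult [OF scalar]] by (simp only: h.add)
  qed
  then show ?thesis by (simp add: a)
qed

lemma derivation_eqI:
  assumes X: "ring_derivation X" "clinear X" and Y: "ring_derivation Y" "clinear Y"
    and "\<And>J K. X (gen_n J K) = Y (gen_n J K)"
  shows "X a = Y a"
proof -
  interpret X: ring_derivation X by fact
  interpret Y: ring_derivation Y by fact
  show ?thesis
    by (induction a rule: oso5_induct)
      (simp_all add: assms X.add X.mult Y.add Y.mult clinearD(2) [OF X(2)] clinearD(2) [OF Y(2)])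
qed

lemma clinear_L_op: "clinear (L_op I J)"
proof -
  interpret ring_derivation "L_op I J" by (rule ring_derivation_L_op)
  show ?thesis
  proof (rule clinearI)
    fix a :: oso5 and c
    obtain f where a: "a = abs_oso5 f" by (rule oso5_cases)
    show "L_op I J (c *\<^sub>C a) = c *\<^sub>C L_op I J a"
      by (simp add: a scaleC_oso5.abs_eq L_op.abs_eq clinearD [OF clinear_L_poly])
  qed (rule add)
qed

section \<open>The coproduct and the counit\<close>

lemma unital_ring_hom_coproduct: "unital_ring_hom coproduct"
proof -
  interpret h: unital_ring_hom "eval_poly (\<chi> J K. \<Sum>L\<in>UNIV. gen_n J L \<otimes>\<^sub>C gen_n L K)"
    by (rule unital_ring_hom_eval)
  show ?thesis
  proof
    fix x y :: oso5
    obtain f g where "x = abs_oso5 f" "y = abs_oso5 g" by (metis oso5_cases)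
    then show "coproduct (x + y) = coproduct x + coproduct y" "coproduct (x * y) = coproduct x * coproduct y"
      by (simp_all add: plus_oso5.abs_eq times_oso5.abs_eq coproduct.abs_eq h.add h.mult)
    show "coproduct 1 = 1" by (simp add: one_oso5_def coproduct.abs_eq)
  qed
qed

interpretation coproduct: unital_ring_hom coproduct by (rule unital_ring_hom_coproduct)

lemma clinear_coproduct: "clinear coproduct"
proof (rule clinearI)
  fix a c
  obtain f where a: "a = abs_oso5 f" by (rule oso5_cases)
  show "coproduct (c *\<^sub>C a) = c *\<^sub>C coproduct a"
    by (simp add: a scaleC_oso5.abs_eq coproduct.abs_eq clinearD [OF clinear_eval_poly])
qed (rule coproduct.add)

lemma coproduct_gen_n: "coproduct (gen_n J K) = (\<Sum>L\<in>UNIV. gen_n J L \<otimes>\<^sub>C gen_n L K)"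
  by (simp add: gen_n.abs_eq coproduct.abs_eq)

lift_definition counit :: "oso5 \<Rightarrow> complex" is "eval_poly (mat 1)"
  by (metis (no_types, lifting) so5_eq_def eval_poly_ideal so5_mat_id clinearD(5) [OF clinear_eval_poly] eq_iff_diff_eq_0)

lemma unital_ring_hom_counit: "unital_ring_hom counit"
proof -
  interpret h: unital_ring_hom "eval_poly (mat 1 :: complex^5^5)" by (rule unital_ring_hom_eval)
  show ?thesis
  proof
    fix x y :: oso5
    obtain f g where "x = abs_oso5 f" "y = abs_oso5 g" by (metis oso5_cases)
    then show "counit (x + y) = counit x + counit y" "counit (x * y) = counit x * counit y"
      by (simp_all add: plus_oso5.abs_eq times_oso5.abs_eq counit.abs_eq h.add h.mult)
    show "counit 1 = 1" by (simp add: one_oso5_def counit.abs_eq)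
  qed
qed

interpretation counit: unital_ring_hom counit by (rule unital_ring_hom_counit)

lemma clinear_counit: "clinear counit"
proof (rule clinearI)
  fix a c
  obtain f where a: "a = abs_oso5 f" by (rule oso5_cases)
  show "counit (c *\<^sub>C a) = c *\<^sub>C counit a"
    by (simp add: a scaleC_oso5.abs_eq counit.abs_eq clinearD [OF clinear_eval_poly])
qed (rule counit.add)

lemma counit_gen_n: "counit (gen_n J K) = (if J = K then 1 else 0)"
  by (simp add: gen_n.abs_eq counit.abs_eq mat_def)

subsection \<open>Contracting the second leg\<close>

text \<open>The map \<open>id \<otimes> \<phi>\<close>. With the coproduct it turns a functional into an operator that commutes with left translations.\<close>

definition slice :: "(oso5 \<Rightarrow> complex) \<Rightarrow> (oso5, oso5) tensor \<Rightarrow> oso5"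
  where "slice \<phi> = tensor_lift (\<lambda>x y. \<phi> y *\<^sub>C x)"

lemma bilinearC_slice: "clinear \<phi> \<Longrightarrow> bilinearC (\<lambda>x y. \<phi> y *\<^sub>C x)"
  by (auto simp: bilinearC_def clinearD scaleC_add_right scaleC_add_left scaleC_complex_def mult.commute intro!: clinearI)

lemma clinear_slice: "clinear \<phi> \<Longrightarrow> clinear (slice \<phi>)"
  unfolding slice_def by (intro clinear_tensor_lift bilinearC_slice)

lemma slice_tensor: "clinear \<phi> \<Longrightarrow> slice \<phi> (x \<otimes>\<^sub>C y) = \<phi> y *\<^sub>C x"
  unfolding slice_def by (simp add: bilinearC_slice)

lemma tensor_map_tensor: "clinear u \<Longrightarrow> clinear v \<Longrightarrow> tensor_map u v (x \<otimes>\<^sub>C y) = u x \<otimes>\<^sub>C v y"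
  unfolding tensor_map_def by (simp add: bilinearC_tensor)

lemma clinear_id: "clinear id"
  by (rule clinearI) simp_all

lemma slice_tensor_map:
  assumes "clinear u" "clinear \<phi>"
  shows "slice \<phi> (tensor_map u id t) = u (slice \<phi> t)"
proof -
  note M = clinearD [OF clinear_tensor_map [OF assms(1) clinear_id]]
  show ?thesis
  proof (induction t rule: tensor_induct)
    case (tensor a b)
    show ?case unfolding tensor_map_tensor [OF assms(1) clinear_id] slice_tensor [OF assms(2)] clinearD(2) [OF assms(1)] id_apply [of b] ..
  qed (simp_all only: M(1,3) clinearD(1,3) [OF clinear_slice [OF assms(2)]] clinearD(1,3) [OF assms(1)])
qed

text \<open>A tangent vector at the identity is a functional \<open>\<phi>\<close> that is a derivation over the counit. This lemma is the reason
why the operator \<open>(id \<otimes> \<phi>) \<circ> coproduct\<close> is a derivation.\<close>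

lemma slice_derivation:
  assumes \<phi>: "clinear \<phi>" and \<phi>_mult: "\<And>x y. \<phi> (x * y) = \<phi> x * counit y + counit x * \<phi> y"
  shows "slice \<phi> (s * t) = slice \<phi> s * slice counit t + slice counit s * slice \<phi> t"
proof (induction s rule: tensor_induct)
  case (tensor a b)
  show ?case
    by (induction t rule: tensor_induct)
      (simp_all add: slice_tensor \<phi> clinear_counit \<phi>_mult clinearD [OF clinear_slice [OF \<phi>]]
        clinearD [OF clinear_slice [OF clinear_counit]] distrib_left distrib_right scaleC_add_left counit.mult mult.commute [where 'a = complex])
next
  case (add s s')
  then show ?case
    by (simp add: clinearD(1) [OF clinear_slice [OF \<phi>]] clinearD(1) [OF clinear_slice [OF clinear_counit]] distrib_right
        add.assoc add.left_commute)
qed (simp add: clinearD(3) [OF clinear_slice [OF \<phi>]] clinearD(3) [OF clinear_slice [OF clinear_counit]])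

lemma slice_counit_mult: "slice counit (s * t) = slice counit s * slice counit t"
proof (induction s rule: tensor_induct)
  case (tensor a b)
  show ?case
    by (induction t rule: tensor_induct)
      (simp_all add: slice_tensor clinear_counit clinearD [OF clinear_slice [OF clinear_counit]] distrib_left distrib_right counit.mult mult.commute [where 'a = complex])
qed (simp_all add: clinearD(1,3) [OF clinear_slice [OF clinear_counit]] distrib_right)

lemma slice_counit_coproduct: "slice counit (coproduct a) = a"
proof (induction a rule: oso5_induct)
  case (scalar c)
  show ?case by (simp add: clinearD [OF clinear_coproduct] clinearD [OF clinear_slice [OF clinear_counit]] one_tensor_def slice_tensor clinear_counit)
next
  case (gen J K)
  have "(\<Sum>L\<in>UNIV. counit (gen_n L K) *\<^sub>C gen_n J L) = (\<Sum>L\<in>UNIV. if L = K then gen_n J L else 0)"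
    by (rule sum.cong) (auto simp: counit_gen_n)
  then show ?case by (simp add: coproduct_gen_n clinearD [OF clinear_slice [OF clinear_counit]] slice_tensor clinear_counit)
qed (simp_all add: coproduct.add coproduct.mult slice_counit_mult clinearD [OF clinear_slice [OF clinear_counit]])

section \<open>The ideal of \<open>SO(4)\<close>\<close>

definition so4_gens :: "oso5 set"
  where "so4_gens = {gen_n 5 5 - 1} \<union> {gen_n 5 \<nu> | \<nu>. \<nu> \<noteq> 5} \<union> {gen_n \<mu> 5 | \<mu>. \<mu> \<noteq> 5}"

lemma so4_gens_graded: "g \<in> so4_gens \<Longrightarrow> \<exists>l p. g \<in> graded l p"
proof -
  have "gen_n 5 5 \<in> graded 0 0" using graded_gen_n [of 5 5] by (simp add: eps_def zero_prod_def)
  then have "gen_n 5 5 - 1 \<in> graded 0 0" using graded_one graded_diff by blast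
  then show "g \<in> so4_gens \<Longrightarrow> \<exists>l p. g \<in> graded l p" using graded_gen_n unfolding so4_gens_def by blast
qed

lemma part_mult_graded:
  assumes "a \<in> graded l p"
  shows "part R (x * a) = part (\<lambda>l' p'. R (l' + l) (p' + p)) x * a"
proof -
  obtain f where f: "bihom l p f" "a = abs_oso5 f" using assms by (rule graded_ex_poly)
  obtain g where g: "x = abs_oso5 g" by (rule oso5_cases)
  show ?thesis by (simp add: f g times_oso5.abs_eq part.abs_eq part_poly_mult_bihom [OF f(1)])
qed

text \<open>The ideal is generated by weight vectors, hence is graded.\<close>

lemma part_so4: "j \<in> ideal_gen so4_gens \<Longrightarrow> part R j \<in> ideal_gen so4_gens"
proof (induction rule: ideals.span_induct_alt)
  case base
  show ?case by (simp add: clinearD [OF clinear_part] ideals.span_zero)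
next
  case (step c g p)
  obtain l r where "g \<in> graded l r" using so4_gens_graded step(1) by blast
  then have "part R (c * g + p) = part (\<lambda>l' r'. R (l' + l) (r' + r)) c * g + part R p"
    by (simp add: clinearD [OF clinear_part] part_mult_graded)
  moreover have "part (\<lambda>l' r'. R (l' + l) (r' + r)) c * g \<in> ideal_gen so4_gens"
    using step(1) by (intro ideal_mult ideals.span_base)
  ultimately show ?case using step by (simp add: ideals.span_add)
qed

lemma bipart_closed:
  assumes "\<And>l p. bipart l p a \<in> V" "0 \<in> V" "\<And>x y. x \<in> V \<Longrightarrow> y \<in> V \<Longrightarrow> x + y \<in> V"
  shows "a \<in> V"
proof -
  have s: "sum f S \<in> V" if "\<And>x. x \<in> S \<Longrightarrow> f x \<in> V" for f :: "weight \<times> weight \<Rightarrow> oso5" and S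
    using that by (induction S rule: infinite_finite_induct) (auto intro: assms)
  have "part (\<lambda>l' p'. (l', p') = k) a \<in> V" for k
    using assms(1) [of "fst k" "snd k"] unfolding bipart_def by (cases k) simp
  then have "Sum_any (\<lambda>k. part (\<lambda>l p. (l, p) = k) a) \<in> V"
    unfolding Sum_any.expand_set by (intro s) auto
  then show ?thesis using part_sum(2) [of Pair a] by simp
qed

lemma lpart_closed:
  assumes "\<And>m. lpart m a \<in> V" "0 \<in> V" "\<And>x y. x \<in> V \<Longrightarrow> y \<in> V \<Longrightarrow> x + y \<in> V"
  shows "a \<in> V"
proof -
  have s: "sum f S \<in> V" if "\<And>x. x \<in> S \<Longrightarrow> f x \<in> V" for f :: "weight \<Rightarrow> oso5" and S
    using that by (induction S rule: infinite_finite_induct) (auto intro: assms)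
  have "Sum_any (\<lambda>l. lpart l a) \<in> V"
    unfolding Sum_any.expand_set by (intro s assms)
  then show ?thesis by (simp only: lpart_sum(2))
qed

text \<open>A graded subspace is an ideal for the deformed product exactly if it is an ideal for the commutative one, since on
weight vectors the two products are proportional.\<close>

lemma so4_ideal_eq: "so4_ideal \<theta> = ideal_gen so4_gens"
proof
  let ?I = "ideal_gen so4_gens"
  have sc: "c *\<^sub>C x \<in> ?I" if "x \<in> ?I" for c x
    using ideal_mult(1) [OF that, of "c *\<^sub>C 1"] by simp
  have star1: "star \<theta> a j \<in> ?I \<and> star \<theta> j a \<in> ?I" if j: "j \<in> ?I" for a j
  proof (induction a rule: graded_induct)
    case zero
    show ?case by (simp add: star_linear ideals.span_zero)
  next
    case (add a b)
    then show ?case by (simp add: star_linear ideals.span_add)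
  next
    case (graded l p a)
    have "j \<in> {x. star \<theta> a x \<in> ?I \<and> star \<theta> x a \<in> ?I}"
    proof (rule bipart_closed)
      fix m q
      have "bipart m q j \<in> ?I" unfolding bipart_def by (rule part_so4 [OF j])
      then show "bipart m q j \<in> {x. star \<theta> a x \<in> ?I \<and> star \<theta> x a \<in> ?I}"
        by (simp add: star_graded [OF graded bipart_in_graded] star_graded [OF bipart_in_graded graded] sc ideal_mult)
    qed (simp_all add: star_linear ideals.span_zero ideals.span_add)
    then show ?case by simp
  qed
  show "so4_ideal \<theta> \<subseteq> ?I"
  proof
    fix j assume "j \<in> so4_ideal \<theta>"
    then show "j \<in> ?I"
    proof induction
      case gen_55
      show ?case by (rule ideals.span_base) (simp add: so4_gens_def)
    next
      case (gen_row \<nu>)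
      then show ?case by (intro ideals.span_base) (auto simp: so4_gens_def)
    next
      case (gen_col \<mu>)
      then show ?case by (intro ideals.span_base) (auto simp: so4_gens_def)
    qed (auto simp: star1 ideals.span_zero ideals.span_add)
  qed
  have g: "g \<in> so4_gens \<Longrightarrow> g \<in> so4_ideal \<theta>" for g
    unfolding so4_gens_def by (auto intro: so4_ideal.intros)
  have cg: "c * g \<in> so4_ideal \<theta>" if gg: "g \<in> so4_gens" for c g
  proof (induction c rule: graded_induct)
    case zero
    show ?case by (simp add: so4_ideal.zero)
  next
    case (add a b)
    then show ?case by (simp add: distrib_right so4_ideal.add)
  next
    case (graded l p a)
    obtain l' p' where "g \<in> graded l' p'" using so4_gens_graded [OF gg] by blast
    from times_graded_star [OF graded this, of \<theta>]
    have "a * g = star \<theta> (phase \<theta> (wedge l l' - wedge p p') *\<^sub>C a) g" by (simp add: star_linear)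
    then show ?case using so4_ideal.left [OF g [OF gg]] by simp
  qed
  show "?I \<subseteq> so4_ideal \<theta>"
  proof
    fix j assume "j \<in> ?I"
    then show "j \<in> so4_ideal \<theta>"
      by (induction rule: ideals.span_induct_alt) (auto intro: so4_ideal.zero so4_ideal.add cg)
  qed
qed

text \<open>The kernel of \<open>id \<otimes> \<pi>\<close>. It is an ideal of the tensor square (\<open>kernel_mult\<close>), so congruences
modulo it can be multiplied.\<close>

definition so4_kernel :: "(oso5, oso5) tensor set"
  where "so4_kernel = cspan {a \<otimes>\<^sub>C j | a j. j \<in> ideal_gen so4_gens}"

lemma proj_kernel_eq: "proj_kernel \<theta> = so4_kernel"
  by (simp add: proj_kernel_def so4_kernel_def so4_ideal_eq)

lemma kernel_tensor: "j \<in> ideal_gen so4_gens \<Longrightarrow> a \<otimes>\<^sub>C j \<in> so4_kernel"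
  unfolding so4_kernel_def by (rule cvec.span_base) blast

lemma kernel_subspace:
  "0 \<in> so4_kernel" "s \<in> so4_kernel \<Longrightarrow> t \<in> so4_kernel \<Longrightarrow> s + t \<in> so4_kernel"
  "s \<in> so4_kernel \<Longrightarrow> c *\<^sub>C s \<in> so4_kernel" "s \<in> so4_kernel \<Longrightarrow> - s \<in> so4_kernel"
  unfolding so4_kernel_def by (simp_all only: cvec.span_zero cvec.span_add cvec.span_scale cvec.span_neg)

lemma kernel_mult:
  assumes "t \<in> so4_kernel" shows "s * t \<in> so4_kernel" "t * s \<in> so4_kernel"
proof -
  have *: "s * (a \<otimes>\<^sub>C j) \<in> so4_kernel" if j: "j \<in> ideal_gen so4_gens" for s a j
  proof (induction s rule: tensor_induct)
    case (tensor b c)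
    have "(b * a) \<otimes>\<^sub>C (c * j) \<in> so4_kernel" by (intro kernel_tensor ideal_mult j)
    then show ?case by simp
  qed (simp_all add: kernel_subspace distrib_right)
  show "s * t \<in> so4_kernel"
    using assms unfolding so4_kernel_def
  proof (induction rule: cvec.span_induct_alt)
    case (step c x y)
    then have "s * x \<in> so4_kernel" using * by auto
    then show ?case using step(2) unfolding so4_kernel_def
      by (simp add: distrib_left cvec.span_add cvec.span_scale)
  qed (simp add: cvec.span_zero)
  then show "t * s \<in> so4_kernel" by (simp add: mult.commute)
qed

definition kernel_eq :: "(oso5, oso5) tensor \<Rightarrow> (oso5, oso5) tensor \<Rightarrow> bool" (infix \<open>\<doteq>\<close> 50)
  where "s \<doteq> t \<longleftrightarrow> s - t \<in> so4_kernel"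

lemma kernel_eq_refl [simp]: "t \<doteq> t"
  by (simp add: kernel_eq_def kernel_subspace)

lemma kernel_eq_sym: "s \<doteq> t \<Longrightarrow> t \<doteq> s"
  unfolding kernel_eq_def using kernel_subspace(4) [of "s - t"] by simp

lemma kernel_eq_trans [trans]: "s \<doteq> t \<Longrightarrow> t \<doteq> r \<Longrightarrow> s \<doteq> r"
  unfolding kernel_eq_def using kernel_subspace(2) [of "s - t" "t - r"] by simp

lemma kernel_eq_add: "s \<doteq> t \<Longrightarrow> s' \<doteq> t' \<Longrightarrow> s + s' \<doteq> t + t'"
  unfolding kernel_eq_def add_diff_add by (rule kernel_subspace)

lemma kernel_eq_scaleC: "s \<doteq> t \<Longrightarrow> c *\<^sub>C s \<doteq> c *\<^sub>C t"
  unfolding kernel_eq_def cvec.scale_right_diff_distrib [symmetric] by (rule kernel_subspace)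

lemma kernel_eq_sum: "(\<And>x. x \<in> S \<Longrightarrow> f x \<doteq> g x) \<Longrightarrow> sum f S \<doteq> sum g S"
  by (induction S rule: infinite_finite_induct) (auto intro: kernel_eq_add)

lemma kernel_eq_mult: "s \<doteq> t \<Longrightarrow> s' \<doteq> t' \<Longrightarrow> s * s' \<doteq> t * t'"
proof -
  assume "s \<doteq> t" "s' \<doteq> t'"
  then have "(s - t) * s' + t * (s' - t') \<in> so4_kernel"
    unfolding kernel_eq_def by (intro kernel_subspace kernel_mult)
  then show ?thesis by (simp add: kernel_eq_def algebra_simps)
qed

lemma tensor_map_kernel:
  assumes "clinear u" "t \<in> so4_kernel" shows "tensor_map u id t \<in> so4_kernel"
proof -
  note M = clinearD [OF clinear_tensor_map [OF assms(1) clinear_id]]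
  show ?thesis
    using assms(2) unfolding so4_kernel_def
  proof (induction rule: cvec.span_induct_alt)
    case base
    show ?case by (simp only: M(3) cvec.span_zero)
  next
    case (step c x y)
    then obtain a j where x: "x = a \<otimes>\<^sub>C j" "j \<in> ideal_gen so4_gens" by blast
    have "tensor_map u id x \<in> so4_kernel"
      unfolding x(1) tensor_map_tensor [OF assms(1) clinear_id] id_apply [of j] by (rule kernel_tensor [OF x(2)])
    then show ?case using step(2) unfolding so4_kernel_def M(1,2) by (intro cvec.span_add cvec.span_scale)
  qed
qed

lemma tensor_map_kernel_eq: "clinear u \<Longrightarrow> s \<doteq> t \<Longrightarrow> tensor_map u id s \<doteq> tensor_map u id t"
  unfolding kernel_eq_def
  using tensor_map_kernel [of u "s - t"] by (simp only: clinearD(5) [OF clinear_tensor_map [OF _ clinear_id]])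

text \<open>A functional that kills the ideal of \<open>SO(4)\<close> factors through the quotient, so its slice is defined on cosets.\<close>

lemma slice_kernel:
  assumes "clinear \<phi>" "\<And>j. j \<in> ideal_gen so4_gens \<Longrightarrow> \<phi> j = 0" "s \<doteq> t"
  shows "slice \<phi> s = slice \<phi> t"
proof -
  note L = clinearD [OF clinear_slice [OF assms(1)]]
  have "slice \<phi> r = 0" if "r \<in> so4_kernel" for r
    using that unfolding so4_kernel_def
    by (induction rule: cvec.span_induct_alt) (auto simp: L slice_tensor assms)
  then show ?thesis using assms(3) by (force simp: kernel_eq_def L)
qed

section \<open>Coinvariants and equivariance\<close>

lemma self_in_id_proj: "t \<in> id_proj \<theta> t"
  unfolding id_proj_def proj_kernel_eq by (rule CollectI, rule exI [of _ 0]) (simp add: kernel_subspace)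

lemma id_proj_eq_iff: "id_proj \<theta> s = id_proj \<theta> t \<longleftrightarrow> s \<doteq> t"
proof
  assume "id_proj \<theta> s = id_proj \<theta> t"
  moreover have "s \<in> id_proj \<theta> s" by (rule self_in_id_proj)
  ultimately obtain k where "k \<in> so4_kernel" "s = t + k" unfolding id_proj_def proj_kernel_eq by auto
  then show "s \<doteq> t" by (simp add: kernel_eq_def)
next
  have *: "id_proj \<theta> s \<subseteq> id_proj \<theta> t" if "s \<doteq> t" for s t
  proof
    fix r assume "r \<in> id_proj \<theta> s"
    then obtain k where "k \<in> so4_kernel" "r = s + k" by (auto simp: id_proj_def proj_kernel_eq)
    then have "r = t + ((s - t) + k)" "(s - t) + k \<in> so4_kernel"
      using that by (auto simp: kernel_eq_def intro: kernel_subspace)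
    then show "r \<in> id_proj \<theta> t" unfolding id_proj_def proj_kernel_eq by blast
  qed
  assume "s \<doteq> t"
  then show "id_proj \<theta> s = id_proj \<theta> t" using * kernel_eq_sym by blast
qed

lemma sphere_alg_iff: "b \<in> sphere_alg \<theta> \<longleftrightarrow> coproduct b \<doteq> b \<otimes>\<^sub>C 1"
  by (simp add: sphere_alg_def coaction_def id_proj_eq_iff)

lemma map_id_id_proj:
  assumes "clinear u"
  shows "map_id \<theta> u (id_proj \<theta> t) = id_proj \<theta> (tensor_map u id t)"
proof -
  have "id_proj \<theta> (tensor_map u id s) = id_proj \<theta> (tensor_map u id t)" if "s \<in> id_proj \<theta> t" for s
  proof -
    from that have "s \<doteq> t" by (auto simp: id_proj_def proj_kernel_eq kernel_eq_def)
    then show ?thesis by (simp add: id_proj_eq_iff tensor_map_kernel_eq assms)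
  qed
  moreover have "t \<in> id_proj \<theta> t" by (rule self_in_id_proj)
  ultimately show ?thesis unfolding map_id_def by blast
qed

text \<open>The condition \<open>\<delta> \<circ> u = (u \<otimes> id) \<circ> \<delta>\<close>, stated for representatives. By \<open>equivariant_iff\<close> it does not depend on \<open>\<theta>\<close>.\<close>

definition equivariant :: "(oso5 \<Rightarrow> oso5) \<Rightarrow> bool"
  where "equivariant u \<longleftrightarrow> (\<forall>a. coproduct (u a) \<doteq> tensor_map u id (coproduct a))"

lemma equivariant_iff:
  "clinear u \<Longrightarrow> (\<forall>a. coaction \<theta> (u a) = map_id \<theta> u (coaction \<theta> a)) \<longleftrightarrow> equivariant u"
  by (simp add: coaction_def map_id_id_proj id_proj_eq_iff equivariant_def)

lemma tensor_zero [simp]: "(0::'a::complex_vec) \<otimes>\<^sub>C b = 0" "a \<otimes>\<^sub>C (0::'b::complex_vec) = 0"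
  using tensor_scaleC_left [of 0 0 b] tensor_scaleC_right [of a 0 0] by simp_all

section \<open>Left weights of the coproduct and the sphere algebra\<close>

text \<open>Tensors whose first leg has left weight \<open>l\<close>. The coproduct maps left weight \<open>l\<close> into this space because
\<open>\<Delta>(n\<^sub>J\<^sub>K)\<close> involves only row \<open>J\<close> in its first leg.\<close>

definition left_homogeneous :: "weight \<Rightarrow> (oso5, oso5) tensor set"
  where "left_homogeneous l = cspan {x \<otimes>\<^sub>C y | x y. \<exists>p. x \<in> graded l p}"

lemma left_homogeneous_base: "x \<in> graded l p \<Longrightarrow> x \<otimes>\<^sub>C y \<in> left_homogeneous l"
  unfolding left_homogeneous_def by (rule cvec.span_base) blast

lemma left_homogeneous_subspace:
  "0 \<in> left_homogeneous l" "s \<in> left_homogeneous l \<Longrightarrow> t \<in> left_homogeneous l \<Longrightarrow> s + t \<in> left_homogeneous l"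
  "s \<in> left_homogeneous l \<Longrightarrow> c *\<^sub>C s \<in> left_homogeneous l"
  unfolding left_homogeneous_def by (simp_all only: cvec.span_zero cvec.span_add cvec.span_scale)

lemma left_homogeneous_mult:
  assumes "s \<in> left_homogeneous l" "t \<in> left_homogeneous l'"
  shows "s * t \<in> left_homogeneous (l + l')"
proof -
  have 1: "(x \<otimes>\<^sub>C y) * t \<in> left_homogeneous (l + l')" if x: "x \<in> graded l p" for x y p
    using assms(2) unfolding left_homogeneous_def [of l']
  proof (induction rule: cvec.span_induct_alt)
    case (step c z r)
    then obtain a b q where z: "z = a \<otimes>\<^sub>C b" "a \<in> graded l' q" by blast
    have "(x \<otimes>\<^sub>C y) * z \<in> left_homogeneous (l + l')"
      unfolding z(1) tensor_mult by (rule left_homogeneous_base [OF graded_mult [OF x z(2)]])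
    then show ?case using step(2) by (simp add: distrib_left left_homogeneous_subspace)
  qed (simp add: left_homogeneous_subspace)
  show ?thesis
    using assms(1) unfolding left_homogeneous_def [of l]
  proof (induction rule: cvec.span_induct_alt)
    case (step c z r)
    then obtain a b q where z: "z = a \<otimes>\<^sub>C b" "a \<in> graded l q" by blast
    show ?case using step(2) 1 [OF z(2), of b] z(1) by (simp add: distrib_right left_homogeneous_subspace)
  qed (simp add: left_homogeneous_subspace)
qed

lemma left_homogeneous_lpart:
  assumes "t \<in> left_homogeneous l"
  shows "tensor_map (lpart m) id t = (if m = l then t else 0)"
  using assms unfolding left_homogeneous_def
proof (induction rule: cvec.span_induct_alt)
  case base
  show ?case by (simp only: clinearD(3) [OF clinear_tensor_map [OF clinear_lpart clinear_id]] if_cancel)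
next
  case (step c z r)
  then obtain a b q where z: "z = a \<otimes>\<^sub>C b" "a \<in> graded l q" by blast
  have "tensor_map (lpart m) id z = (if m = l then z else 0)"
    unfolding z(1) tensor_map_tensor [OF clinear_lpart clinear_id] lpart_graded [OF z(2)] id_apply [of b]
    by simp
  then show ?case using step(2) by (simp only: clinearD(1,2) [OF clinear_tensor_map [OF clinear_lpart clinear_id]]) auto
qed

lemma left_homogeneous_one: "1 \<in> left_homogeneous 0"
  unfolding one_tensor_def by (rule left_homogeneous_base [OF graded_one])

lemma left_homogeneous_power:
  "t \<in> left_homogeneous l \<Longrightarrow> t ^ n \<in> left_homogeneous (int n * fst l, int n * snd l)"
proof (induction n)
  case 0
  then show ?case using left_homogeneous_one by (simp add: zero_prod_def)
next
  case (Suc n)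
  have "l + (int n * fst l, int n * snd l) = (int (Suc n) * fst l, int (Suc n) * snd l)"
    by (simp add: prod_eq_iff algebra_simps)
  then show ?case using left_homogeneous_mult [OF Suc.prems Suc.IH [OF Suc.prems]] by simp
qed

lemma left_homogeneous_prod:
  "finite S \<Longrightarrow> (\<And>x. x \<in> S \<Longrightarrow> f x \<in> left_homogeneous (w x)) \<Longrightarrow> prod f S \<in> left_homogeneous (sum w S)"
  by (induction S rule: finite_induct) (simp_all add: left_homogeneous_one left_homogeneous_mult)

lemma coproduct_graded:
  assumes "a \<in> graded l p" shows "coproduct a \<in> left_homogeneous l"
proof -
  obtain f where f: "bihom l p f" "a = abs_oso5 f" using assms by (rule graded_ex_poly)
  have gen: "coproduct (gen_n J K) \<in> left_homogeneous (eps J)" for J K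
  proof -
    have "sum g S \<in> left_homogeneous (eps J)" if "\<And>L. g L \<in> left_homogeneous (eps J)" for g and S :: "5 set"
      using that by (induction S rule: infinite_finite_induct) (simp_all add: left_homogeneous_subspace)
    then show ?thesis unfolding coproduct_gen_n by (simp add: left_homogeneous_base [OF graded_gen_n])
  qed
  have mon: "eval_poly (\<chi> J K. \<Sum>L\<in>UNIV. gen_n J L \<otimes>\<^sub>C gen_n L K) (Poly_Mapping.single m c) \<in> left_homogeneous (left_weight m)" for m c
  proof -
    have "(\<Prod>x\<in>UNIV. coproduct (gen_n (fst x) (snd x)) ^ poly_mapping.lookup m x) \<in> left_homogeneous (left_weight m)"
      unfolding monom_weight_def
      by (rule left_homogeneous_prod) (auto intro: left_homogeneous_power [OF gen])
    then show ?thesis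
      by (simp add: eval_poly_single coproduct_gen_n case_prod_unfold left_homogeneous_subspace)
  qed
  have "f = (\<Sum>k\<in>Poly_Mapping.keys f. Poly_Mapping.single k (poly_mapping.lookup f k))"
    by (rule poly_mapping_eqI) (auto simp: lookup_sum lookup_single when_def in_keys_iff)
  then have "coproduct a = eval_poly (\<chi> J K. \<Sum>L\<in>UNIV. gen_n J L \<otimes>\<^sub>C gen_n L K)
      (\<Sum>k\<in>Poly_Mapping.keys f. Poly_Mapping.single k (poly_mapping.lookup f k))"
    by (simp add: f(2) coproduct.abs_eq)
  also have "\<dots> = (\<Sum>k\<in>Poly_Mapping.keys f. eval_poly (\<chi> J K. \<Sum>L\<in>UNIV. gen_n J L \<otimes>\<^sub>C gen_n L K)
      (Poly_Mapping.single k (poly_mapping.lookup f k)))"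
    by (rule clinearD(6) [OF clinear_eval_poly])
  also have "\<dots> \<in> left_homogeneous l"
  proof -
    have "sum g S \<in> left_homogeneous l" if "\<And>k. k \<in> S \<Longrightarrow> g k \<in> left_homogeneous l" for g and S :: "(5 \<times> 5 \<Rightarrow>\<^sub>0 nat) set"
      using that by (induction S rule: infinite_finite_induct) (simp_all add: left_homogeneous_subspace)
    moreover have "eval_poly (\<chi> J K. \<Sum>L\<in>UNIV. gen_n J L \<otimes>\<^sub>C gen_n L K)
      (Poly_Mapping.single k (poly_mapping.lookup f k)) \<in> left_homogeneous l" if "k \<in> Poly_Mapping.keys f" for k
      using mon [of k "poly_mapping.lookup f k"] f(1) that by (simp add: bihom_def)
    ultimately show ?thesis .
  qed
  finally show ?thesis .
qed

text \<open>The left torus action commutes with the right coaction of \<open>SO(5)\<close> on itself.\<close>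

lemma coproduct_lpart: "coproduct (lpart m a) = tensor_map (lpart m) id (coproduct a)"
proof -
  note M = clinearD(1,3) [OF clinear_tensor_map [OF clinear_lpart clinear_id]]
  show ?thesis
  proof (induction a rule: graded_induct)
    case (graded l p a)
    show ?case
      unfolding left_homogeneous_lpart [OF coproduct_graded [OF graded]] lpart_graded [OF graded] by simp
  qed (simp_all only: M clinearD(1,3) [OF clinear_lpart] coproduct.add coproduct.zero)
qed

lemma sphere_closed:
  shows "0 \<in> sphere_alg \<theta>"
    and "a \<in> sphere_alg \<theta> \<Longrightarrow> b \<in> sphere_alg \<theta> \<Longrightarrow> a + b \<in> sphere_alg \<theta>"
    and "a \<in> sphere_alg \<theta> \<Longrightarrow> b \<in> sphere_alg \<theta> \<Longrightarrow> a * b \<in> sphere_alg \<theta>"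
    and "a \<in> sphere_alg \<theta> \<Longrightarrow> c *\<^sub>C a \<in> sphere_alg \<theta>"
    and "a \<in> sphere_alg \<theta> \<Longrightarrow> lpart m a \<in> sphere_alg \<theta>"
proof -
  show "0 \<in> sphere_alg \<theta>" by (simp add: sphere_alg_iff)
  show "a + b \<in> sphere_alg \<theta>" if "a \<in> sphere_alg \<theta>" "b \<in> sphere_alg \<theta>"
    using that kernel_eq_add unfolding sphere_alg_iff coproduct.add tensor_add_left by blast
  show "c *\<^sub>C a \<in> sphere_alg \<theta>" if "a \<in> sphere_alg \<theta>"
    using that kernel_eq_scaleC unfolding sphere_alg_iff clinearD(2) [OF clinear_coproduct] tensor_scaleC_left by blast
  show "a * b \<in> sphere_alg \<theta>" if "a \<in> sphere_alg \<theta>" "b \<in> sphere_alg \<theta>"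
    using kernel_eq_mult [OF that [unfolded sphere_alg_iff]] by (simp add: sphere_alg_iff coproduct.mult)
  show "lpart m a \<in> sphere_alg \<theta>" if "a \<in> sphere_alg \<theta>"
  proof -
    have "coproduct (lpart m a) \<doteq> tensor_map (lpart m) id (a \<otimes>\<^sub>C 1)"
      unfolding coproduct_lpart using that by (intro tensor_map_kernel_eq clinear_lpart) (simp add: sphere_alg_iff)
    then show ?thesis
      unfolding sphere_alg_iff tensor_map_tensor [OF clinear_lpart clinear_id] id_apply [of 1] .
  qed
qed

lemma sphere_one: "1 \<in> sphere_alg \<theta>"
  by (simp add: sphere_alg_iff one_tensor_def)

lemma last_row_kernel:
  "L \<noteq> 5 \<Longrightarrow> a \<otimes>\<^sub>C gen_n L 5 \<doteq> 0" "a \<otimes>\<^sub>C gen_n 5 5 \<doteq> a \<otimes>\<^sub>C 1"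
proof -
  show "L \<noteq> 5 \<Longrightarrow> a \<otimes>\<^sub>C gen_n L 5 \<doteq> 0"
    unfolding kernel_eq_def by (simp, intro kernel_tensor ideals.span_base) (auto simp: so4_gens_def)
  have "a \<otimes>\<^sub>C (gen_n 5 5 - 1) \<in> so4_kernel"
    by (intro kernel_tensor ideals.span_base) (simp add: so4_gens_def)
  moreover have "a \<otimes>\<^sub>C gen_n 5 5 = a \<otimes>\<^sub>C (gen_n 5 5 - 1) + a \<otimes>\<^sub>C 1"
    unfolding tensor_add_right [symmetric] by simp
  ultimately show "a \<otimes>\<^sub>C gen_n 5 5 \<doteq> a \<otimes>\<^sub>C 1"
    unfolding kernel_eq_def by simp
qed

text \<open>The last column of \<open>N\<close> consists of the coordinates of the sphere: modulo the ideal of \<open>SO(4)\<close>, the last column of the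
second leg is that of the identity matrix.\<close>

lemma sphere_gen: "gen_n J 5 \<in> sphere_alg \<theta>"
proof -
  have "(\<Sum>L\<in>UNIV. gen_n J L \<otimes>\<^sub>C gen_n L 5) \<doteq> (\<Sum>L\<in>UNIV. if L = (5::5) then gen_n J 5 \<otimes>\<^sub>C 1 else 0)"
    by (rule kernel_eq_sum) (auto intro: last_row_kernel)
  then show ?thesis by (simp add: sphere_alg_iff coproduct_gen_n)
qed

section \<open>Left and right invariant derivations\<close>

text \<open>With both indices moved to the same side of the quadratic form, the ten derivations become antisymmetric in \<open>I, J\<close>
(\<open>right_inv_field_antisym\<close>), as elements of \<open>so(5)\<close> viewed as bivectors.\<close>

definition right_inv_field :: "5 \<Rightarrow> 5 \<Rightarrow> oso5 \<Rightarrow> oso5"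
  where "right_inv_field I J = L_op I (prime_idx J)"

lemma ring_derivation_right_inv_field: "ring_derivation (right_inv_field I J)"
  unfolding right_inv_field_def by (rule ring_derivation_L_op)

lemma clinear_right_inv_field: "clinear (right_inv_field I J)"
  unfolding right_inv_field_def by (rule clinear_L_op)

lemma right_inv_field_gen_n: "right_inv_field I J (gen_n L M) =
    (if L = prime_idx J then gen_n I M else 0) - (if L = prime_idx I then gen_n J M else 0)"
  by (simp add: right_inv_field_def L_op_gen_n)

lemma right_inv_field_antisym: "right_inv_field J I a = - right_inv_field I J a"
proof -
  obtain f where a: "a = abs_oso5 f" by (rule oso5_cases)
  show ?thesis by (simp add: a right_inv_field_def L_op.abs_eq uminus_oso5.abs_eq [symmetric] L_poly_def uminus_oso5.abs_eq)
qed

definition tangent_at_one :: "5 \<Rightarrow> 5 \<Rightarrow> oso5 \<Rightarrow> complex"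
  where "tangent_at_one I J a = counit (right_inv_field I J a)"

lemma clinear_tangent_at_one: "clinear (tangent_at_one I J)"
  by (rule clinearI) (simp_all add: tangent_at_one_def clinearD [OF clinear_right_inv_field] clinearD [OF clinear_counit])

lemma tangent_at_one_mult:
  "tangent_at_one I J (x * y) = tangent_at_one I J x * counit y + counit x * tangent_at_one I J y"
  by (simp add: tangent_at_one_def ring_derivation.mult [OF ring_derivation_right_inv_field] counit.add counit.mult)

lemma tangent_at_one_gen_n: "tangent_at_one I J (gen_n L M) =
    (if L = prime_idx J \<and> I = M then 1 else 0) - (if L = prime_idx I \<and> J = M then 1 else 0)"
  by (simp add: tangent_at_one_def right_inv_field_gen_n counit.diff counit_gen_n)

lemma prime_eq_5 [simp]: "prime_idx J = 5 \<longleftrightarrow> J = 5"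
  using exhaust_5 [of J] by auto

text \<open>The tangent vectors whose indices avoid 5 are tangent to \<open>SO(4)\<close>.\<close>

lemma tangent_at_one_so4:
  assumes "I \<noteq> 5" "J \<noteq> 5" "j \<in> ideal_gen so4_gens"
  shows "tangent_at_one I J j = 0"
  using assms(3)
proof (induction rule: ideals.span_induct_alt)
  case base
  show ?case by (rule clinearD [OF clinear_tangent_at_one])
next
  case (step c g p)
  have "counit g = 0" "tangent_at_one I J g = 0"
    using step(1) assms(1,2) prime_eq_5 [of I] prime_eq_5 [of J]
    by (auto simp: so4_gens_def counit.diff counit_gen_n clinearD [OF clinear_tangent_at_one] tangent_at_one_gen_n
      tangent_at_one_def [of _ _ 1] ring_derivation.one [OF ring_derivation_right_inv_field])
  with step show ?case by (simp add: clinearD [OF clinear_tangent_at_one] tangent_at_one_mult)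
qed

text \<open>The derivation that agrees with \<open>right_inv_field I J\<close> at the identity but is invariant under left translations.
For \<open>I, J \<noteq> 5\<close> it is the infinitesimal action of \<open>so(4)\<close> along the fibres.\<close>

definition left_inv_field :: "5 \<Rightarrow> 5 \<Rightarrow> oso5 \<Rightarrow> oso5"
  where "left_inv_field I J a = slice (tangent_at_one I J) (coproduct a)"

lemma clinear_left_inv_field: "clinear (left_inv_field I J)"
  by (rule clinearI) (simp_all add: left_inv_field_def clinearD [OF clinear_coproduct] clinearD [OF clinear_slice [OF clinear_tangent_at_one]])

lemma ring_derivation_left_inv_field: "ring_derivation (left_inv_field I J)"
proof
  fix x y
  show "left_inv_field I J (x + y) = left_inv_field I J x + left_inv_field I J y" by (rule clinearD [OF clinear_left_inv_field])
  show "left_inv_field I J (x * y) = left_inv_field I J x * y + x * left_inv_field I J y"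
    unfolding left_inv_field_def coproduct.mult slice_derivation [OF clinear_tangent_at_one tangent_at_one_mult] slice_counit_coproduct ..
qed

lemma left_inv_field_gen_n: "left_inv_field I J (gen_n L M) =
    (if M = I then gen_n L (prime_idx J) else 0) - (if M = J then gen_n L (prime_idx I) else 0)"
proof -
  have "left_inv_field I J (gen_n L M) = (\<Sum>P\<in>UNIV. tangent_at_one I J (gen_n P M) *\<^sub>C gen_n L P)"
    by (simp add: left_inv_field_def coproduct_gen_n clinearD [OF clinear_slice [OF clinear_tangent_at_one]] slice_tensor clinear_tangent_at_one)
  also have "\<dots> = (\<Sum>P\<in>UNIV. if P = prime_idx J then (if M = I then gen_n L P else 0) else 0)
      - (\<Sum>P\<in>UNIV. if P = prime_idx I then (if M = J then gen_n L P else 0) else 0)"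
    unfolding sum_subtractf [symmetric]
    by (rule sum.cong) (auto simp: tangent_at_one_gen_n cvec.scale_left_diff_distrib)
  finally show ?thesis by simp
qed

text \<open>Coinvariants are constant along the fibres.\<close>

lemma left_inv_field_sphere:
  assumes "I \<noteq> 5" "J \<noteq> 5" "b \<in> sphere_alg \<theta>"
  shows "left_inv_field I J b = 0"
proof -
  have "left_inv_field I J b = slice (tangent_at_one I J) (b \<otimes>\<^sub>C 1)"
    unfolding left_inv_field_def using assms
    by (intro slice_kernel clinear_tangent_at_one tangent_at_one_so4) (simp_all add: sphere_alg_iff)
  then show ?thesis
    by (simp add: slice_tensor clinear_tangent_at_one tangent_at_one_def ring_derivation.one [OF ring_derivation_right_inv_field])
qed

lemma left_inv_field_equivariant:
  assumes "I \<noteq> 5" "J \<noteq> 5" "clinear u" "equivariant u"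
  shows "left_inv_field I J (u a) = u (left_inv_field I J a)"
proof -
  have "left_inv_field I J (u a) = slice (tangent_at_one I J) (tensor_map u id (coproduct a))"
    unfolding left_inv_field_def using assms
    by (intro slice_kernel clinear_tangent_at_one tangent_at_one_so4) (simp_all only: equivariant_def not_False_eq_True)
  then show ?thesis unfolding slice_tensor_map [OF assms(3) clinear_tangent_at_one] left_inv_field_def .
qed

lemma tensor_map_derivation:
  assumes "ring_derivation X" "clinear X"
  shows "tensor_map X id (s * t) = tensor_map X id s * t + s * tensor_map X id t"
proof -
  note M = clinearD [OF clinear_tensor_map [OF assms(2) clinear_id]]
  interpret ring_derivation X by fact
  have 1: "tensor_map X id ((a \<otimes>\<^sub>C b) * t) = tensor_map X id (a \<otimes>\<^sub>C b) * t + (a \<otimes>\<^sub>C b) * tensor_map X id t" for a b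
  proof (induction t rule: tensor_induct)
    case zero
    show ?case by (simp only: mult_zero_right M(3) add_0)
  next
    case (tensor c d)
    show ?case unfolding tensor_mult tensor_map_tensor [OF assms(2) clinear_id] id_apply [of b] id_apply [of d] id_apply [of "b * d"]
      by (simp add: mult tensor_add_left)
  next
    case (add s t)
    show ?case unfolding distrib_left M(1) add.IH by (simp only: ac_simps)
  qed
  show ?thesis
  proof (induction s rule: tensor_induct)
    case zero
    show ?case by (simp only: mult_zero_left M(3) add_0)
  next
    case (tensor a b)
    show ?case by (rule 1)
  next
    case (add s s')
    show ?case unfolding distrib_right M(1) add.IH by (simp only: ac_simps)
  qed
qed

text \<open>The right-invariant derivations act on the first leg only; both sides are derivations along the coproduct and agree on the
matrix entries.\<close>

lemma coproduct_right_inv_field: "coproduct (right_inv_field I J a) = tensor_map (right_inv_field I J) id (coproduct a)"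
proof -
  note M = clinearD [OF clinear_tensor_map [OF clinear_right_inv_field clinear_id]]
  interpret ring_derivation "right_inv_field I J" by (rule ring_derivation_right_inv_field)
  show ?thesis
  proof (induction a rule: oso5_induct)
    case (scalar c)
    have "tensor_map (right_inv_field I J) id (1 \<otimes>\<^sub>C (1::oso5)) = 0"
      unfolding tensor_map_tensor [OF clinear_right_inv_field clinear_id] by simp
    then show ?case
      by (simp only: clinearD(2) [OF clinear_right_inv_field] one clinearD(2) [OF clinear_coproduct] M(2) coproduct.one
        coproduct.zero one_tensor_def)
  next
    case (gen L M)
    have "tensor_map (right_inv_field I J) id (coproduct (gen_n L M)) = (\<Sum>P\<in>UNIV. right_inv_field I J (gen_n L P) \<otimes>\<^sub>C gen_n P M)"
      unfolding coproduct_gen_n M(6) tensor_map_tensor [OF clinear_right_inv_field clinear_id] by simp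
    also have "\<dots> = (\<Sum>P\<in>UNIV. (if L = prime_idx J then gen_n I P \<otimes>\<^sub>C gen_n P M else 0)
        - (if L = prime_idx I then gen_n J P \<otimes>\<^sub>C gen_n P M else 0))"
    proof (rule sum.cong)
      fix P :: 5
      have d: "(a - b) \<otimes>\<^sub>C c = a \<otimes>\<^sub>C c - b \<otimes>\<^sub>C c" for a b c :: oso5
        using tensor_add_left [of "a - b" b c] by (simp add: algebra_simps)
      show "right_inv_field I J (gen_n L P) \<otimes>\<^sub>C gen_n P M = (if L = prime_idx J then gen_n I P \<otimes>\<^sub>C gen_n P M else 0)
        - (if L = prime_idx I then gen_n J P \<otimes>\<^sub>C gen_n P M else 0)"
        by (simp add: right_inv_field_gen_n d)
    qed simp
    also have "\<dots> = coproduct (right_inv_field I J (gen_n L M))"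
      by (simp add: right_inv_field_gen_n coproduct.diff coproduct_gen_n sum_subtractf)
    finally show ?case ..
  next
    case (mult a b)
    then show ?case
      by (simp only: ring_derivation.mult [OF ring_derivation_right_inv_field] coproduct.add coproduct.mult
        tensor_map_derivation [OF ring_derivation_right_inv_field clinear_right_inv_field])
  qed (simp only: add coproduct.add M(1))
qed

section \<open>Right weights\<close>

text \<open>For additive \<open>w\<close> this is the derivation by which an element of the torus Lie algebra acts from the right. It serves to compute
\<open>left_inv_field 1 3\<close> and \<open>left_inv_field 2 4\<close> on weight vectors, by comparison on the matrix entries.\<close>

definition right_degree :: "(weight \<Rightarrow> int) \<Rightarrow> oso5 \<Rightarrow> oso5"
  where "right_degree w a = Sum_any (\<lambda>k. of_int (w (snd k)) *\<^sub>C bipart (fst k) (snd k) a)"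

lemma finite_right_degree: "finite {k. of_int (w (snd k)) *\<^sub>C bipart (fst k) (snd k) a \<noteq> 0}"
  by (rule finite_subset [OF _ finite_bipart [of a]]) auto

lemma clinear_right_degree: "clinear (right_degree w)"
  unfolding right_degree_def [abs_def]
  by (rule clinear_Sum_any [OF _ finite_right_degree])
    (auto intro!: clinearI simp: clinearD [OF clinear_bipart] scaleC_add_right mult.commute)

lemma right_degree_graded:
  assumes "a \<in> graded l p" shows "right_degree w a = of_int (w p) *\<^sub>C a"
proof -
  have "right_degree w a = of_int (w (snd (l, p))) *\<^sub>C bipart (fst (l, p)) (snd (l, p)) a"
    unfolding right_degree_def
    by (rule Sum_any_single) (auto simp: bipart_graded [OF assms] prod_eq_iff)
  then show ?thesis by (simp add: bipart_graded [OF assms])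
qed

lemma ring_derivation_right_degree:
  assumes w: "\<And>p q. w (p + q) = w p + w q"
  shows "ring_derivation (right_degree w)"
proof
  note D = clinearD [OF clinear_right_degree, of w]
  fix x y :: oso5
  show "right_degree w (x + y) = right_degree w x + right_degree w y" by (rule D)
  have 1: "right_degree w (x * y) = right_degree w x * y + x * right_degree w y" if x: "x \<in> graded l p" for x l p
  proof (induction y rule: graded_induct)
    case (graded l' p' y)
    then show ?case
      by (simp add: right_degree_graded [OF graded_mult [OF x graded]] right_degree_graded [OF x] right_degree_graded [OF graded]
        w scaleC_add_left)
  qed (simp_all add: D distrib_left)
  show "right_degree w (x * y) = right_degree w x * y + x * right_degree w y"
    by (induction x rule: graded_induct) (simp_all add: D distrib_right 1)
qed

lemma left_inv_field_weight:
  assumes "a \<in> graded l p"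
  shows "left_inv_field 1 3 a = of_int (fst p) *\<^sub>C a" "left_inv_field 2 4 a = of_int (snd p) *\<^sub>C a"
proof -
  have "left_inv_field 1 3 a = right_degree fst a"
  proof (rule derivation_eqI [OF ring_derivation_left_inv_field clinear_left_inv_field ring_derivation_right_degree clinear_right_degree])
    fix J K :: 5
    show "left_inv_field 1 3 (gen_n J K) = right_degree fst (gen_n J K)"
      using exhaust_5 [of K] by (elim disjE) (simp_all add: right_degree_graded [OF graded_gen_n] left_inv_field_gen_n eps_def)
  qed simp
  then show "left_inv_field 1 3 a = of_int (fst p) *\<^sub>C a" by (simp add: right_degree_graded [OF assms])
  have "left_inv_field 2 4 a = right_degree snd a"
  proof (rule derivation_eqI [OF ring_derivation_left_inv_field clinear_left_inv_field ring_derivation_right_degree clinear_right_degree])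
    fix J K :: 5
    show "left_inv_field 2 4 (gen_n J K) = right_degree snd (gen_n J K)"
      using exhaust_5 [of K] by (elim disjE) (simp_all add: right_degree_graded [OF graded_gen_n] left_inv_field_gen_n eps_def)
  qed simp
  then show "left_inv_field 2 4 a = of_int (snd p) *\<^sub>C a" by (simp add: right_degree_graded [OF assms])
qed

lemma left_inv_field_bipart:
  "left_inv_field 1 3 (bipart m q a) = bipart m q (left_inv_field 1 3 a)" "left_inv_field 2 4 (bipart m q a) = bipart m q (left_inv_field 2 4 a)"
  by (induction a rule: graded_induct)
    (simp_all add: clinearD [OF clinear_left_inv_field] clinearD [OF clinear_bipart] left_inv_field_weight bipart_graded)

text \<open>The torus acting from the right is contained in \<open>SO(4)\<close>; its two generators have the right weights as their joint
eigenvalues, which are thus determined by infinitesimal data.\<close>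

lemma right_weight_from_left_inv_field:
  assumes "left_inv_field 1 3 a = of_int (fst p) *\<^sub>C a" "left_inv_field 2 4 a = of_int (snd p) *\<^sub>C a"
  shows "lpart m a \<in> graded m p"
proof -
  have z: "bipart l q a = 0" if "q \<noteq> p" for l q
  proof -
    have "of_int (fst q) *\<^sub>C bipart l q a = (of_int (fst p) *\<^sub>C bipart l q a :: oso5)"
      "of_int (snd q) *\<^sub>C bipart l q a = (of_int (snd p) *\<^sub>C bipart l q a :: oso5)"
      using left_inv_field_bipart [of l q a] left_inv_field_weight [OF bipart_in_graded [of l q a]] by (simp_all add: assms clinearD [OF clinear_bipart])
    then show ?thesis using that unfolding cvec.scale_cancel_right by (auto simp: prod_eq_iff)
  qed
  have "a \<in> {x. lpart m x \<in> graded m p}"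
  proof (rule bipart_closed)
    fix l q
    show "bipart l q a \<in> {x. lpart m x \<in> graded m p}"
      using z [of q l] bipart_in_graded [of l q a] by (cases "q = p") (auto simp: lpart_graded [OF bipart_in_graded] clinearD [OF clinear_lpart])
  qed (auto simp: clinearD [OF clinear_lpart] graded_add)
  then show ?thesis by simp
qed

lemma sphere_right_weight:
  assumes "b \<in> sphere_alg \<theta>" shows "lpart m b \<in> graded m 0"
  by (rule right_weight_from_left_inv_field) (simp_all add: left_inv_field_sphere [OF _ _ assms])

text \<open>An equivariant map commutes with the infinitesimal right action of the torus, hence preserves its eigenspaces.\<close>

lemma equivariant_right_weight:
  assumes u: "clinear u" "equivariant u" and a: "a \<in> graded l p"
  shows "lpart m (u a) \<in> graded m p"
  by (rule right_weight_from_left_inv_field)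
    (simp_all add: left_inv_field_equivariant [OF _ _ u] left_inv_field_weight [OF a] clinearD [OF u(1)])

section \<open>Expansion of derivations in invariant frames\<close>

lemma row_orthogonality: "(\<Sum>K\<in>UNIV. gen_n J K * gen_n L (prime_idx K)) = (if L = prime_idx J then 1 else 0)"
proof -
  have "(gen_mat ** Qmat ** transpose gen_mat) $ J $ L = Qmat $ J $ L"
    using so5_mat_gen by (simp add: so5_mat_def)
  moreover have "(gen_mat ** Qmat ** transpose gen_mat) $ J $ L = (\<Sum>K\<in>UNIV. gen_n J (prime_idx K) * gen_n L K)"
    unfolding matrix_matrix_mult_def [of "gen_mat ** Qmat"]
    by (simp add: mult_Qmat_right) (simp add: gen_mat_def transpose_def)
  moreover have "(\<Sum>K\<in>UNIV. gen_n J (prime_idx K) * gen_n L K) = (\<Sum>K\<in>UNIV. gen_n J K * gen_n L (prime_idx K))"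
    by (rule sum.reindex_bij_witness [of _ prime_idx prime_idx]) auto
  ultimately show ?thesis by (simp add: Qmat_nth)
qed

lemma column_orthogonality: "(\<Sum>K\<in>UNIV. gen_n (prime_idx K) J * gen_n K L) = (if L = prime_idx J then 1 else 0)"
proof -
  have "(transpose gen_mat ** Qmat ** gen_mat) $ J $ L = Qmat $ J $ L"
    using so5_mat_gen by (simp add: so5_mat_def)
  moreover have "(transpose gen_mat ** Qmat ** gen_mat) $ J $ L = (\<Sum>K\<in>UNIV. gen_n (prime_idx K) J * gen_n K L)"
    unfolding matrix_matrix_mult_def [of "transpose gen_mat ** Qmat"]
    by (simp add: mult_Qmat_right) (simp add: gen_mat_def transpose_def)
  ultimately show ?thesis by (simp add: Qmat_nth)
qed

lemma sum_prime: "(\<Sum>K\<in>UNIV. f (prime_idx K)) = (\<Sum>K\<in>UNIV. f K)"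
  by (rule sum.reindex_bij_witness [of _ prime_idx prime_idx]) auto

lemma prime_eq_iff [simp]: "prime_idx I = prime_idx J \<longleftrightarrow> I = J"
  by (metis prime_prime)

lemma ring_derivation_times: "ring_derivation X \<Longrightarrow> ring_derivation (\<lambda>a. b * X a)"
  unfolding ring_derivation_def by (simp add: algebra_simps)

lemma ring_derivation_scaleC: "ring_derivation X \<Longrightarrow> ring_derivation (\<lambda>a. c *\<^sub>C X a)"
  for X :: "oso5 \<Rightarrow> oso5"
  unfolding ring_derivation_def by (simp add: scaleC_add_right)

lemma ring_derivation_sum: "(\<And>k. k \<in> S \<Longrightarrow> ring_derivation (X k)) \<Longrightarrow> ring_derivation (\<lambda>a. \<Sum>k\<in>S. X k a)"
  unfolding ring_derivation_def by (auto simp: sum.distrib sum_distrib_left sum_distrib_right intro!: sum.cong)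

lemma clinear_times_comp: "clinear X \<Longrightarrow> clinear (\<lambda>a. b * X a)" for b :: oso5
  by (rule clinearI) (simp_all add: clinearD distrib_left)

lemma clinear_scaleC_comp: "clinear X \<Longrightarrow> clinear (\<lambda>a. c *\<^sub>C X a)"
  by (rule clinearI) (simp_all add: clinearD scaleC_add_right mult.commute)

lemma clinear_sum_comp: "(\<And>k. k \<in> S \<Longrightarrow> clinear (X k)) \<Longrightarrow> clinear (\<lambda>a. \<Sum>k\<in>S. X k a)"
  by (rule clinearI) (simp_all add: clinearD sum.distrib cvec.scale_sum_right)

lemma clinear_add_comp: "clinear X \<Longrightarrow> clinear Y \<Longrightarrow> clinear (\<lambda>a. X a + Y a)"
  by (rule clinearI) (simp_all add: clinearD scaleC_add_right)

lemma half_double: "(1 / 2) *\<^sub>C (x + x) = x" for x :: "'a::complex_vec"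
  unfolding scaleC_add_right scaleC_add_left [symmetric] by simp

text \<open>The entries of the matrix \<open>X(N) N\<^sup>-\<^sup>1\<close>, with an index moved by the quadratic form.\<close>

definition left_coeff :: "(oso5 \<Rightarrow> oso5) \<Rightarrow> 5 \<Rightarrow> 5 \<Rightarrow> oso5"
  where "left_coeff X I J = (\<Sum>K\<in>UNIV. X (gen_n (prime_idx J) K) * gen_n (prime_idx I) (prime_idx K))"

text \<open>The entries of the matrix \<open>N\<^sup>-\<^sup>1 X(N)\<close>, with an index moved by the quadratic form.\<close>

definition right_coeff :: "(oso5 \<Rightarrow> oso5) \<Rightarrow> 5 \<Rightarrow> 5 \<Rightarrow> oso5"
  where "right_coeff X I J = (\<Sum>K\<in>UNIV. gen_n (prime_idx K) J * X (gen_n K I))"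

context
  fixes X :: "oso5 \<Rightarrow> oso5"
  assumes X: "ring_derivation X" "clinear X"
begin

interpretation X: ring_derivation X by (rule X(1))

text \<open>Differentiating \<open>N Q N\<^sup>t = Q\<close> shows that \<open>X(N) N\<^sup>-\<^sup>1\<close> takes values in \<open>so(5)\<close>.\<close>

lemma left_coeff_antisym: "left_coeff X J I = - left_coeff X I J"
proof -
  have "left_coeff X J I = (\<Sum>K\<in>UNIV. X (gen_n (prime_idx I) (prime_idx K)) * gen_n (prime_idx J) K)"
    unfolding left_coeff_def by (subst sum_prime [symmetric]) simp
  then have "left_coeff X I J + left_coeff X J I = X (\<Sum>K\<in>UNIV. gen_n (prime_idx J) K * gen_n (prime_idx I) (prime_idx K))"
    by (simp add: left_coeff_def X.sum X.mult sum.distrib mult.commute)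
  also have "\<dots> = 0" unfolding row_orthogonality by simp
  finally show ?thesis by (simp add: eq_neg_iff_add_eq_0 add.commute)
qed

lemma right_coeff_antisym: "right_coeff X J I = - right_coeff X I J"
proof -
  have "right_coeff X J I = (\<Sum>K\<in>UNIV. gen_n K I * X (gen_n (prime_idx K) J))"
    unfolding right_coeff_def by (subst sum_prime [symmetric]) simp
  then have "right_coeff X I J + right_coeff X J I = X (\<Sum>K\<in>UNIV. gen_n (prime_idx K) J * gen_n K I)"
    by (simp add: right_coeff_def X.sum X.mult sum.distrib mult.commute add.commute)
  also have "\<dots> = 0" unfolding column_orthogonality by simp
  finally show ?thesis by (simp add: eq_neg_iff_add_eq_0 add.commute)
qed

lemma left_coeff_contract: "(\<Sum>I\<in>UNIV. left_coeff X I J * gen_n I M) = X (gen_n (prime_idx J) M)"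
proof -
  have "(\<Sum>I\<in>UNIV. left_coeff X I J * gen_n I M) =
      (\<Sum>K\<in>UNIV. X (gen_n (prime_idx J) K) * (\<Sum>I\<in>UNIV. gen_n (prime_idx I) (prime_idx K) * gen_n I M))"
    unfolding left_coeff_def sum_distrib_left sum_distrib_right by (subst sum.swap) (simp add: mult.assoc)
  also have "\<dots> = (\<Sum>K\<in>UNIV. if K = M then X (gen_n (prime_idx J) K) else 0)"
    unfolding column_orthogonality by (rule sum.cong) auto
  finally show ?thesis by simp
qed

lemma right_coeff_contract: "(\<Sum>J\<in>UNIV. right_coeff X M J * gen_n L (prime_idx J)) = X (gen_n L M)"
proof -
  have "(\<Sum>J\<in>UNIV. right_coeff X M J * gen_n L (prime_idx J)) =
      (\<Sum>K\<in>UNIV. X (gen_n K M) * (\<Sum>J\<in>UNIV. gen_n (prime_idx K) J * gen_n L (prime_idx J)))"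
    unfolding right_coeff_def sum_distrib_left sum_distrib_right by (subst sum.swap) (simp add: ac_simps)
  also have "\<dots> = (\<Sum>K\<in>UNIV. if K = L then X (gen_n K M) else 0)"
    unfolding row_orthogonality by (rule sum.cong) auto
  finally show ?thesis by simp
qed

text \<open>The factor compensates for counting each pair of indices twice.\<close>

lemma left_expansion: "X a = (1 / 2) *\<^sub>C (\<Sum>I\<in>UNIV. \<Sum>J\<in>UNIV. left_coeff X I J * right_inv_field I J a)"
proof (rule derivation_eqI [OF X])
  show "ring_derivation (\<lambda>a. (1 / 2) *\<^sub>C (\<Sum>I\<in>UNIV. \<Sum>J\<in>UNIV. left_coeff X I J * right_inv_field I J a))"
    by (intro ring_derivation_scaleC ring_derivation_sum ring_derivation_times ring_derivation_right_inv_field)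
  show "clinear (\<lambda>a. (1 / 2) *\<^sub>C (\<Sum>I\<in>UNIV. \<Sum>J\<in>UNIV. left_coeff X I J * right_inv_field I J a))"
    by (intro clinear_scaleC_comp clinear_sum_comp clinear_times_comp clinear_right_inv_field)
  fix L M
  have e: "L = prime_idx J \<longleftrightarrow> J = prime_idx L" for J by auto
  have "(\<Sum>I\<in>UNIV. \<Sum>J\<in>UNIV. left_coeff X I J * right_inv_field I J (gen_n L M)) =
    (\<Sum>I\<in>UNIV. \<Sum>J\<in>UNIV. if J = prime_idx L then left_coeff X I J * gen_n I M else 0)
    - (\<Sum>I\<in>UNIV. \<Sum>J\<in>UNIV. if I = prime_idx L then left_coeff X I J * gen_n J M else 0)"
    unfolding right_inv_field_gen_n e sum_subtractf [symmetric] by (intro sum.cong refl) (simp add: right_diff_distrib)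
  also have "(\<Sum>I\<in>UNIV. \<Sum>J\<in>UNIV. if I = prime_idx L then left_coeff X I J * gen_n J M else 0)
      = (\<Sum>J\<in>UNIV. \<Sum>I\<in>UNIV. if I = prime_idx L then left_coeff X I J * gen_n J M else 0)"
    by (rule sum.swap)
  finally have "(\<Sum>I\<in>UNIV. \<Sum>J\<in>UNIV. left_coeff X I J * right_inv_field I J (gen_n L M)) = (\<Sum>I\<in>UNIV. left_coeff X I (prime_idx L) * gen_n I M) - (\<Sum>J\<in>UNIV. left_coeff X (prime_idx L) J * gen_n J M)"
    by simp
  also have "(\<Sum>J\<in>UNIV. left_coeff X (prime_idx L) J * gen_n J M) = - (\<Sum>J\<in>UNIV. left_coeff X J (prime_idx L) * gen_n J M)"
    unfolding sum_negf [symmetric] by (subst left_coeff_antisym) simp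
  finally have "(\<Sum>I\<in>UNIV. \<Sum>J\<in>UNIV. left_coeff X I J * right_inv_field I J (gen_n L M)) = X (gen_n L M) + X (gen_n L M)"
    by (simp add: left_coeff_contract)
  then show "X (gen_n L M) = (1 / 2) *\<^sub>C (\<Sum>I\<in>UNIV. \<Sum>J\<in>UNIV. left_coeff X I J * right_inv_field I J (gen_n L M))"
    by (simp only: half_double)
qed

lemma right_expansion: "X a = (1 / 2) *\<^sub>C (\<Sum>I\<in>UNIV. \<Sum>J\<in>UNIV. right_coeff X I J * left_inv_field I J a)"
proof (rule derivation_eqI [OF X])
  show "ring_derivation (\<lambda>a. (1 / 2) *\<^sub>C (\<Sum>I\<in>UNIV. \<Sum>J\<in>UNIV. right_coeff X I J * left_inv_field I J a))"
    by (intro ring_derivation_scaleC ring_derivation_sum ring_derivation_times ring_derivation_left_inv_field)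
  show "clinear (\<lambda>a. (1 / 2) *\<^sub>C (\<Sum>I\<in>UNIV. \<Sum>J\<in>UNIV. right_coeff X I J * left_inv_field I J a))"
    by (intro clinear_scaleC_comp clinear_sum_comp clinear_times_comp clinear_left_inv_field)
  fix L M
  have e: "(if M = J then a else b) = (if J = M then a else b)" for J :: 5 and a b :: oso5 by auto
  have "(\<Sum>I\<in>UNIV. \<Sum>J\<in>UNIV. right_coeff X I J * left_inv_field I J (gen_n L M)) =
    (\<Sum>I\<in>UNIV. \<Sum>J\<in>UNIV. if I = M then right_coeff X I J * gen_n L (prime_idx J) else 0)
    - (\<Sum>I\<in>UNIV. \<Sum>J\<in>UNIV. if J = M then right_coeff X I J * gen_n L (prime_idx I) else 0)"
    unfolding left_inv_field_gen_n e sum_subtractf [symmetric] by (intro sum.cong refl) (simp add: right_diff_distrib)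
  also have "(\<Sum>I\<in>UNIV. \<Sum>J\<in>UNIV. if I = M then right_coeff X I J * gen_n L (prime_idx J) else 0)
      = (\<Sum>J\<in>UNIV. \<Sum>I\<in>UNIV. if I = M then right_coeff X I J * gen_n L (prime_idx J) else 0)"
    by (rule sum.swap)
  finally have "(\<Sum>I\<in>UNIV. \<Sum>J\<in>UNIV. right_coeff X I J * left_inv_field I J (gen_n L M)) = (\<Sum>J\<in>UNIV. right_coeff X M J * gen_n L (prime_idx J)) - (\<Sum>I\<in>UNIV. right_coeff X I M * gen_n L (prime_idx I))"
    by simp
  also have "(\<Sum>I\<in>UNIV. right_coeff X I M * gen_n L (prime_idx I)) = - (\<Sum>I\<in>UNIV. right_coeff X M I * gen_n L (prime_idx I))"
    unfolding sum_negf [symmetric] by (subst right_coeff_antisym) simp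
  finally have "(\<Sum>I\<in>UNIV. \<Sum>J\<in>UNIV. right_coeff X I J * left_inv_field I J (gen_n L M)) = X (gen_n L M) + X (gen_n L M)"
    by (simp add: right_coeff_contract)
  then show "X (gen_n L M) = (1 / 2) *\<^sub>C (\<Sum>I\<in>UNIV. \<Sum>J\<in>UNIV. right_coeff X I J * left_inv_field I J (gen_n L M))"
    by (simp only: half_double)
qed

text \<open>If \<open>X\<close> annihilates the last column of \<open>N\<close>, then the last column of \<open>N\<^sup>-\<^sup>1 X(N)\<close> is zero, and by antisymmetry so is its last
row. In the left-invariant frame only generators of \<open>so(4)\<close> are left.\<close>

lemma vanishes_on_sphere:
  assumes "\<And>J. X (gen_n J 5) = 0" "b \<in> sphere_alg \<theta>"
  shows "X b = 0"
proof -
  \<comment> \<open>the first index of \<open>right_coeff\<close> is the column of \<open>N\<close> that is differentiated\<close>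
  have r5: "right_coeff X 5 J = 0" for J by (simp add: right_coeff_def assms(1))
  then have "right_coeff X J 5 = 0" for J using right_coeff_antisym [of J 5] by simp
  then have "right_coeff X I J * left_inv_field I J b = 0" for I J
    using r5 left_inv_field_sphere [OF _ _ assms(2), of I J] by (cases "I = 5 \<or> J = 5") auto
  then show ?thesis by (subst right_expansion) simp
qed

text \<open>If \<open>X\<close> is equivariant on the entries of \<open>N\<close>, the coaction maps \<open>X(N)\<close> to \<open>X(N) \<otimes> \<pi>(N)\<close> and \<open>N\<^sup>-\<^sup>1\<close> to
\<open>\<pi>(N)\<^sup>-\<^sup>1 (N\<^sup>-\<^sup>1 \<otimes> 1)\<close>; in the product the factors \<open>\<pi>(N)\<close> cancel. The proof is this cancellation written in indices.\<close>

lemma left_coeff_sphere: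
  assumes "\<And>J K. coproduct (X (gen_n J K)) \<doteq> (\<Sum>L\<in>UNIV. X (gen_n J L) \<otimes>\<^sub>C gen_n L K)"
  shows "left_coeff X I J \<in> sphere_alg \<theta>"
proof -
  have t: "sum f S \<otimes>\<^sub>C c = (\<Sum>x\<in>S. f x \<otimes>\<^sub>C c)" "c \<otimes>\<^sub>C sum f S = (\<Sum>x\<in>S. c \<otimes>\<^sub>C f x)"
    for f :: "5 \<Rightarrow> oso5" and c :: oso5 and S
    by (induction S rule: infinite_finite_induct) (simp_all add: tensor_bilinear)
  have "coproduct (left_coeff X I J) = (\<Sum>K\<in>UNIV. coproduct (X (gen_n (prime_idx J) K)) * coproduct (gen_n (prime_idx I) (prime_idx K)))"
    by (simp add: left_coeff_def coproduct.sum coproduct.mult)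
  also have "\<dots> \<doteq> (\<Sum>K\<in>UNIV. (\<Sum>L\<in>UNIV. X (gen_n (prime_idx J) L) \<otimes>\<^sub>C gen_n L K) *
       (\<Sum>P\<in>UNIV. gen_n (prime_idx I) P \<otimes>\<^sub>C gen_n P (prime_idx K)))"
    unfolding coproduct_gen_n [of "prime_idx I"] by (intro kernel_eq_sum kernel_eq_mult assms kernel_eq_refl)
  also have "(\<Sum>K\<in>UNIV. (\<Sum>L\<in>UNIV. X (gen_n (prime_idx J) L) \<otimes>\<^sub>C gen_n L K) *
       (\<Sum>P\<in>UNIV. gen_n (prime_idx I) P \<otimes>\<^sub>C gen_n P (prime_idx K)))
     = (\<Sum>K\<in>UNIV. \<Sum>L\<in>UNIV. \<Sum>P\<in>UNIV. (X (gen_n (prime_idx J) L) * gen_n (prime_idx I) P) \<otimes>\<^sub>C (gen_n L K * gen_n P (prime_idx K)))"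
    by (simp add: sum_product)
  also have "\<dots> = (\<Sum>L\<in>UNIV. \<Sum>P\<in>UNIV. \<Sum>K\<in>UNIV. (X (gen_n (prime_idx J) L) * gen_n (prime_idx I) P) \<otimes>\<^sub>C (gen_n L K * gen_n P (prime_idx K)))"
    by (subst sum.swap, rule sum.cong [OF refl], rule sum.swap)
  also have "\<dots> = (\<Sum>L\<in>UNIV. \<Sum>P\<in>UNIV. if P = prime_idx L then (X (gen_n (prime_idx J) L) * gen_n (prime_idx I) P) \<otimes>\<^sub>C 1 else 0)"
    unfolding t(2) [symmetric] row_orthogonality by (intro sum.cong refl) simp
  also have "\<dots> = left_coeff X I J \<otimes>\<^sub>C 1"
    by (simp add: left_coeff_def t(1))
  finally show ?thesis unfolding sphere_alg_iff .
qed

end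

text \<open>The contraction of the basis trivector \<open>K I J\<close> with the vector \<open>v\<^sub>J = n\<^sub>J\<^sub>5\<close>.\<close>

definition vertical :: "5 \<Rightarrow> 5 \<Rightarrow> 5 \<Rightarrow> oso5 \<Rightarrow> oso5"
  where "vertical K I J a = gen_n K 5 * right_inv_field I J a + gen_n I 5 * right_inv_field J K a + gen_n J 5 * right_inv_field K I a"

text \<open>The wedge product of the bivector \<open>left_coeff X\<close> with the covector \<open>v\<^sub>K\<^sub>'\<close> dual to \<open>v\<close>: the contracting homotopy of the Koszul complex.\<close>

definition koszul_coeff :: "(oso5 \<Rightarrow> oso5) \<Rightarrow> 5 \<Rightarrow> 5 \<Rightarrow> 5 \<Rightarrow> oso5"
  where "koszul_coeff X K I J = gen_n (prime_idx K) 5 * left_coeff X I J + gen_n (prime_idx I) 5 * left_coeff X J K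
     + gen_n (prime_idx J) 5 * left_coeff X K I"

lemma sum3_rotate: "(\<Sum>K\<in>A. \<Sum>I\<in>A. \<Sum>J\<in>A. f K I J) = (\<Sum>K\<in>A. \<Sum>I\<in>A. \<Sum>J\<in>A. f I J K)"
  for f :: "'b \<Rightarrow> 'b \<Rightarrow> 'b \<Rightarrow> 'a::comm_monoid_add"
proof -
  have "(\<Sum>K\<in>A. \<Sum>I\<in>A. \<Sum>J\<in>A. f I J K) = (\<Sum>I\<in>A. \<Sum>K\<in>A. \<Sum>J\<in>A. f I J K)" by (rule sum.swap)
  also have "\<dots> = (\<Sum>I\<in>A. \<Sum>J\<in>A. \<Sum>K\<in>A. f I J K)" by (rule sum.cong [OF refl], rule sum.swap)
  finally show ?thesis ..
qed

text \<open>Contracting \<open>v' \<and> c\<close> with \<open>v\<close> returns \<open>c\<close>, because \<open>v' \<cdot> v = 1\<close> and the contraction of \<open>c\<close> with \<open>v\<close> is zero. The factor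
\<open>1 / 6\<close> is \<open>1 / 2\<close> from the expansion in bivectors and \<open>1 / 3\<close> from symmetrising over cyclic rotations.\<close>

lemma koszul_expansion:
  assumes X: "ring_derivation X" "clinear X" and v: "\<And>J. X (gen_n J 5) = 0"
  shows "X a = (1 / 6) *\<^sub>C (\<Sum>K\<in>UNIV. \<Sum>I\<in>UNIV. \<Sum>J\<in>UNIV. koszul_coeff X K I J * vertical K I J a)"
proof -
  let ?T = "koszul_coeff X" and ?c = "left_coeff X" and ?v = "\<lambda>K. gen_n K 5"
  \<comment> \<open>the contraction of \<open>c\<close> with \<open>v\<close> is \<open>X\<close> applied to the last column\<close>
  have c0: "(\<Sum>K\<in>UNIV. ?c K J * ?v K) = 0" for J
    by (simp add: left_coeff_contract [OF X] v)
  have c1: "(\<Sum>K\<in>UNIV. ?c J K * ?v K) = 0" for J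
    using c0 [of J] by (subst left_coeff_antisym [OF X]) (simp add: sum_negf)
  have v1: "(\<Sum>K\<in>UNIV. ?v (prime_idx K) * ?v K) = 1" unfolding column_orthogonality by simp
  \<comment> \<open>the homotopy identity; the terms containing contractions of \<open>c\<close> with \<open>v\<close> drop out\<close>
  have T: "(\<Sum>K\<in>UNIV. ?v K * ?T K I J) = ?c I J" for I J
  proof -
    have "(\<Sum>K\<in>UNIV. ?v K * ?T K I J) = (\<Sum>K\<in>UNIV. ?v (prime_idx K) * ?v K) * ?c I J
       + ?v (prime_idx I) * (\<Sum>K\<in>UNIV. ?c J K * ?v K) + ?v (prime_idx J) * (\<Sum>K\<in>UNIV. ?c K I * ?v K)"
      unfolding sum_distrib_left sum_distrib_right sum.distrib [symmetric]
      by (rule sum.cong) (simp_all add: koszul_coeff_def algebra_simps)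
    then show ?thesis by (simp add: c0 c1 v1)
  qed
  let ?S = "\<lambda>F. \<Sum>K\<in>UNIV. \<Sum>I\<in>UNIV. \<Sum>J\<in>UNIV. F K I J :: oso5"
  have rot: "?T K I J = ?T I J K" for K I J by (simp add: koszul_coeff_def ac_simps)
  \<comment> \<open>rotating the indices of \<open>F\<close> yields the three summands of \<open>vertical\<close>, with the same coefficient\<close>
  define F where "F K I J = ?T K I J * (?v K * right_inv_field I J a)" for K I J
  have "(\<Sum>I\<in>UNIV. \<Sum>J\<in>UNIV. ?c I J * right_inv_field I J a) = (\<Sum>I\<in>UNIV. \<Sum>J\<in>UNIV. \<Sum>K\<in>UNIV. F K I J)"
    unfolding T [symmetric] F_def by (simp add: sum_distrib_left sum_distrib_right ac_simps)
  also have "\<dots> = ?S F" by (rule sum3_rotate [of "\<lambda>I J K. F K I J"])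
  finally have 1: "(\<Sum>I\<in>UNIV. \<Sum>J\<in>UNIV. ?c I J * right_inv_field I J a) = ?S F" .
  have "?S (\<lambda>K I J. ?T K I J * vertical K I J a) = ?S (\<lambda>K I J. F K I J + F I J K + F J K I)"
  proof (intro sum.cong refl)
    fix K I J
    have "?T K I J = ?T J K I" using rot by metis
    then show "?T K I J * vertical K I J a = F K I J + F I J K + F J K I"
      using rot [of K I J] by (simp add: F_def vertical_def distrib_left)
  qed
  also have "\<dots> = ?S F + ?S F + ?S F"
    unfolding sum.distrib by (simp only: sum3_rotate [of "\<lambda>K I J. F K I J", symmetric] sum3_rotate [of "\<lambda>K I J. F J K I", symmetric])
  also have "\<dots> = 3 *\<^sub>C ?S F"
    using scaleC_add_left [of 1 2 "?S F"] scaleC_add_left [of 1 1 "?S F"] by (simp add: ac_simps)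
  finally show ?thesis by (subst left_expansion [OF X]) (simp add: 1)
qed

section \<open>Vertical derivations and the generators\<close>

lemma ring_derivation_vertical: "ring_derivation (vertical K I J)"
  using ring_derivation_times [OF ring_derivation_right_inv_field]
  unfolding ring_derivation_def vertical_def [abs_def] by (simp add: algebra_simps)

lemma clinear_vertical: "clinear (vertical K I J)"
  unfolding vertical_def [abs_def] by (intro clinear_add_comp clinear_times_comp clinear_right_inv_field)

lemma vertical_sphere: "b \<in> sphere_alg \<theta> \<Longrightarrow> vertical K I J b = 0"
proof (rule vanishes_on_sphere [OF ring_derivation_vertical clinear_vertical])
  fix L
  show "vertical K I J (gen_n L 5) = 0" by (simp add: vertical_def right_inv_field_gen_n algebra_simps)
qed

lemma equivariant_add:
  assumes "clinear u" "clinear v" "equivariant u" "equivariant v"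
  shows "equivariant (\<lambda>a. u a + v a)"
proof -
  have "tensor_map (\<lambda>a. u a + v a) id t = tensor_map u id t + tensor_map v id t" for t :: "(oso5, oso5) tensor"
  proof (induction t rule: tensor_induct)
    case (tensor a b)
    show ?case unfolding tensor_map_tensor [OF clinear_add_comp [OF assms(1,2)] clinear_id]
      tensor_map_tensor [OF assms(1) clinear_id] tensor_map_tensor [OF assms(2) clinear_id] tensor_add_left ..
  next
    case (add s t)
    then show ?case
      by (simp only: clinearD(1) [OF clinear_tensor_map [OF _ clinear_id]] clinear_add_comp assms ac_simps)
  qed (simp only: clinearD(3) [OF clinear_tensor_map [OF _ clinear_id]] clinear_add_comp assms add_0)
  then show ?thesis using assms(3,4) unfolding equivariant_def coproduct.add by (simp only: kernel_eq_add simp_thms)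
qed

text \<open>Multiplication by a coinvariant function is compatible with the coaction.\<close>

lemma equivariant_times:
  assumes "clinear u" "equivariant u" "b \<in> sphere_alg \<theta>"
  shows "equivariant (\<lambda>a. b * u a)"
proof -
  have t: "tensor_map (\<lambda>a. b * u a) id t = (b \<otimes>\<^sub>C 1) * tensor_map u id t" for t :: "(oso5, oso5) tensor"
  proof (induction t rule: tensor_induct)
    case (tensor a c)
    show ?case unfolding tensor_map_tensor [OF clinear_times_comp [OF assms(1)] clinear_id]
      tensor_map_tensor [OF assms(1) clinear_id] tensor_mult by simp
  next
    case (add s t)
    then show ?case
      by (simp only: clinearD(1) [OF clinear_tensor_map [OF _ clinear_id]] clinear_times_comp assms distrib_left)
  qed (simp only: clinearD(3) [OF clinear_tensor_map [OF _ clinear_id]] clinear_times_comp assms mult_zero_right)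
  show ?thesis
    unfolding equivariant_def coproduct.mult t
    using assms(2,3) unfolding equivariant_def sphere_alg_iff by (blast intro: kernel_eq_mult)
qed

lemma equivariant_right_inv_field: "equivariant (right_inv_field I J)"
  by (simp only: equivariant_def coproduct_right_inv_field kernel_eq_refl simp_thms)

lemma equivariant_vertical: "equivariant (vertical K I J)"
  unfolding vertical_def [abs_def]
  by (intro equivariant_add clinear_add_comp clinear_times_comp clinear_right_inv_field equivariant_times [OF _ _ sphere_gen] equivariant_right_inv_field)

lemma bihom_partial_n:
  assumes "bihom l p (Poly_Mapping.single m c)"
  shows "bihom (l - eps J) (p - eps K) (partial_n J K (Poly_Mapping.single m c))"
proof (cases "c * of_nat (poly_mapping.lookup m (J, K)) = 0")
  case False
  define m' where "m' = m - Poly_Mapping.single (J, K) 1"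
  have m: "m = m' + Poly_Mapping.single (J, K) 1"
    by (rule poly_mapping_eqI) (use False in \<open>auto simp: m'_def lookup_add lookup_minus lookup_single when_def\<close>)
  have "left_weight m = l" "right_weight m = p" using assms False by (simp_all add: bihom_def)
  then have "left_weight m' = l - eps J" "right_weight m' = p - eps K"
    by (simp_all add: m monom_weight_add algebra_simps)
  then show ?thesis unfolding partial_n_single m'_def [symmetric] by (simp add: bihom_def)
next
  case True
  then show ?thesis unfolding partial_n_single by (simp only: single_zero bihom_zero)
qed

lemma bihom_T_poly: "bihom l p (Poly_Mapping.single m c) \<Longrightarrow> bihom (l + (eps I - eps J)) p (T_poly I J (Poly_Mapping.single m c))"
  unfolding T_poly_def
proof (rule bihom_sum)
  fix K assume "bihom l p (Poly_Mapping.single m c)"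
  from bihom_mult [OF bihom_var [of I K] bihom_partial_n [OF this, of J K]]
  show "bihom (l + (eps I - eps J)) p (var I K * partial_n J K (Poly_Mapping.single m c))"
    by (simp add: algebra_simps)
qed

text \<open>On monomials, \<open>n\<^sub>I\<^sub>K \<partial>\<^sub>J\<^sub>K\<close> replaces a factor of row \<open>J\<close> by one of row \<open>I\<close> in the same column.\<close>

lemma homogeneous_right_inv_field: "homogeneous (eps I + eps J) (right_inv_field I J)"
  unfolding homogeneous_def
proof (intro conjI clinear_right_inv_field allI impI)
  fix l p a assume "a \<in> graded l p"
  then obtain f where f: "bihom l p f" "a = abs_oso5 f" by (rule graded_ex_poly)
  let ?f = "\<lambda>k. Poly_Mapping.single k (poly_mapping.lookup f k)"
  have "f = (\<Sum>k\<in>Poly_Mapping.keys f. ?f k)"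
    by (rule poly_mapping_eqI) (auto simp: lookup_sum lookup_single when_def in_keys_iff)
  then have "L_poly I (prime_idx J) f = (\<Sum>k\<in>Poly_Mapping.keys f. L_poly I (prime_idx J) (?f k))"
    by (metis clinearD(6) [OF clinear_L_poly])
  also have "bihom (l + (eps I + eps J)) p \<dots>"
  proof (rule bihom_sum)
    fix k assume "k \<in> Poly_Mapping.keys f"
    then have "bihom l p (?f k)" using f(1) by (simp add: bihom_def)
    from bihom_T_poly [OF this, of I "prime_idx J"] bihom_T_poly [OF this, of J "prime_idx I"]
    show "bihom (l + (eps I + eps J)) p (L_poly I (prime_idx J) (?f k))"
      unfolding L_poly_def by (intro bihom_diff) (simp_all add: eps_prime add.commute)
  qed
  finally show "right_inv_field I J a \<in> graded (l + (eps I + eps J)) p"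
    by (simp add: f(2) right_inv_field_def L_op.abs_eq graded_abs)
qed

lemma graded_last: "gen_n K 5 \<in> graded (eps K) 0"
  using graded_gen_n [of K 5] by (simp add: eps_def zero_prod_def)

lemma homogeneous_add: "homogeneous r u \<Longrightarrow> homogeneous r v \<Longrightarrow> homogeneous r (\<lambda>a. u a + v a)"
  unfolding homogeneous_def by (auto intro: clinear_add_comp graded_add)

lemma homogeneous_times:
  assumes "homogeneous r u" "b \<in> graded k 0" shows "homogeneous (k + r) (\<lambda>a. b * u a)"
  unfolding homogeneous_def
proof (intro conjI allI impI clinear_times_comp homogeneousD(1) [OF assms(1)])
  fix l p a assume "a \<in> graded l p"
  from graded_mult [OF assms(2) homogeneousD(2) [OF assms(1) this]]
  show "b * u a \<in> graded (l + (k + r)) p" by (simp add: ac_simps)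
qed

lemma homogeneous_vertical: "homogeneous (eps K + eps I + eps J) (vertical K I J)"
proof -
  have *: "homogeneous (eps K + eps I + eps J) (\<lambda>a. gen_n K' 5 * right_inv_field I' J' a)"
    if "eps K + eps I + eps J = eps K' + (eps I' + eps J')" for K' I' J'
    unfolding that by (rule homogeneous_times [OF homogeneous_right_inv_field graded_last])
  show ?thesis unfolding vertical_def [abs_def] by (intro homogeneous_add *) (simp_all add: ac_simps)
qed

lemma right_inv_field_diag: "right_inv_field I I a = 0"
proof -
  obtain f where a: "a = abs_oso5 f" by (rule oso5_cases)
  show ?thesis by (simp add: a right_inv_field_def L_op.abs_eq L_poly_def zero_oso5_def)
qed

text \<open>Orients the ten pairs of indices so that each derivation has one normal form.\<close>

lemma right_inv_field_canonical:
  "right_inv_field 3 1 a = - right_inv_field 1 3 a" "right_inv_field 4 2 a = - right_inv_field 2 4 a" "right_inv_field 1 5 a = - right_inv_field 5 1 a" "right_inv_field 5 3 a = - right_inv_field 3 5 a"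
  "right_inv_field 2 5 a = - right_inv_field 5 2 a" "right_inv_field 5 4 a = - right_inv_field 4 5 a" "right_inv_field 1 2 a = - right_inv_field 2 1 a" "right_inv_field 4 3 a = - right_inv_field 3 4 a"
  "right_inv_field 1 4 a = - right_inv_field 4 1 a" "right_inv_field 2 3 a = - right_inv_field 3 2 a"
  by (rule right_inv_field_antisym)+

lemma L_op_right_inv_field:
  "L_op 1 1 = right_inv_field 1 3" "L_op 2 2 = right_inv_field 2 4" "L_op 5 3 = right_inv_field 5 1" "L_op 3 5 = right_inv_field 3 5" "L_op 5 4 = right_inv_field 5 2"
  "L_op 4 5 = right_inv_field 4 5" "L_op 2 3 = right_inv_field 2 1" "L_op 3 2 = right_inv_field 3 4" "L_op 4 3 = right_inv_field 4 1" "L_op 3 4 = right_inv_field 3 2"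
  by (simp_all add: right_inv_field_def)

lemma sqrt2_sqrt2: "sqrt2 * sqrt2 = 2"
  unfolding sqrt2_def of_real_mult [symmetric] by simp

lemma two_times: "2 * x = 2 *\<^sub>C x" for x :: oso5
  unfolding mult_2 using scaleC_add_left [of 1 1 x] by (simp only: one_add_one scaleC_one)

lemma K_op_vertical: "K_op 1 a = 2 *\<^sub>C vertical 5 2 4 a" "K_op 2 a = 2 *\<^sub>C vertical 5 1 3 a"
  by (simp_all add: K_op_def vertical_def H1_def H2_def E_op_def L_op_right_inv_field right_inv_field_canonical alpha_def beta_def alpha_star_def
    beta_star_def x_coord_def sqrt2_sqrt2 scaleC_add_right mult.assoc two_times)

lemma W_op_vertical:
  "W_op (0, 1) a = 2 *\<^sub>C vertical 2 1 3 a" "W_op (0, - 1) a = 2 *\<^sub>C vertical 4 1 3 a"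
  "W_op (1, 0) a = 2 *\<^sub>C vertical 1 2 4 a" "W_op (- 1, 0) a = 2 *\<^sub>C vertical 3 2 4 a"
  "W_op (1, 1) a = 2 *\<^sub>C vertical 5 2 1 a" "W_op (- 1, - 1) a = 2 *\<^sub>C vertical 5 3 4 a"
  "W_op (1, - 1) a = 2 *\<^sub>C vertical 5 1 4 a" "W_op (- 1, 1) a = 2 *\<^sub>C vertical 5 2 3 a"
  by (simp_all add: W_op_def vertical_def H1_def H2_def E_op_def L_op_right_inv_field right_inv_field_canonical alpha_def beta_def alpha_star_def
    beta_star_def x_coord_def sqrt2_sqrt2 scaleC_add_right cvec.scale_right_diff_distrib mult.assoc two_times ac_simps)

section \<open>Functions of the left torus action\<close>

text \<open>Functions of the left torus action. These are the operators by which \<open>twist_D\<close> differs from the identity on homogeneous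
maps, and \<open>exp_H\<close> is among them.\<close>

definition grade_scale :: "(weight \<Rightarrow> complex) \<Rightarrow> oso5 \<Rightarrow> oso5"
  where "grade_scale f a = Sum_any (\<lambda>l. f l *\<^sub>C lpart l a)"

lemma finite_grade_scale: "finite {l. f l *\<^sub>C lpart l a \<noteq> 0}"
  by (rule finite_subset [OF _ lpart_sum(1) [of a]]) auto

lemma clinear_grade_scale: "clinear (grade_scale f)"
  unfolding grade_scale_def [abs_def]
  by (rule clinear_Sum_any [OF _ finite_grade_scale]) (rule clinear_scaleC_comp [OF clinear_lpart])

lemma grade_scale_graded: "a \<in> graded l p \<Longrightarrow> grade_scale f a = f l *\<^sub>C a"
  unfolding grade_scale_def by (subst Sum_any_single [of l]) (simp_all add: lpart_graded)

lemma lpart_grade_scale: "lpart m (grade_scale f a) = f m *\<^sub>C lpart m a"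
  by (induction a rule: graded_induct)
    (simp_all add: clinearD [OF clinear_grade_scale] clinearD [OF clinear_lpart] scaleC_add_right grade_scale_graded lpart_graded)

lemma equivariant_grade_scale: "equivariant (grade_scale f)"
proof -
  note M = clinearD [OF clinear_tensor_map [OF clinear_grade_scale clinear_id], of f]
  have t: "tensor_map (grade_scale f) id t = f l *\<^sub>C t" if "t \<in> left_homogeneous l" for t l
    using that unfolding left_homogeneous_def
  proof (induction rule: cvec.span_induct_alt)
    case base
    show ?case by (simp only: M(3) cvec.scale_zero_right)
  next
    case (step c z r)
    then obtain x y p where z: "z = x \<otimes>\<^sub>C y" "x \<in> graded l p" by blast
    show ?case
      unfolding M(1,2) step(2) z(1) tensor_map_tensor [OF clinear_grade_scale clinear_id] grade_scale_graded [OF z(2)] id_apply [of y]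
      by (simp add: tensor_scaleC_left scaleC_add_right mult.commute)
  qed
  have "coproduct (grade_scale f a) = tensor_map (grade_scale f) id (coproduct a)" for a
  proof (induction a rule: graded_induct)
    case zero
    show ?case by (simp only: clinearD(3) [OF clinear_grade_scale] coproduct.zero M(3))
  next
    case (add a b)
    then show ?case by (simp only: clinearD(1) [OF clinear_grade_scale] coproduct.add M(1))
  next
    case (graded l p a)
    show ?case
      unfolding t [OF coproduct_graded [OF graded]] grade_scale_graded [OF graded] clinearD(2) [OF clinear_coproduct] ..
  qed
  then show ?thesis by (simp only: equivariant_def kernel_eq_refl simp_thms)
qed

lemma equivariant_comp:
  assumes "clinear u" "equivariant u" "clinear v" "equivariant v"
  shows "equivariant (\<lambda>a. u (v a))"
proof -
  have c: "clinear (\<lambda>a. u (v a))" by (rule clinearI) (simp_all add: clinearD [OF assms(1)] clinearD [OF assms(3)])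
  have t: "tensor_map (\<lambda>a. u (v a)) id t = tensor_map u id (tensor_map v id t)" for t :: "(oso5, oso5) tensor"
  proof (induction t rule: tensor_induct)
    case zero
    show ?case by (simp only: clinearD(3) [OF clinear_tensor_map [OF _ clinear_id]] c assms)
  next
    case (tensor a b)
    show ?case unfolding tensor_map_tensor [OF c clinear_id] tensor_map_tensor [OF assms(3) clinear_id]
      tensor_map_tensor [OF assms(1) clinear_id] id_apply [of b] ..
  next
    case (add s t)
    then show ?case by (simp only: clinearD(1) [OF clinear_tensor_map [OF _ clinear_id]] c assms)
  qed
  show ?thesis unfolding equivariant_def t
  proof
    fix a
    have "coproduct (u (v a)) \<doteq> tensor_map u id (coproduct (v a))"
      using assms(2) unfolding equivariant_def by blast
    also have "\<dots> \<doteq> tensor_map u id (tensor_map v id (coproduct a))"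
      using assms(4) unfolding equivariant_def by (intro tensor_map_kernel_eq assms(1)) blast
    finally show "coproduct (u (v a)) \<doteq> tensor_map u id (tensor_map v id (coproduct a))" .
  qed
qed

lemma twist_D_homogeneous_eq:
  assumes "homogeneous r u"
  shows "twist_D \<theta> u = (\<lambda>a. u (grade_scale (\<lambda>l. phase \<theta> (- wedge r l)) a))"
proof
  fix a
  note u = homogeneousD(1) [OF assms]
  show "twist_D \<theta> u a = u (grade_scale (\<lambda>l. phase \<theta> (- wedge r l)) a)"
  proof (rule clinear_eqI_graded [of "twist_D \<theta> u" "\<lambda>a. u (grade_scale (\<lambda>l. phase \<theta> (- wedge r l)) a)"])
    show "clinear (\<lambda>a. u (grade_scale (\<lambda>l. phase \<theta> (- wedge r l)) a))"
      by (rule clinearI) (simp_all add: clinearD [OF u] clinearD [OF clinear_grade_scale])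
  qed (simp_all add: clinear_twist_D u twist_D_homogeneous [OF assms] grade_scale_graded clinearD [OF u])
qed

section \<open>Gauge derivations and their twists\<close>

text \<open>A homogeneous infinitesimal gauge transformation of the undeformed bundle. By \<open>vanishes_on_sphere\<close>, the condition on
the last column implies that \<open>X\<close> annihilates all coinvariants.\<close>

definition gauge_derivation :: "weight \<Rightarrow> (oso5 \<Rightarrow> oso5) \<Rightarrow> bool"
  where "gauge_derivation r X \<longleftrightarrow>
    ring_derivation X \<and> homogeneous r X \<and> equivariant X \<and> (\<forall>J. X (gen_n J 5) = 0)"

lemma gauge_derivationD:
  assumes "gauge_derivation r X"
  shows "ring_derivation X" "homogeneous r X" "clinear X" "equivariant X" "b \<in> sphere_alg \<theta> \<Longrightarrow> X b = 0"
  using assms vanishes_on_sphere [of X b \<theta>] unfolding gauge_derivation_def homogeneous_def by blast+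

lemma gauge_derivation_times:
  assumes "gauge_derivation r X" "b \<in> sphere_alg \<theta>" "b \<in> graded k 0"
  shows "gauge_derivation (k + r) (\<lambda>a. b * X a)"
  using assms equivariant_times [OF gauge_derivationD(3,4) [OF assms(1)] assms(2)] unfolding gauge_derivation_def
  by (simp add: ring_derivation_times homogeneous_times)

lemma gauge_derivation_scaleC:
  assumes "gauge_derivation r X" shows "gauge_derivation r (\<lambda>a. c *\<^sub>C X a)"
  using gauge_derivation_times [OF assms sphere_closed(4) [OF sphere_one] graded_scaleC [OF graded_one], of c] by simp

lemma gauge_derivation_vertical: "gauge_derivation (eps K + eps I + eps J) (vertical K I J)"
  using vertical_sphere [OF sphere_gen]
  by (simp add: gauge_derivation_def ring_derivation_vertical homogeneous_vertical equivariant_vertical)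

lemma gauge_derivation_eq_vertical:
  assumes "\<And>a. X a = c *\<^sub>C vertical K I J a" "eps K + eps I + eps J = r"
  shows "gauge_derivation r X"
proof -
  have "X = (\<lambda>a. c *\<^sub>C vertical K I J a)" by (rule ext) (rule assms(1))
  then show ?thesis using gauge_derivation_scaleC [OF gauge_derivation_vertical [of K I J], of c] by (simp add: assms(2))
qed

lemma gauge_derivation_K: "j \<in> {1, 2} \<Longrightarrow> gauge_derivation 0 (K_op j)"
proof -
  have "gauge_derivation 0 (K_op 1)"
    by (rule gauge_derivation_eq_vertical [OF K_op_vertical(1)]) (simp add: eps_def zero_prod_def)
  moreover have "gauge_derivation 0 (K_op 2)"
    by (rule gauge_derivation_eq_vertical [OF K_op_vertical(2)]) (simp add: eps_def zero_prod_def)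
  ultimately show "j \<in> {1, 2} \<Longrightarrow> gauge_derivation 0 (K_op j)" by blast
qed

lemma gauge_derivation_W: "r \<in> roots \<Longrightarrow> gauge_derivation r (W_op r)"
proof -
  have 1: "gauge_derivation (0, 1) (W_op (0, 1))"
    by (rule gauge_derivation_eq_vertical [OF W_op_vertical(1)]) (simp add: eps_def)
  have 2: "gauge_derivation (0, - 1) (W_op (0, - 1))"
    by (rule gauge_derivation_eq_vertical [OF W_op_vertical(2)]) (simp add: eps_def)
  have 3: "gauge_derivation (1, 0) (W_op (1, 0))"
    by (rule gauge_derivation_eq_vertical [OF W_op_vertical(3)]) (simp add: eps_def)
  have 4: "gauge_derivation (- 1, 0) (W_op (- 1, 0))"
    by (rule gauge_derivation_eq_vertical [OF W_op_vertical(4)]) (simp add: eps_def)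
  have 5: "gauge_derivation (1, 1) (W_op (1, 1))"
    by (rule gauge_derivation_eq_vertical [OF W_op_vertical(5)]) (simp add: eps_def)
  have 6: "gauge_derivation (- 1, - 1) (W_op (- 1, - 1))"
    by (rule gauge_derivation_eq_vertical [OF W_op_vertical(6)]) (simp add: eps_def)
  have 7: "gauge_derivation (1, - 1) (W_op (1, - 1))"
    by (rule gauge_derivation_eq_vertical [OF W_op_vertical(7)]) (simp add: eps_def)
  have 8: "gauge_derivation (- 1, 1) (W_op (- 1, 1))"
    by (rule gauge_derivation_eq_vertical [OF W_op_vertical(8)]) (simp add: eps_def)
  show "r \<in> roots \<Longrightarrow> gauge_derivation r (W_op r)"
    unfolding roots_def using 1 2 3 4 5 6 7 8 by blast
qed

lemma finite_braid_support:
  assumes "clinear u"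
  shows "finite {(r, l). star \<theta> (lpart l a) (map_part r u a') \<noteq> 0}"
proof (rule finite_support_prod [OF finite_map_part [OF assms, of a'] lpart_sum(1) [of a]])
  fix r l assume "star \<theta> (lpart l a) (map_part r u a') \<noteq> 0"
  then have "map_part r u a' \<noteq> 0" "lpart l a \<noteq> 0"
    using clinearD(3) [OF clinear_star(1)] clinearD(3) [OF clinear_star(2)] by metis+
  then show "r \<in> {r. map_part r u a' \<noteq> 0} \<and> l \<in> {l. lpart l a \<noteq> 0}" by blast
qed

text \<open>Both sides are linear in \<open>a\<close> and in \<open>a'\<close>, the braided term because its support is finite.\<close>

lemma leibniz_from_graded:
  assumes u: "clinear u"
    and gr: "\<And>a a' l p l' p'. a \<in> graded l p \<Longrightarrow> a' \<in> graded l' p' \<Longrightarrow>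
      u (star \<theta> a a') = star \<theta> (u a) a' + exp_wedge t (\<lambda>r l. star \<theta> (lpart l a) (map_part r u a'))"
  shows "u (star \<theta> a a') = star \<theta> (u a) a' + exp_wedge t (\<lambda>r l. star \<theta> (lpart l a) (map_part r u a'))"
proof -
  have c1: "clinear (\<lambda>a. exp_wedge t (\<lambda>r l. star \<theta> (lpart l a) (map_part r u a')))" for a'
    by (rule clinear_exp_wedge [OF _ finite_braid_support [OF u]])
      (rule clinearI; simp add: star_linear clinearD [OF clinear_lpart])
  have c2: "clinear (\<lambda>a'. exp_wedge t (\<lambda>r l. star \<theta> (lpart l a) (map_part r u a')))" for a
    by (rule clinear_exp_wedge [OF _ finite_braid_support [OF u]])
      (rule clinearI; simp add: star_linear clinearD [OF clinear_map_part [OF u]])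
  have 1: "u (star \<theta> a a') = star \<theta> (u a) a' + exp_wedge t (\<lambda>r l. star \<theta> (lpart l a) (map_part r u a'))"
    if a: "a \<in> graded l p" for a l p a'
  proof (rule clinear_eqI_graded [of "\<lambda>a'. u (star \<theta> a a')" "\<lambda>a'. star \<theta> (u a) a' + exp_wedge t (\<lambda>r l. star \<theta> (lpart l a) (map_part r u a'))"])
    show "clinear (\<lambda>a'. u (star \<theta> a a'))" by (rule clinearI) (simp_all add: star_linear clinearD [OF u])
    show "clinear (\<lambda>a'. star \<theta> (u a) a' + exp_wedge t (\<lambda>r l. star \<theta> (lpart l a) (map_part r u a')))"
      by (intro clinear_add_comp clinear_star c2)
  qed (rule gr [OF a])
  show ?thesis
  proof (rule clinear_eqI_graded [of "\<lambda>a. u (star \<theta> a a')" "\<lambda>a. star \<theta> (u a) a' + exp_wedge t (\<lambda>r l. star \<theta> (lpart l a) (map_part r u a'))"])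
    show "clinear (\<lambda>a. u (star \<theta> a a'))" by (rule clinearI) (simp_all add: star_linear clinearD [OF u])
    have "clinear (\<lambda>a. star \<theta> (u a) a')" by (rule clinearI) (simp_all add: star_linear clinearD [OF u])
    then show "clinear (\<lambda>a. star \<theta> (u a) a' + exp_wedge t (\<lambda>r l. star \<theta> (lpart l a) (map_part r u a')))"
      by (intro clinear_add_comp c1)
  qed (rule 1)
qed

lemma braid_homogeneous:
  assumes u: "homogeneous r u" and a: "a \<in> graded l p"
  shows "exp_wedge (- 2 * \<theta>) (\<lambda>r l. star \<theta> (lpart l a) (map_part r u c)) = phase \<theta> (- 2 * wedge r l) *\<^sub>C star \<theta> a (u c)"
proof -
  have "exp_wedge (- 2 * \<theta>) (\<lambda>r l. star \<theta> (lpart l a) (map_part r u c))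
      = phase (- 2 * \<theta>) (wedge r l) *\<^sub>C star \<theta> (lpart l a) (map_part r u c)"
  proof (rule exp_wedge_single)
    fix r' l' assume "(r', l') \<noteq> (r, l)"
    then show "star \<theta> (lpart l' a) (map_part r' u c) = 0"
      by (cases "r' = r") (simp_all add: lpart_graded [OF a] map_part_homogeneous [OF u] star_linear)
  qed
  then show ?thesis by (simp add: lpart_graded [OF a] map_part_homogeneous [OF u] phase_double_time)
qed

text \<open>The braided Leibniz rule for weight vectors is the ordinary one up to phases. In the first term, the phase of \<open>twist_D X\<close> on a
product splits into the phase at \<open>a\<close> and the phase by which \<open>X a \<bullet> a'\<close> differs from \<open>a \<bullet> a'\<close>; in the second
term, the defect is exactly the braiding \<open>- 2 * wedge r l\<close>.\<close>

lemma twist_gauge_in_aut: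
  assumes X: "gauge_derivation r X"
  shows "twist_D \<theta> X \<in> aut \<theta>"
proof -
  note hX = gauge_derivationD(2) [OF X]
  let ?u = "twist_D \<theta> X"
  have hu: "homogeneous r ?u" by (rule homogeneous_twist_D [OF hX])
  note u = homogeneousD(1) [OF hu]
  have eq: "equivariant ?u"
    unfolding twist_D_homogeneous_eq [OF hX]
    by (rule equivariant_comp [OF gauge_derivationD(3,4) [OF X] clinear_grade_scale equivariant_grade_scale])
  have "?u (star \<theta> a a') = star \<theta> (?u a) a' + exp_wedge (- 2 * \<theta>) (\<lambda>r l. star \<theta> (lpart l a) (map_part r ?u a'))" for a a'
  proof (rule leibniz_from_graded [OF u])
    fix a a' l p l' p' assume a: "a \<in> graded l p" and a': "a' \<in> graded l' p'"
    note Xa = homogeneousD(2) [OF hX a] and Xa' = homogeneousD(2) [OF hX a']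
    have "?u (star \<theta> a a') = (phase \<theta> (wedge p p' - wedge l l') * phase \<theta> (- wedge r (l + l'))) *\<^sub>C (X a * a' + a * X a')"
      by (simp add: star_graded [OF a a'] clinearD [OF u] twist_D_homogeneous [OF hX graded_mult [OF a a']]
          ring_derivation.mult [OF gauge_derivationD(1) [OF X]])
    also have "\<dots> = (phase \<theta> (- wedge r l) * phase \<theta> (wedge p p' - wedge (l + r) l')) *\<^sub>C (X a * a')
       + (phase \<theta> (- 2 * wedge r l) * (phase \<theta> (- wedge r l') * phase \<theta> (wedge p p' - wedge l (l' + r)))) *\<^sub>C (a * X a')"
    proof -
      have "phase \<theta> (wedge p p' - wedge l l') * phase \<theta> (- wedge r (l + l'))
          = phase \<theta> (- wedge r l) * phase \<theta> (wedge p p' - wedge (l + r) l')"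
        unfolding phase_add [symmetric] by (rule arg_cong [of _ _ "phase \<theta>"]) simp
      moreover have "phase \<theta> (wedge p p' - wedge l l') * phase \<theta> (- wedge r (l + l'))
          = phase \<theta> (- 2 * wedge r l) * (phase \<theta> (- wedge r l') * phase \<theta> (wedge p p' - wedge l (l' + r)))"
        unfolding phase_add [symmetric] by (rule arg_cong [of _ _ "phase \<theta>"]) (simp add: wedge_swap [of l r])
      ultimately show ?thesis by (simp only: scaleC_add_right)
    qed
    also have "(phase \<theta> (- wedge r l) * phase \<theta> (wedge p p' - wedge (l + r) l')) *\<^sub>C (X a * a') = star \<theta> (?u a) a'"
      by (simp add: twist_D_homogeneous [OF hX a] star_linear star_graded [OF Xa a'])
    also have "(phase \<theta> (- 2 * wedge r l) * (phase \<theta> (- wedge r l') * phase \<theta> (wedge p p' - wedge l (l' + r)))) *\<^sub>C (a * X a')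
      = phase \<theta> (- 2 * wedge r l) *\<^sub>C star \<theta> a (?u a')"
      by (simp add: twist_D_homogeneous [OF hX a'] star_linear star_graded [OF a Xa'] mult.assoc)
    finally show "?u (star \<theta> a a') = star \<theta> (?u a) a' + exp_wedge (- 2 * \<theta>) (\<lambda>r l. star \<theta> (lpart l a) (map_part r ?u a'))"
      unfolding braid_homogeneous [OF hu a] .
  qed
  moreover have "?u b = 0" if b: "b \<in> sphere_alg \<theta>" for b
  proof -
    have "b \<in> {x. ?u x = 0}"
    proof (rule lpart_closed)
      fix m
      show "lpart m b \<in> {x. ?u x = 0}"
        using gauge_derivationD(5) [OF X sphere_closed(5) [OF b]] twist_D_homogeneous [OF hX sphere_right_weight [OF b]] by simp
    qed (simp_all add: clinearD [OF u])
    then show ?thesis by simp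
  qed
  ultimately show ?thesis unfolding aut_def using u eq equivariant_iff [OF u] by blast
qed

lemma map_part_add:
  assumes "clinear u" "clinear v"
  shows "map_part r (\<lambda>a. u a + v a) a = map_part r u a + map_part r v a"
proof (rule clinear_eqI_graded [of "map_part r (\<lambda>a. u a + v a)" "\<lambda>a. map_part r u a + map_part r v a"])
  fix l p a assume a: "a \<in> graded l p"
  show "map_part r (\<lambda>a. u a + v a) a = map_part r u a + map_part r v a"
    by (simp add: map_part_graded [OF _ a] assms clinear_add_comp clinearD [OF clinear_lpart])
qed (intro clinear_map_part clinear_add_comp assms)+

lemma aut_add:
  assumes "u \<in> aut \<theta>" "v \<in> aut \<theta>" shows "(\<lambda>a. u a + v a) \<in> aut \<theta>"
proof -
  have u: "clinear u" "equivariant u" and v: "clinear v" "equivariant v"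
    using assms equivariant_iff [of u \<theta>] equivariant_iff [of v \<theta>] unfolding aut_def by blast+
  have c: "clinear (\<lambda>a. u a + v a)" by (intro clinear_add_comp u v)
  have "u (star \<theta> a a') + v (star \<theta> a a') = star \<theta> (u a + v a) a'
      + exp_wedge (- 2 * \<theta>) (\<lambda>r l. star \<theta> (lpart l a) (map_part r (\<lambda>a. u a + v a) a'))" for a a'
  proof -
    have e: "exp_wedge (- 2 * \<theta>) (\<lambda>r l. star \<theta> (lpart l a) (map_part r (\<lambda>a. u a + v a) a'))
        = exp_wedge (- 2 * \<theta>) (\<lambda>r l. star \<theta> (lpart l a) (map_part r u a'))
        + exp_wedge (- 2 * \<theta>) (\<lambda>r l. star \<theta> (lpart l a) (map_part r v a'))"
      unfolding map_part_add [OF u(1) v(1)] star_linear(1)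
      by (rule exp_wedge_add [OF finite_braid_support [OF u(1)] finite_braid_support [OF v(1)]])
    have uv: "u (star \<theta> a a') = star \<theta> (u a) a' + exp_wedge (- 2 * \<theta>) (\<lambda>r l. star \<theta> (lpart l a) (map_part r u a'))"
      "v (star \<theta> a a') = star \<theta> (v a) a' + exp_wedge (- 2 * \<theta>) (\<lambda>r l. star \<theta> (lpart l a) (map_part r v a'))"
      using assms unfolding aut_def by blast+
    show ?thesis unfolding e uv clinearD(1) [OF clinear_star(2)] by (simp only: add.assoc add.left_commute)
  qed
  moreover have "u b + v b = 0" if "b \<in> sphere_alg \<theta>" for b
    using assms that unfolding aut_def by simp
  ultimately show ?thesis
    unfolding aut_def using c equivariant_add [OF u(1) v(1) u(2) v(2)] equivariant_iff [OF c] by blast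
qed

lemma gauge_derivation_zero: "gauge_derivation 0 (\<lambda>a. 0)"
  using gauge_derivation_times [OF gauge_derivation_K sphere_closed(1) graded_zero, of 1 "0"] by simp

text \<open>Finite sums of twists of homogeneous gauge derivations. This description of \<open>aut\<close> (\<open>aut_eq_twisted_sums\<close>) makes induction
over homogeneous summands possible.\<close>

inductive_set twisted_sums :: "real \<Rightarrow> (oso5 \<Rightarrow> oso5) set" for \<theta> :: real where
  zero: "(\<lambda>a. 0) \<in> twisted_sums \<theta>"
| step: "u \<in> twisted_sums \<theta> \<Longrightarrow> gauge_derivation r X \<Longrightarrow> (\<lambda>a. u a + twist_D \<theta> X a) \<in> twisted_sums \<theta>"

lemma twisted_sums_aut: "u \<in> twisted_sums \<theta> \<Longrightarrow> u \<in> aut \<theta>"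
proof (induction rule: twisted_sums.induct)
  case zero
  show ?case using twist_gauge_in_aut [OF gauge_derivation_zero, of \<theta>] by (simp add: twist_D_zero)
qed (intro aut_add twist_gauge_in_aut)

lemma twisted_sums_add:
  assumes "v \<in> twisted_sums \<theta>" "u \<in> twisted_sums \<theta>"
  shows "(\<lambda>a. u a + v a) \<in> twisted_sums \<theta>"
  using assms(1)
proof (induction rule: twisted_sums.induct)
  case zero
  show ?case using assms(2) by simp
next
  case (step v r X)
  from twisted_sums.step [OF step.IH step.hyps(2)] show ?case by (simp add: add.assoc)
qed

lemma twist_in_twisted_sums: "gauge_derivation r X \<Longrightarrow> twist_D \<theta> X \<in> twisted_sums \<theta>"
  using twisted_sums.step [OF twisted_sums.zero, of r X \<theta>] by simp

text \<open>For homogeneous \<open>b\<close>, twisting \<open>b * X\<close> and letting \<open>b\<close> act on the twist of \<open>X\<close> differ by a scalar, which is absorbed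
in \<open>b\<close>. Here it matters that \<open>b\<close> has right weight zero.\<close>

lemma act_twist:
  assumes b: "b \<in> graded k 0" and X: "homogeneous r X"
  shows "act \<theta> b (twist_D \<theta> X) = twist_D \<theta> (\<lambda>a. (phase \<theta> (- wedge k r) *\<^sub>C b) * X a)"
proof
  fix a
  have h: "homogeneous (k + r) (\<lambda>a. (phase \<theta> (- wedge k r) *\<^sub>C b) * X a)"
    by (rule homogeneous_times [OF X graded_scaleC [OF b]])
  note L = clinearD [OF homogeneousD(1) [OF homogeneous_twist_D [OF X, of \<theta>]]]
  show "act \<theta> b (twist_D \<theta> X) a = twist_D \<theta> (\<lambda>a. (phase \<theta> (- wedge k r) *\<^sub>C b) * X a) a"
  proof (rule clinear_eqI_graded [of "act \<theta> b (twist_D \<theta> X)" "twist_D \<theta> (\<lambda>a. (phase \<theta> (- wedge k r) *\<^sub>C b) * X a)"])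
    show "clinear (act \<theta> b (twist_D \<theta> X))"
      by (rule clinearI) (simp_all add: act_def star_linear L)
    show "clinear (twist_D \<theta> (\<lambda>a. (phase \<theta> (- wedge k r) *\<^sub>C b) * X a))"
      by (rule homogeneousD(1) [OF homogeneous_twist_D [OF h]])
    fix l p a assume a: "a \<in> graded l p"
    have e: "phase \<theta> (- wedge r l) * phase \<theta> (wedge 0 p - wedge k (l + r)) = phase \<theta> (- wedge (k + r) l) * phase \<theta> (- wedge k r)"
      unfolding phase_add [symmetric] by (rule arg_cong [of _ _ "phase \<theta>"]) simp
    have "act \<theta> b (twist_D \<theta> X) a = (phase \<theta> (- wedge r l) * phase \<theta> (wedge 0 p - wedge k (l + r))) *\<^sub>C (b * X a)"
      by (simp add: act_def twist_D_homogeneous [OF X a] star_linear star_graded [OF b homogeneousD(2) [OF X a]])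
    also have "\<dots> = twist_D \<theta> (\<lambda>a. (phase \<theta> (- wedge k r) *\<^sub>C b) * X a) a"
      unfolding e twist_D_homogeneous [OF h a] by simp
    finally show "act \<theta> b (twist_D \<theta> X) a = twist_D \<theta> (\<lambda>a. (phase \<theta> (- wedge k r) *\<^sub>C b) * X a) a" .
  qed
qed

lemma twist_D_times:
  assumes b: "b \<in> graded k 0" and X: "homogeneous r X"
  shows "twist_D \<theta> (\<lambda>a. b * X a) = act \<theta> (phase \<theta> (wedge k r) *\<^sub>C b) (twist_D \<theta> X)"
  unfolding act_twist [OF graded_scaleC [OF b] X] by (simp add: phase_simps)

lemma twisted_sums_act:
  assumes "b \<in> sphere_alg \<theta>" "u \<in> twisted_sums \<theta>"
  shows "act \<theta> b u \<in> twisted_sums \<theta>"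
proof -
  have "act \<theta> c u \<in> twisted_sums \<theta>" if c: "c \<in> sphere_alg \<theta>" "c \<in> graded k 0" for c k
    using assms(2)
  proof (induction rule: twisted_sums.induct)
    case zero
    have "act \<theta> c (\<lambda>a. 0) = (\<lambda>a. 0)" by (simp add: act_def fun_eq_iff star_linear)
    then show ?case using twisted_sums.zero by simp
  next
    case (step u r X)
    have "act \<theta> c (\<lambda>a. u a + twist_D \<theta> X a) = (\<lambda>a. act \<theta> c u a + act \<theta> c (twist_D \<theta> X) a)"
      by (simp add: act_def fun_eq_iff star_linear)
    moreover have "act \<theta> c (twist_D \<theta> X) \<in> twisted_sums \<theta>"
      unfolding act_twist [OF c(2) gauge_derivationD(2) [OF step.hyps(2)]]
      by (rule twist_in_twisted_sums [OF gauge_derivation_times [OF step.hyps(2) sphere_closed(4) [OF c(1)] graded_scaleC [OF c(2)]]])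
    ultimately show ?case using twisted_sums_add step.IH by simp
  qed
  note hom = this
  have "b \<in> {x. act \<theta> x u \<in> twisted_sums \<theta>}"
  proof (rule lpart_closed)
    show "lpart m b \<in> {x. act \<theta> x u \<in> twisted_sums \<theta>}" for m
      using hom [OF sphere_closed(5) [OF assms(1)] sphere_right_weight [OF assms(1)]] by simp
    have "act \<theta> 0 u = (\<lambda>a. 0)" by (simp add: act_def fun_eq_iff star_linear)
    then show "0 \<in> {x. act \<theta> x u \<in> twisted_sums \<theta>}" using twisted_sums.zero by simp
    fix x y assume "x \<in> {x. act \<theta> x u \<in> twisted_sums \<theta>}" "y \<in> {x. act \<theta> x u \<in> twisted_sums \<theta>}"
    moreover have "act \<theta> (x + y) u = (\<lambda>a. act \<theta> x u a + act \<theta> y u a)" by (simp add: act_def fun_eq_iff star_linear)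
    ultimately show "x + y \<in> {x. act \<theta> x u \<in> twisted_sums \<theta>}" using twisted_sums_add by simp
  qed
  then show ?thesis by simp
qed

section \<open>From braided to ordinary derivations\<close>

lemma lpart_star_right:
  assumes a: "a \<in> graded l p" shows "lpart (l + m) (star \<theta> a x) = star \<theta> a (lpart m x)"
proof (rule clinear_eqI_graded [of "\<lambda>x. lpart (l + m) (star \<theta> a x)" "\<lambda>x. star \<theta> a (lpart m x)"])
  show "clinear (\<lambda>x. lpart (l + m) (star \<theta> a x))" "clinear (\<lambda>x. star \<theta> a (lpart m x))"
    by (rule clinearI; simp add: star_linear clinearD [OF clinear_lpart])+
  fix l' p' x assume x: "x \<in> graded l' p'"
  show "lpart (l + m) (star \<theta> a x) = star \<theta> a (lpart m x)"
    by (simp add: lpart_graded [OF star_in_graded [OF a x]] lpart_graded [OF x] star_linear)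
qed

lemma lpart_star_left:
  assumes a: "a \<in> graded l p" shows "lpart (m + l) (star \<theta> x a) = star \<theta> (lpart m x) a"
proof (rule clinear_eqI_graded [of "\<lambda>x. lpart (m + l) (star \<theta> x a)" "\<lambda>x. star \<theta> (lpart m x) a"])
  show "clinear (\<lambda>x. lpart (m + l) (star \<theta> x a))" "clinear (\<lambda>x. star \<theta> (lpart m x) a)"
    by (rule clinearI; simp add: star_linear clinearD [OF clinear_lpart])+
  fix l' p' x assume x: "x \<in> graded l' p'"
  show "lpart (m + l) (star \<theta> x a) = star \<theta> (lpart m x) a"
    by (simp add: lpart_graded [OF star_in_graded [OF x a]] lpart_graded [OF x] star_linear)
qed

lemma lpart_times_right:
  assumes "a \<in> graded l p" shows "lpart (l + m) (a * x) = a * lpart m x"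
proof (rule clinear_eqI_graded [of "\<lambda>x. lpart (l + m) (a * x)" "\<lambda>x. a * lpart m x"])
  show "clinear (\<lambda>x. lpart (l + m) (a * x))" "clinear (\<lambda>x. a * lpart m x)"
    by (rule clinearI; simp add: distrib_left clinearD [OF clinear_lpart])+
  fix l' p' x assume x: "x \<in> graded l' p'"
  show "lpart (l + m) (a * x) = a * lpart m x"
    by (simp add: lpart_graded [OF graded_mult [OF assms x]] lpart_graded [OF x])
qed

context
  fixes \<theta> :: real and u :: "oso5 \<Rightarrow> oso5"
  assumes u_aut: "u \<in> aut \<theta>"
begin

lemma aut_clinear: "clinear u"
  using u_aut unfolding aut_def by blast

lemma aut_equivariant: "equivariant u"
  using u_aut equivariant_iff [OF aut_clinear] unfolding aut_def by blast

lemma aut_leibniz: "u (star \<theta> a a') = star \<theta> (u a) a' + exp_wedge (- 2 * \<theta>) (\<lambda>r l. star \<theta> (lpart l a) (map_part r u a'))"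
  using u_aut unfolding aut_def by blast

lemma aut_sphere: "b \<in> sphere_alg \<theta> \<Longrightarrow> u b = 0"
  using u_aut unfolding aut_def by blast

lemma lpart_untwist: "a \<in> graded l p \<Longrightarrow> lpart (q + l) (twist_D (- \<theta>) u a) = phase \<theta> (wedge q l) *\<^sub>C lpart (q + l) (u a)"
  by (simp add: lpart_twist_D [OF aut_clinear] phase_simps)

text \<open>The braided Leibniz rule for the component of \<open>u\<close> of weight \<open>q\<close>: the rule holds for each component separately because the
components raise the left weight by different amounts.\<close>

lemma aut_leibniz_component:
  assumes a: "a \<in> graded l p" and a': "a' \<in> graded l' p'"
  shows "lpart (q + l + l') (u (star \<theta> a a')) = star \<theta> (lpart (q + l) (u a)) a'
     + phase \<theta> (- 2 * wedge q l) *\<^sub>C star \<theta> a (lpart (q + l') (u a'))"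
proof -
  have "lpart (q + l + l') (exp_wedge (- 2 * \<theta>) (\<lambda>r l. star \<theta> (lpart l a) (map_part r u a')))
      = exp_wedge (- 2 * \<theta>) (\<lambda>r k. lpart (q + l + l') (star \<theta> (lpart k a) (map_part r u a')))"
    by (rule exp_wedge_image [OF clinear_lpart finite_braid_support [OF aut_clinear]])
  also have "\<dots> = phase (- 2 * \<theta>) (wedge q l) *\<^sub>C lpart (q + l + l') (star \<theta> (lpart l a) (map_part q u a'))"
  proof (rule exp_wedge_single)
    fix r k assume rk: "(r, k) \<noteq> (q, l)"
    show "lpart (q + l + l') (star \<theta> (lpart k a) (map_part r u a')) = 0"
    proof (cases "k = l")
      case True
      then have "q + l' \<noteq> l' + r" using rk by (simp add: add.commute)
      then have "lpart (q + l') (map_part r u a') = 0"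
        by (simp add: map_part_graded [OF aut_clinear a'] lpart_lpart)
      then show ?thesis
        using lpart_star_right [OF a, of "q + l'" \<theta> "map_part r u a'"] True
        by (simp add: lpart_graded [OF a] star_linear ac_simps)
    qed (simp add: lpart_graded [OF a] star_linear clinearD [OF clinear_lpart])
  qed
  also have "lpart (q + l + l') (star \<theta> (lpart l a) (map_part q u a')) = star \<theta> a (lpart (q + l') (u a'))"
    using lpart_star_right [OF a, of "q + l'" \<theta> "map_part q u a'"]
    by (simp add: lpart_graded [OF a] map_part_graded [OF aut_clinear a'] lpart_lpart ac_simps)
  finally show ?thesis
    using lpart_star_left [OF a', of "q + l" \<theta> "u a"]
    by (simp add: aut_leibniz clinearD [OF clinear_lpart] phase_double_time)
qed

text \<open>The inverse twist cancels the braiding component by component; the right weights drop out because \<open>u\<close> preserves them.\<close>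

lemma untwist_mult_graded:
  assumes a: "a \<in> graded l p" and a': "a' \<in> graded l' p'"
  shows "twist_D (- \<theta>) u (a * a') = twist_D (- \<theta>) u a * a' + a * twist_D (- \<theta>) u a'"
proof (rule lpart_eqI)
  fix m
  \<comment> \<open>the component of \<open>u\<close> that contributes to left weight \<open>m\<close> of the product\<close>
  define q where "q = m - l - l'"
  have m: "m = q + (l + l')" by (simp add: q_def)
  let ?A = "lpart (q + l) (u a)" and ?A' = "lpart (q + l') (u a')"
  have A: "?A \<in> graded (q + l) p" by (rule equivariant_right_weight [OF aut_clinear aut_equivariant a])
  have A': "?A' \<in> graded (q + l') p'" by (rule equivariant_right_weight [OF aut_clinear aut_equivariant a'])
  have "lpart m (u (a * a')) = phase \<theta> (wedge l l' - wedge p p') *\<^sub>C lpart (q + l + l') (u (star \<theta> a a'))"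
    unfolding times_graded_star [OF a a', of \<theta>] m
    by (simp add: clinearD [OF aut_clinear] clinearD [OF clinear_lpart] add.assoc)
  also have "\<dots> = (phase \<theta> (wedge l l' - wedge p p') * phase \<theta> (wedge p p' - wedge (q + l) l')) *\<^sub>C (?A * a')
      + (phase \<theta> (wedge l l' - wedge p p') * (phase \<theta> (- 2 * wedge q l) * phase \<theta> (wedge p p' - wedge l (q + l')))) *\<^sub>C (a * ?A')"
    unfolding aut_leibniz_component [OF a a'] star_graded [OF A a'] star_graded [OF a A'] scaleC_add_right
    by (simp add: mult.assoc)
  finally have u: "lpart m (u (a * a')) = \<dots>" .
  have e1: "phase \<theta> (wedge q (l + l')) * (phase \<theta> (wedge l l' - wedge p p') * phase \<theta> (wedge p p' - wedge (q + l) l')) = phase \<theta> (wedge q l)"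
    unfolding phase_add [symmetric] by (rule arg_cong [of _ _ "phase \<theta>"]) simp
  have e2: "phase \<theta> (wedge q (l + l')) * (phase \<theta> (wedge l l' - wedge p p') *
      (phase \<theta> (- 2 * wedge q l) * phase \<theta> (wedge p p' - wedge l (q + l')))) = phase \<theta> (wedge q l')"
    unfolding phase_add [symmetric] by (rule arg_cong [of _ _ "phase \<theta>"]) (simp add: wedge_swap [of l q])
  have "lpart m (twist_D (- \<theta>) u (a * a')) = phase \<theta> (wedge q (l + l')) *\<^sub>C lpart m (u (a * a'))"
    unfolding m by (rule lpart_untwist [OF graded_mult [OF a a']])
  also have "\<dots> = phase \<theta> (wedge q l) *\<^sub>C (?A * a') + phase \<theta> (wedge q l') *\<^sub>C (a * ?A')"
    unfolding u scaleC_add_right scaleC_scaleC e1 e2 ..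
  also have "\<dots> = lpart (q + l) (twist_D (- \<theta>) u a) * a' + a * lpart (q + l') (twist_D (- \<theta>) u a')"
    by (simp add: lpart_untwist [OF a] lpart_untwist [OF a'])
  also have "\<dots> = lpart m (twist_D (- \<theta>) u a * a' + a * twist_D (- \<theta>) u a')"
    using lpart_times_right [OF a', of "q + l" "twist_D (- \<theta>) u a"] lpart_times_right [OF a, of "q + l'" "twist_D (- \<theta>) u a'"]
    unfolding m clinearD(1) [OF clinear_lpart] by (simp add: ac_simps)
  finally show "lpart m (twist_D (- \<theta>) u (a * a')) = lpart m (twist_D (- \<theta>) u a * a' + a * twist_D (- \<theta>) u a')" .
qed

lemma clinear_untwist: "clinear (twist_D (- \<theta>) u)"
  by (rule clinear_twist_D [OF aut_clinear])

lemma ring_derivation_untwist: "ring_derivation (twist_D (- \<theta>) u)"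
proof
  note D = clinearD [OF clinear_untwist]
  fix x y
  show "twist_D (- \<theta>) u (x + y) = twist_D (- \<theta>) u x + twist_D (- \<theta>) u y" by (rule D)
  have 1: "twist_D (- \<theta>) u (x * y) = twist_D (- \<theta>) u x * y + x * twist_D (- \<theta>) u y" if x: "x \<in> graded l p" for x l p
    by (induction y rule: graded_induct) (simp_all add: D(1,3) distrib_left untwist_mult_graded [OF x])
  show "twist_D (- \<theta>) u (x * y) = twist_D (- \<theta>) u x * y + x * twist_D (- \<theta>) u y"
    by (induction x rule: graded_induct) (simp_all add: D(1,3) distrib_right 1)
qed

text \<open>On a single left weight space the inverse twist is a composition with a scaling operator. All entries of one row of \<open>N\<close>
lie in one such space, so equivariance is inherited on the generators (\<open>untwist_equivariant_gen\<close>), which is all that the coefficients depend on.\<close>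

lemma untwist_eq_grade_scale:
  assumes "a \<in> graded l p"
  shows "twist_D (- \<theta>) u a = grade_scale (\<lambda>m. phase \<theta> (wedge (m - l) l)) (u a)"
  by (rule lpart_eqI) (simp add: lpart_twist_D [OF aut_clinear assms] lpart_grade_scale phase_simps)

lemma untwist_last_column: "twist_D (- \<theta>) u (gen_n J 5) = 0"
  unfolding untwist_eq_grade_scale [OF graded_gen_n] aut_sphere [OF sphere_gen] by (rule clinearD [OF clinear_grade_scale])

lemma untwist_equivariant_gen:
  "coproduct (twist_D (- \<theta>) u (gen_n J K)) \<doteq> (\<Sum>L\<in>UNIV. twist_D (- \<theta>) u (gen_n J L) \<otimes>\<^sub>C gen_n L K)"
proof -
  define F where "F = grade_scale (\<lambda>m. phase \<theta> (wedge (m - eps J) (eps J)))"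
  have F: "clinear F" "equivariant F" unfolding F_def by (rule clinear_grade_scale equivariant_grade_scale)+
  have X: "twist_D (- \<theta>) u (gen_n J L) = F (u (gen_n J L))" for L
    unfolding F_def by (rule untwist_eq_grade_scale [OF graded_gen_n])
  have c: "clinear (\<lambda>a. F (u a))" by (rule clinearI) (simp_all add: clinearD [OF F(1)] clinearD [OF aut_clinear])
  have "equivariant (\<lambda>a. F (u a))" by (rule equivariant_comp [OF F aut_clinear aut_equivariant])
  then have "coproduct (F (u (gen_n J K))) \<doteq> tensor_map (\<lambda>a. F (u a)) id (coproduct (gen_n J K))"
    unfolding equivariant_def by (rule spec)
  also have "tensor_map (\<lambda>a. F (u a)) id (coproduct (gen_n J K)) = (\<Sum>L\<in>UNIV. F (u (gen_n J L)) \<otimes>\<^sub>C gen_n L K)"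
    unfolding coproduct_gen_n clinearD(6) [OF clinear_tensor_map [OF c clinear_id]] tensor_map_tensor [OF c clinear_id] by simp
  finally show ?thesis unfolding X .
qed

lemma koszul_coeff_untwist: "koszul_coeff (twist_D (- \<theta>) u) K I J \<in> sphere_alg \<theta>"
  unfolding koszul_coeff_def
  by (intro sphere_closed(2,3) sphere_gen left_coeff_sphere [OF ring_derivation_untwist clinear_untwist] untwist_equivariant_gen)

end

definition gauge_generators :: "(oso5 \<Rightarrow> oso5) set"
  where "gauge_generators = {K_op j | j. j \<in> {1, 2}} \<union> {W_op r | r. r \<in> roots}"

text \<open>The ten three-element subsets of the indices give the ten generators. Other index triples follow from
antisymmetry.\<close>

lemma vertical_multiple_of_generator: "\<exists>c g. g \<in> gauge_generators \<and> vertical K I J = (\<lambda>a. c *\<^sub>C g a)"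
proof -
  define Q where "Q K I J \<longleftrightarrow> (\<exists>c g. g \<in> gauge_generators \<and> vertical K I J = (\<lambda>a. c *\<^sub>C g a))" for K I J
  have base: "Q K I J" if "g \<in> gauge_generators" "\<And>a. g a = 2 *\<^sub>C vertical K I J a" for g K I J
    unfolding Q_def by (rule exI [of _ "1 / 2"], rule exI [of _ g]) (simp add: that fun_eq_iff)
  have G: "K_op 1 \<in> gauge_generators" "K_op 2 \<in> gauge_generators" "\<And>r. r \<in> roots \<Longrightarrow> W_op r \<in> gauge_generators"
    unfolding gauge_generators_def by blast+
  have W: "W_op (0, 1) \<in> gauge_generators" "W_op (0, - 1) \<in> gauge_generators" "W_op (1, 0) \<in> gauge_generators"
    "W_op (- 1, 0) \<in> gauge_generators" "W_op (1, 1) \<in> gauge_generators" "W_op (- 1, - 1) \<in> gauge_generators"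
    "W_op (1, - 1) \<in> gauge_generators" "W_op (- 1, 1) \<in> gauge_generators"
    by (rule G(3), simp add: roots_def)+
  have b: "Q 5 2 4" "Q 5 1 3" "Q 2 1 3" "Q 4 1 3" "Q 1 2 4" "Q 3 2 4" "Q 5 2 1" "Q 5 3 4" "Q 5 1 4" "Q 5 2 3"
    by (rule base [OF G(1) K_op_vertical(1)] base [OF G(2) K_op_vertical(2)] base [OF W(1) W_op_vertical(1)]
      base [OF W(2) W_op_vertical(2)] base [OF W(3) W_op_vertical(3)] base [OF W(4) W_op_vertical(4)]
      base [OF W(5) W_op_vertical(5)] base [OF W(6) W_op_vertical(6)] base [OF W(7) W_op_vertical(7)]
      base [OF W(8) W_op_vertical(8)])+
  have rot: "Q I J K" if "Q K I J" for K I J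
  proof -
    have "vertical I J K = vertical K I J" by (simp add: fun_eq_iff vertical_def ac_simps)
    then show ?thesis using that unfolding Q_def by simp
  qed
  have swap: "Q K J I" if q: "Q K I J" for K I J
  proof -
    obtain c g where g: "g \<in> gauge_generators" "vertical K I J = (\<lambda>a. c *\<^sub>C g a)" using q unfolding Q_def by blast
    have "vertical K J I a = - vertical K I J a" for a
      unfolding vertical_def right_inv_field_antisym [of I J] right_inv_field_antisym [of J K] right_inv_field_antisym [of K I] by simp
    then have "vertical K J I = (\<lambda>a. (- c) *\<^sub>C g a)" using g(2) by (simp add: fun_eq_iff)
    then show ?thesis unfolding Q_def using g(1) by blast
  qed
  have diag: "Q K I I" for K I
  proof -
    have "vertical K I I a = 0" for a
      unfolding vertical_def right_inv_field_antisym [of I K] by (simp add: right_inv_field_diag)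
    then show ?thesis unfolding Q_def using G(1) by (intro exI [of _ 0] exI [of _ "K_op 1"]) (simp add: fun_eq_iff)
  qed
  note r1 = b [THEN rot]
  note r2 = r1 [THEN rot]
  note s = b [THEN swap] r1 [THEN swap] r2 [THEN swap]
  have "Q K I J"
    using exhaust_5 [of K] exhaust_5 [of I] exhaust_5 [of J]
    by (elim disjE) (simp_all only: b r1 r2 s diag diag [THEN rot] diag [THEN rot, THEN rot])
  then show ?thesis unfolding Q_def .
qed

abbreviation (input) braided_module :: "real \<Rightarrow> (oso5 \<Rightarrow> oso5) set"
  where "braided_module \<theta> \<equiv> submodule_gen \<theta>
        ({twist_D \<theta> (K_op j) | j. j \<in> {1, 2}} \<union> {twist_D \<theta> (W_op r) | r. r \<in> roots})"

lemma generator_homogeneous: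
  assumes "g \<in> gauge_generators"
  obtains r where "homogeneous r g" "twist_D \<theta> g \<in> braided_module \<theta>"
  using assms gauge_derivationD(2) [OF gauge_derivation_K] gauge_derivationD(2) [OF gauge_derivation_W]
  unfolding gauge_generators_def by (blast intro: submodule_gen.base)

text \<open>The coefficient \<open>b\<close> is split into weight components, since the twist is compatible with multiplication by a homogeneous \<open>b\<close> only.\<close>

lemma twist_vertical_in_module:
  assumes b: "b \<in> sphere_alg \<theta>"
  shows "twist_D \<theta> (\<lambda>a. b * vertical K I J a) \<in> braided_module \<theta>"
proof -
  obtain c g where g: "g \<in> gauge_generators" "vertical K I J = (\<lambda>a. c *\<^sub>C g a)"
    using vertical_multiple_of_generator by blast
  obtain r where r: "homogeneous r g" "twist_D \<theta> g \<in> braided_module \<theta>" using g(1) by (rule generator_homogeneous)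
  note cg = clinear_times_comp [OF homogeneousD(1) [OF r(1)]]
  have v: "(\<lambda>a. b * vertical K I J a) = (\<lambda>a. (c *\<^sub>C b) * g a)" for b
    by (simp add: g(2) fun_eq_iff)
  have "b \<in> {x. twist_D \<theta> (\<lambda>a. (c *\<^sub>C x) * g a) \<in> braided_module \<theta>}"
  proof (rule lpart_closed)
    fix m
    have "twist_D \<theta> (\<lambda>a. (c *\<^sub>C lpart m b) * g a)
        = act \<theta> (phase \<theta> (wedge m r) *\<^sub>C c *\<^sub>C lpart m b) (twist_D \<theta> g)"
      by (rule twist_D_times [OF graded_scaleC [OF sphere_right_weight [OF b]] r(1)])
    also have "\<dots> \<in> braided_module \<theta>"
      by (intro submodule_gen.act sphere_closed(4,5) b r(2))
    finally show "lpart m b \<in> {x. twist_D \<theta> (\<lambda>a. (c *\<^sub>C x) * g a) \<in> braided_module \<theta>}" by simp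
  next
    show "0 \<in> {x. twist_D \<theta> (\<lambda>a. (c *\<^sub>C x) * g a) \<in> braided_module \<theta>}"
      using submodule_gen.zero by (simp add: twist_D_zero)
  next
    fix x y assume xy: "x \<in> {x. twist_D \<theta> (\<lambda>a. (c *\<^sub>C x) * g a) \<in> braided_module \<theta>}"
      "y \<in> {x. twist_D \<theta> (\<lambda>a. (c *\<^sub>C x) * g a) \<in> braided_module \<theta>}"
    have "twist_D \<theta> (\<lambda>a. (c *\<^sub>C (x + y)) * g a) = (\<lambda>a. twist_D \<theta> (\<lambda>a. (c *\<^sub>C x) * g a) a + twist_D \<theta> (\<lambda>a. (c *\<^sub>C y) * g a) a)"
      using twist_D_add [OF cg [of "c *\<^sub>C x"] cg [of "c *\<^sub>C y"], of \<theta>]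
      by (simp add: fun_eq_iff scaleC_add_right distrib_right)
    then show "x + y \<in> {x. twist_D \<theta> (\<lambda>a. (c *\<^sub>C x) * g a) \<in> braided_module \<theta>}"
      using submodule_gen.add xy by simp
  qed
  then show ?thesis unfolding v by simp
qed

lemma aut_subset_module: "aut \<theta> \<subseteq> braided_module \<theta>"
proof
  fix u assume u: "u \<in> aut \<theta>"
  let ?X = "twist_D (- \<theta>) u"
  define P where "P Y \<longleftrightarrow> clinear Y \<and> twist_D \<theta> Y \<in> braided_module \<theta>" for Y
  have P_sum: "P (\<lambda>a. \<Sum>k\<in>S. Y k a)" if "\<And>k. P (Y k)" for Y and S :: "5 set"
    using finite [of S]
  proof (induction S rule: finite_induct)
    case empty
    then show ?case unfolding P_def using submodule_gen.zero by (simp add: twist_D_zero clinearI)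
  next
    case (insert k S)
    have "twist_D \<theta> (\<lambda>a. Y k a + (\<Sum>k\<in>S. Y k a)) = (\<lambda>a. twist_D \<theta> (Y k) a + twist_D \<theta> (\<lambda>a. \<Sum>k\<in>S. Y k a) a)"
      using twist_D_add that insert.IH unfolding P_def by blast
    then show ?case using submodule_gen.add that [of k] insert unfolding P_def by (simp add: clinear_add_comp)
  qed
  have T: "(1 / 6) *\<^sub>C koszul_coeff ?X K I J \<in> sphere_alg \<theta>" for K I J
    by (rule sphere_closed(4) [OF koszul_coeff_untwist [OF u]])
  have "P (\<lambda>a. ((1 / 6) *\<^sub>C koszul_coeff ?X K I J) * vertical K I J a)" for K I J
    unfolding P_def using twist_vertical_in_module [OF T] clinear_times_comp [OF clinear_vertical] by blast
  then have "P (\<lambda>a. \<Sum>K\<in>UNIV. \<Sum>I\<in>UNIV. \<Sum>J\<in>UNIV. ((1 / 6) *\<^sub>C koszul_coeff ?X K I J) * vertical K I J a)"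
    by (intro P_sum)
  moreover have "(\<lambda>a. \<Sum>K\<in>UNIV. \<Sum>I\<in>UNIV. \<Sum>J\<in>UNIV. ((1 / 6) *\<^sub>C koszul_coeff ?X K I J) * vertical K I J a) = ?X"
  proof
    fix a
    show "(\<Sum>K\<in>UNIV. \<Sum>I\<in>UNIV. \<Sum>J\<in>UNIV. ((1 / 6) *\<^sub>C koszul_coeff ?X K I J) * vertical K I J a) = ?X a"
      unfolding koszul_expansion [OF ring_derivation_untwist [OF u] clinear_untwist [OF u] untwist_last_column [OF u], of a]
      by (simp add: cvec.scale_sum_right)
  qed
  ultimately have "twist_D \<theta> ?X \<in> braided_module \<theta>" unfolding P_def by simp
  moreover have "twist_D \<theta> ?X = u" by (rule ext) (rule twist_D_inverse [OF aut_clinear [OF u]])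
  ultimately show "u \<in> braided_module \<theta>" by simp
qed

lemma module_subset_twisted_sums: "braided_module \<theta> \<subseteq> twisted_sums \<theta>"
proof
  fix u assume "u \<in> braided_module \<theta>"
  then show "u \<in> twisted_sums \<theta>"
  proof (induction rule: submodule_gen.induct)
    case (base u)
    then show ?case using twist_in_twisted_sums gauge_derivation_K gauge_derivation_W by blast
  qed (auto intro: twisted_sums.zero twisted_sums_add twisted_sums_act)
qed

lemma aut_eq_twisted_sums: "aut \<theta> = twisted_sums \<theta>"
  using aut_subset_module [of \<theta>] module_subset_twisted_sums [of \<theta>] twisted_sums_aut [of _ \<theta>] by blast

lemma aut_eq_module: "aut \<theta> = braided_module \<theta>"
  using aut_subset_module [of \<theta>] module_subset_twisted_sums [of \<theta>] twisted_sums_aut [of _ \<theta>] by blast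

section \<open>The braided bracket\<close>

lemma finite_bracket_support:
  assumes "clinear u" "clinear v"
  shows "finite {(r, s). map_part s v (map_part r u a) \<noteq> 0}"
proof -
  have "{(r, s). map_part s v (map_part r u a) \<noteq> 0}
      \<subseteq> (\<Union>r\<in>{r. map_part r u a \<noteq> 0}. {r} \<times> {s. map_part s v (map_part r u a) \<noteq> 0})"
    using clinearD(3) [OF clinear_map_part [OF assms(2)]] by force
  then show ?thesis
    by (rule finite_subset) (intro finite_UN_I finite_cartesian_product finite_map_part assms, simp)
qed

lemma braided_bracket_add_left:
  assumes "clinear u" "clinear v" "clinear w"
  shows "braided_bracket \<theta> (\<lambda>a. u a + v a) w a = braided_bracket \<theta> u w a + braided_bracket \<theta> v w a"
proof -
  have "exp_wedge (- 2 * \<theta>) (\<lambda>r s. map_part s w (map_part r (\<lambda>a. u a + v a) a))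
      = exp_wedge (- 2 * \<theta>) (\<lambda>r s. map_part s w (map_part r u a)) + exp_wedge (- 2 * \<theta>) (\<lambda>r s. map_part s w (map_part r v a))"
    unfolding map_part_add [OF assms(1,2)] clinearD(1) [OF clinear_map_part [OF assms(3)]]
    by (rule exp_wedge_add [OF finite_bracket_support finite_bracket_support]; rule assms)
  then show ?thesis unfolding braided_bracket_def by simp
qed

lemma braided_bracket_add_right:
  assumes "clinear u" "clinear v" "clinear w"
  shows "braided_bracket \<theta> w (\<lambda>a. u a + v a) a = braided_bracket \<theta> w u a + braided_bracket \<theta> w v a"
proof -
  have "exp_wedge (- 2 * \<theta>) (\<lambda>r s. map_part s (\<lambda>a. u a + v a) (map_part r w a))
      = exp_wedge (- 2 * \<theta>) (\<lambda>r s. map_part s u (map_part r w a)) + exp_wedge (- 2 * \<theta>) (\<lambda>r s. map_part s v (map_part r w a))"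
    unfolding map_part_add [OF assms(1,2)]
    by (rule exp_wedge_add [OF finite_bracket_support finite_bracket_support]; rule assms)
  then show ?thesis unfolding braided_bracket_def by (simp add: clinearD [OF assms(3)])
qed

lemma map_part_zero_map: "map_part r (\<lambda>a. 0) = (\<lambda>a. 0)"
  by (rule ext) (simp add: map_part_def clinearD [OF clinear_lpart])

lemma exp_wedge_zero: "exp_wedge t (\<lambda>r s. 0) = 0"
  by (simp add: exp_wedge_def)

lemma braided_bracket_zero:
  assumes "clinear w"
  shows "braided_bracket \<theta> (\<lambda>a. 0) w a = 0" "braided_bracket \<theta> w (\<lambda>a. 0) a = 0"
  unfolding braided_bracket_def map_part_zero_map
  by (simp_all add: clinearD(3) [OF clinear_map_part [OF assms]] exp_wedge_zero clinearD [OF assms])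

lemma clinear_act: "clinear u \<Longrightarrow> clinear (act \<theta> b u)"
  by (rule clinearI) (simp_all add: act_def star_linear clinearD)

lemma act_add: "act \<theta> (x + y) u = (\<lambda>a. act \<theta> x u a + act \<theta> y u a)" "act \<theta> b (\<lambda>a. u a + v a) = (\<lambda>a. act \<theta> b u a + act \<theta> b v a)"
  "act \<theta> 0 u = (\<lambda>a. 0)" "act \<theta> b (\<lambda>a. 0) = (\<lambda>a. 0)"
  by (simp_all add: act_def fun_eq_iff star_linear)

text \<open>The right-hand side of the formula for the bracket of \<open>b \<bullet> X\<close> and \<open>b' \<bullet> X'\<close>.\<close>

definition scaled_bracket :: "real \<Rightarrow> oso5 \<Rightarrow> oso5 \<Rightarrow> (oso5 \<Rightarrow> oso5) \<Rightarrow> (oso5 \<Rightarrow> oso5) \<Rightarrow> oso5 \<Rightarrow> oso5"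
  where "scaled_bracket \<theta> b b' X X' a = exp_wedge (- 2 * \<theta>) (\<lambda>r l.
               act \<theta> (star \<theta> b (lpart l b')) (braided_bracket \<theta> (map_part r X) X') a)"

lemma twisted_sums_clinear: "u \<in> twisted_sums \<theta> \<Longrightarrow> clinear u"
  using twisted_sums_aut aut_clinear by blast

lemma twisted_sums_finite: "u \<in> twisted_sums \<theta> \<Longrightarrow> finite {r. map_part r u \<noteq> (\<lambda>a. 0)}"
proof (induction rule: twisted_sums.induct)
  case zero
  show ?case by (simp add: map_part_zero_map)
next
  case (step u r X)
  note h = homogeneous_twist_D [OF gauge_derivationD(2) [OF step.hyps(2)], of \<theta>]
  have "{s. map_part s (\<lambda>a. u a + twist_D \<theta> X a) \<noteq> (\<lambda>a. 0)} \<subseteq> {s. map_part s u \<noteq> (\<lambda>a. 0)} \<union> {r}"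
    using map_part_add [OF twisted_sums_clinear [OF step.hyps(1)] homogeneousD(1) [OF h]]
    by (auto simp: map_part_homogeneous [OF h] fun_eq_iff)
  then show ?case using step.IH by (meson finite_UnI finite.emptyI finite.insertI finite_subset)
qed

lemma finite_scaled_support:
  assumes "X \<in> twisted_sums \<theta>" "clinear X'"
  shows "finite {(r, l). act \<theta> (star \<theta> b (lpart l b')) (braided_bracket \<theta> (map_part r X) X') a \<noteq> 0}"
proof (rule finite_support_prod [OF twisted_sums_finite [OF assms(1)] lpart_sum(1) [of b']])
  fix r l assume "act \<theta> (star \<theta> b (lpart l b')) (braided_bracket \<theta> (map_part r X) X') a \<noteq> 0"
  then have "lpart l b' \<noteq> 0" "map_part r X \<noteq> (\<lambda>a. 0)"
    by (auto simp: act_def star_linear braided_bracket_zero(1) [OF assms(2)])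
  then show "r \<in> {r. map_part r X \<noteq> (\<lambda>a. 0)} \<and> l \<in> {l. lpart l b' \<noteq> 0}" by blast
qed

text \<open>The operator \<open>u\<close> passes \<open>b'\<close> at the cost of a braiding phase and without a derivative term, as it annihilates \<open>b'\<close>;
likewise \<open>v\<close> passes \<open>b\<close>. Interchanging \<open>b\<close> and \<open>b'\<close> costs a further phase, and the three phases combine with the one in the
bracket of \<open>b \<bullet> u\<close> and \<open>b' \<bullet> v\<close> to that in the bracket of \<open>u\<close> and \<open>v\<close>.\<close>

lemma bracket_act_homogeneous:
  assumes X: "gauge_derivation r X" and Y: "gauge_derivation s Y"
    and b: "b \<in> sphere_alg \<theta>" "b \<in> graded k 0" and b': "b' \<in> sphere_alg \<theta>" "b' \<in> graded k' 0"
  shows "braided_bracket \<theta> (act \<theta> b (twist_D \<theta> X)) (act \<theta> b' (twist_D \<theta> Y)) a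
     = scaled_bracket \<theta> b b' (twist_D \<theta> X) (twist_D \<theta> Y) a"
proof -
  let ?u = "twist_D \<theta> X" and ?v = "twist_D \<theta> Y"
  note hu = homogeneous_twist_D [OF gauge_derivationD(2) [OF X], of \<theta>]
    and hv = homogeneous_twist_D [OF gauge_derivationD(2) [OF Y], of \<theta>]
  note au = twist_gauge_in_aut [OF X, of \<theta>] and av = twist_gauge_in_aut [OF Y, of \<theta>]
  have homogeneous_act: "homogeneous (k + r) (act \<theta> b u)" if u: "homogeneous r u" and b: "b \<in> graded k 0" for k r b u
    unfolding homogeneous_def act_def
  proof (intro conjI allI impI)
    show "clinear (\<lambda>a. star \<theta> b (u a))" by (rule clinearI) (simp_all add: star_linear clinearD [OF homogeneousD(1) [OF u]])
    fix l p a assume "a \<in> graded l p"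
    from star_in_graded [OF b homogeneousD(2) [OF u this], of \<theta>]
    show "star \<theta> b (u a) \<in> graded (l + (k + r)) p" by (simp add: ac_simps)
  qed
  have leib: "u (star \<theta> b c) = phase \<theta> (- 2 * wedge r k) *\<^sub>C star \<theta> b (u c)"
    if "u \<in> aut \<theta>" "homogeneous r u" "b \<in> sphere_alg \<theta>" "b \<in> graded k 0" for u r b c k
    unfolding aut_leibniz [OF that(1)] braid_homogeneous [OF that(2,4)] aut_sphere [OF that(1,3)] by (simp add: star_linear)
  \<comment> \<open>the coinvariants are braided commutative\<close>
  have comm: "star \<theta> b' b = phase \<theta> (- 2 * wedge k' k) *\<^sub>C star \<theta> b b'"
    unfolding star_graded [OF b(2) b'(2)] star_graded [OF b'(2) b(2)]
    by (simp add: phase_simps wedge_swap [of k k'] mult.commute)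
  have e: "phase \<theta> (- 2 * wedge (k + r) (k' + s)) * (phase \<theta> (- 2 * wedge s k) * phase \<theta> (- 2 * wedge k' k))
      = phase \<theta> (- 2 * wedge r k') * phase \<theta> (- 2 * wedge r s)"
    unfolding phase_add [symmetric]
    by (rule arg_cong [of _ _ "phase \<theta>"]) (simp add: wedge_swap [of k' k] wedge_swap [of s k])
  have "star \<theta> b' (star \<theta> b (?v (?u a))) = phase \<theta> (- 2 * wedge k' k) *\<^sub>C star \<theta> b (star \<theta> b' (?v (?u a)))"
    unfolding star_assoc [symmetric] comm by (simp add: star_linear)
  then have vu: "act \<theta> b' ?v (act \<theta> b ?u a) = (phase \<theta> (- 2 * wedge s k) * phase \<theta> (- 2 * wedge k' k)) *\<^sub>C star \<theta> b (star \<theta> b' (?v (?u a)))"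
    unfolding act_def leib [OF av hv b] by (simp add: star_linear)
  have "braided_bracket \<theta> (act \<theta> b ?u) (act \<theta> b' ?v) a
     = act \<theta> b ?u (act \<theta> b' ?v a) - phase \<theta> (- 2 * wedge (k + r) (k' + s)) *\<^sub>C act \<theta> b' ?v (act \<theta> b ?u a)"
    by (rule braided_bracket_homogeneous [OF homogeneous_act [OF hu b(2)] homogeneous_act [OF hv b'(2)]])
  also have "\<dots> = phase \<theta> (- 2 * wedge r k') *\<^sub>C star \<theta> b (star \<theta> b' (?u (?v a)))
     - (phase \<theta> (- 2 * wedge r k') * phase \<theta> (- 2 * wedge r s)) *\<^sub>C star \<theta> b (star \<theta> b' (?v (?u a)))"
    unfolding vu scaleC_scaleC e by (simp add: act_def leib [OF au hu b'] star_linear)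
  also have "\<dots> = phase \<theta> (- 2 * wedge r k') *\<^sub>C star \<theta> (star \<theta> b b') (braided_bracket \<theta> ?u ?v a)"
    unfolding braided_bracket_homogeneous [OF hu hv] star_assoc
    by (simp add: star_linear cvec.scale_right_diff_distrib)
  also have "\<dots> = scaled_bracket \<theta> b b' ?u ?v a"
  proof -
    have "scaled_bracket \<theta> b b' ?u ?v a = phase (- 2 * \<theta>) (wedge r k') *\<^sub>C
        act \<theta> (star \<theta> b (lpart k' b')) (braided_bracket \<theta> (map_part r ?u) ?v) a"
      unfolding scaled_bracket_def
    proof (rule exp_wedge_single)
      fix r' l assume "(r', l) \<noteq> (r, k')"
      then show "act \<theta> (star \<theta> b (lpart l b')) (braided_bracket \<theta> (map_part r' ?u) ?v) a = 0"
        by (cases "r' = r") (simp_all add: lpart_graded [OF b'(2)] map_part_homogeneous [OF hu] act_def star_linear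
            braided_bracket_zero(1) [OF homogeneousD(1) [OF hv]])
    qed
    then show ?thesis
      by (simp add: lpart_graded [OF b'(2)] map_part_homogeneous [OF hu] act_def phase_double_time)
  qed
  finally show ?thesis .
qed

text \<open>Both sides are additive in each of the four arguments, so the homogeneous case suffices.\<close>

lemma bracket_act:
  assumes X: "X \<in> twisted_sums \<theta>" and Y: "Y \<in> twisted_sums \<theta>"
    and b: "b \<in> sphere_alg \<theta>" and b': "b' \<in> sphere_alg \<theta>"
  shows "braided_bracket \<theta> (act \<theta> b X) (act \<theta> b' Y) a = scaled_bracket \<theta> b b' X Y a"
proof -
  note cl = twisted_sums_clinear
  note fin = finite_scaled_support
  have 1: "braided_bracket \<theta> (act \<theta> b (twist_D \<theta> X)) (act \<theta> b' Y) a = scaled_bracket \<theta> b b' (twist_D \<theta> X) Y a"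
    if X: "gauge_derivation r X" and b: "b \<in> sphere_alg \<theta>" "b \<in> graded k 0" and b': "b' \<in> sphere_alg \<theta>" "b' \<in> graded k' 0"
    for r X b b' k k'
    using Y
  proof (induction rule: twisted_sums.induct)
    case zero
    have c: "clinear (twist_D \<theta> X)" by (rule clinear_twist_D [OF gauge_derivationD(3) [OF X]])
    show ?case
      by (simp add: act_add braided_bracket_zero clinear_act clinear_map_part c scaled_bracket_def exp_wedge_zero)
         (simp add: act_def braided_bracket_zero clinear_map_part c star_linear exp_wedge_zero)
  next
    case (step Y s Z)
    have c: "clinear (twist_D \<theta> X)" "clinear (twist_D \<theta> Z)"
      by (rule clinear_twist_D [OF gauge_derivationD(3) [OF X]] clinear_twist_D [OF gauge_derivationD(3) [OF step.hyps(2)]])+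
    note cY = cl [OF step.hyps(1)]
    have "scaled_bracket \<theta> b b' (twist_D \<theta> X) (\<lambda>a. Y a + twist_D \<theta> Z a) a
        = scaled_bracket \<theta> b b' (twist_D \<theta> X) Y a + scaled_bracket \<theta> b b' (twist_D \<theta> X) (twist_D \<theta> Z) a"
      unfolding scaled_bracket_def
      by (subst exp_wedge_add [OF fin [OF twist_in_twisted_sums [OF X] cY] fin [OF twist_in_twisted_sums [OF X] c(2)], symmetric])
        (simp add: act_def star_linear braided_bracket_add_right cY c clinear_map_part)
    then show ?case
      by (simp add: act_add braided_bracket_add_right clinear_act c cY step.IH
        bracket_act_homogeneous [OF X step.hyps(2) b b'])
  qed
  have 2: "braided_bracket \<theta> (act \<theta> b X) (act \<theta> b' Y) a = scaled_bracket \<theta> b b' X Y a"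
    if b: "b \<in> sphere_alg \<theta>" "b \<in> graded k 0" and b': "b' \<in> sphere_alg \<theta>" "b' \<in> graded k' 0"
    for b b' k k'
    using X
  proof (induction rule: twisted_sums.induct)
    case zero
    show ?case
      by (simp add: act_add braided_bracket_zero clinear_act cl [OF Y] scaled_bracket_def map_part_zero_map)
         (simp add: act_def braided_bracket_zero cl [OF Y] star_linear exp_wedge_zero)
  next
    case (step X r Z)
    have c: "clinear (twist_D \<theta> Z)" by (rule clinear_twist_D [OF gauge_derivationD(3) [OF step.hyps(2)]])
    note cX = cl [OF step.hyps(1)]
    have mp: "map_part r (\<lambda>a. X a + twist_D \<theta> Z a) = (\<lambda>a. map_part r X a + map_part r (twist_D \<theta> Z) a)" for r
      by (rule ext) (rule map_part_add [OF cX c])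
    have "scaled_bracket \<theta> b b' (\<lambda>a. X a + twist_D \<theta> Z a) Y a
        = scaled_bracket \<theta> b b' X Y a + scaled_bracket \<theta> b b' (twist_D \<theta> Z) Y a"
      unfolding scaled_bracket_def mp
      by (subst exp_wedge_add [OF fin [OF step.hyps(1) cl [OF Y]] fin [OF twist_in_twisted_sums [OF step.hyps(2)] cl [OF Y]], symmetric])
        (simp add: act_def star_linear braided_bracket_add_left cl [OF Y] cX c clinear_map_part)
    then show ?case
      by (simp add: act_add braided_bracket_add_left clinear_act c cX cl [OF Y] step.IH 1 [OF step.hyps(2) b b'])
  qed
  note cX = cl [OF X] and cY = cl [OF Y]
  have 3: "braided_bracket \<theta> (act \<theta> b X) (act \<theta> b' Y) a = scaled_bracket \<theta> b b' X Y a"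
    if b: "b \<in> sphere_alg \<theta>" "b \<in> graded k 0" for b k
  proof -
    have "b' \<in> {x. braided_bracket \<theta> (act \<theta> b X) (act \<theta> x Y) a = scaled_bracket \<theta> b x X Y a}"
    proof (rule lpart_closed)
      show "lpart m b' \<in> {x. braided_bracket \<theta> (act \<theta> b X) (act \<theta> x Y) a = scaled_bracket \<theta> b x X Y a}" for m
        using 2 [OF b sphere_closed(5) [OF b'] sphere_right_weight [OF b']] by simp
      show "0 \<in> {x. braided_bracket \<theta> (act \<theta> b X) (act \<theta> x Y) a = scaled_bracket \<theta> b x X Y a}"
        by (simp add: act_add braided_bracket_zero clinear_act cX scaled_bracket_def clinearD [OF clinear_lpart] star_linear exp_wedge_zero)
      fix x y assume xy: "x \<in> {x. braided_bracket \<theta> (act \<theta> b X) (act \<theta> x Y) a = scaled_bracket \<theta> b x X Y a}"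
        "y \<in> {x. braided_bracket \<theta> (act \<theta> b X) (act \<theta> x Y) a = scaled_bracket \<theta> b x X Y a}"
      have "scaled_bracket \<theta> b (x + y) X Y a = scaled_bracket \<theta> b x X Y a + scaled_bracket \<theta> b y X Y a"
        unfolding scaled_bracket_def
        by (subst exp_wedge_add [OF fin [OF X cY] fin [OF X cY], symmetric])
          (simp add: act_def star_linear clinearD [OF clinear_lpart])
      then show "x + y \<in> {x. braided_bracket \<theta> (act \<theta> b X) (act \<theta> x Y) a = scaled_bracket \<theta> b x X Y a}"
        using xy by (simp add: act_add braided_bracket_add_right clinear_act cX cY)
    qed
    then show ?thesis by simp
  qed
  have "b \<in> {x. braided_bracket \<theta> (act \<theta> x X) (act \<theta> b' Y) a = scaled_bracket \<theta> x b' X Y a}"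
  proof (rule lpart_closed)
    show "lpart m b \<in> {x. braided_bracket \<theta> (act \<theta> x X) (act \<theta> b' Y) a = scaled_bracket \<theta> x b' X Y a}" for m
      using 3 [OF sphere_closed(5) [OF b] sphere_right_weight [OF b]] by simp
    show "0 \<in> {x. braided_bracket \<theta> (act \<theta> x X) (act \<theta> b' Y) a = scaled_bracket \<theta> x b' X Y a}"
      by (simp add: act_add braided_bracket_zero clinear_act cY scaled_bracket_def star_linear exp_wedge_zero)
    fix x y assume xy: "x \<in> {x. braided_bracket \<theta> (act \<theta> x X) (act \<theta> b' Y) a = scaled_bracket \<theta> x b' X Y a}"
      "y \<in> {x. braided_bracket \<theta> (act \<theta> x X) (act \<theta> b' Y) a = scaled_bracket \<theta> x b' X Y a}"
    have "scaled_bracket \<theta> (x + y) b' X Y a = scaled_bracket \<theta> x b' X Y a + scaled_bracket \<theta> y b' X Y a"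
      unfolding scaled_bracket_def
      by (subst exp_wedge_add [OF fin [OF X cY] fin [OF X cY], symmetric]) (simp add: act_def star_linear)
    then show "x + y \<in> {x. braided_bracket \<theta> (act \<theta> x X) (act \<theta> b' Y) a = scaled_bracket \<theta> x b' X Y a}"
      using xy by (simp add: act_add braided_bracket_add_left clinear_act cX cY)
  qed
  then show ?thesis by simp
qed

lemma twist_D_degree_zero: "homogeneous 0 u \<Longrightarrow> twist_D \<theta> u = u"
  using clinear_eqI_graded [of "twist_D \<theta> u" u] by (simp add: fun_eq_iff twist_D_homogeneous clinear_twist_D homogeneousD(1))

lemma twist_D_eq_exp_H:
  assumes "homogeneous r u"
  shows "twist_D \<theta> u = u \<circ> exp_H (\<i> * of_real pi * of_real \<theta> * of_int (snd r)) (- \<i> * of_real pi * of_real \<theta> * of_int (fst r))"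
proof -
  have "exp_H (\<i> * of_real pi * of_real \<theta> * of_int (snd r)) (- \<i> * of_real pi * of_real \<theta> * of_int (fst r))
      = grade_scale (\<lambda>l. phase \<theta> (- wedge r l))"
    by (simp add: fun_eq_iff exp_H_def grade_scale_def phase_def wedge_def algebra_simps)
  then show ?thesis by (simp add: twist_D_homogeneous_eq [OF assms] comp_def)
qed

theorem proposition8p7:
  fixes \<theta> :: real
  shows
    "aut \<theta> = submodule_gen \<theta>
        ({twist_D \<theta> (K_op j) | j. j \<in> {1, 2}} \<union> {twist_D \<theta> (W_op r) | r. r \<in> roots})
     \<and> (\<forall>j\<in>{1, 2}. twist_D \<theta> (K_op j) = K_op j)
     \<and> (\<forall>r\<in>roots. twist_D \<theta> (W_op r) =
          W_op r \<circ> exp_H (\<i> * of_real pi * of_real \<theta> * of_int (snd r)) (- \<i> * of_real pi * of_real \<theta> * of_int (fst r)))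
     \<and> braided_bracket \<theta> (twist_D \<theta> (K_op 1)) (twist_D \<theta> (K_op 2)) = twist_D \<theta> (commutator (K_op 1) (K_op 2))
     \<and> (\<forall>j\<in>{1, 2}. \<forall>r\<in>roots.
          braided_bracket \<theta> (twist_D \<theta> (K_op j)) (twist_D \<theta> (W_op r)) = twist_D \<theta> (commutator (K_op j) (W_op r)))
     \<and> (\<forall>r\<in>roots. \<forall>s\<in>roots.
          braided_bracket \<theta> (twist_D \<theta> (W_op r)) (twist_D \<theta> (W_op s)) =
            (\<lambda>a. phase (- \<theta>) (wedge r s) *\<^sub>C twist_D \<theta> (commutator (W_op r) (W_op s)) a))
     \<and> (\<forall>X\<in>aut \<theta>. \<forall>X'\<in>aut \<theta>. \<forall>b\<in>sphere_alg \<theta>. \<forall>b'\<in>sphere_alg \<theta>.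
          braided_bracket \<theta> (act \<theta> b X) (act \<theta> b' X') =
            (\<lambda>a. exp_wedge (- 2 * \<theta>) (\<lambda>r l.
               act \<theta> (star \<theta> b (lpart l b')) (braided_bracket \<theta> (map_part r X) X') a)))"
proof -
  note K = gauge_derivationD(2) [OF gauge_derivation_K] and W = gauge_derivationD(2) [OF gauge_derivation_W]
  have degree_zero: "braided_bracket \<theta> (twist_D \<theta> u) (twist_D \<theta> v) = twist_D \<theta> (commutator u v)"
    if "homogeneous 0 u" "homogeneous s v" for u v s
    by (rule ext) (simp add: twist_D_bracket [OF that])
  have bilinear: "braided_bracket \<theta> (act \<theta> b X) (act \<theta> b' X') = (\<lambda>a. exp_wedge (- 2 * \<theta>) (\<lambda>r l.
      act \<theta> (star \<theta> b (lpart l b')) (braided_bracket \<theta> (map_part r X) X') a))"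
    if "X \<in> aut \<theta>" "X' \<in> aut \<theta>" "b \<in> sphere_alg \<theta>" "b' \<in> sphere_alg \<theta>" for X X' b b'
    using bracket_act [OF that [unfolded aut_eq_twisted_sums]] unfolding scaled_bracket_def by (rule ext)
  show ?thesis
  proof (intro conjI ballI)
    show "braided_bracket \<theta> (twist_D \<theta> (K_op 1)) (twist_D \<theta> (K_op 2)) = twist_D \<theta> (commutator (K_op 1) (K_op 2))"
      by (rule degree_zero [OF K K]) simp_all
    show "braided_bracket \<theta> (twist_D \<theta> (W_op r)) (twist_D \<theta> (W_op s)) =
        (\<lambda>a. phase (- \<theta>) (wedge r s) *\<^sub>C twist_D \<theta> (commutator (W_op r) (W_op s)) a)"
      if "r \<in> roots" "s \<in> roots" for r s
      by (rule ext) (rule twist_D_bracket [OF W [OF that(1)] W [OF that(2)]])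
  qed (fact aut_eq_module | erule twist_D_degree_zero [OF K] | erule twist_D_eq_exp_H [OF W]
      | erule degree_zero [OF K W] | erule (3) bilinear | assumption)+
qed

end
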